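(* Let $1\le k\le m<2n$. In $U_q^+(\mathfrak{so}_{2n})$ the coproduct of $e[k,m]$ is $$\Delta(e[k,m])=e[k,m]\otimes 1+g_{km}\otimes e[k,m]+\sum_{i=k}^{m-1}\tau_i(1-q^{-1})\,g_{ki}\,e[i+1,m]\otimes e[k,i],$$ where $g_{ki}=\mathrm{gr}(e(k,i))$ is the element of $G$ obtained from the word $e(k,i)$ by substituting $g_\lambda$ for each letter $x_\lambda$, and: $\tau_i=1$ for $i\notin\{n-1,n\}$; $\tau_n=0$ if $k=n$ and $\tau_n=1$ otherwise; $\tau_{n-1}=0$ if $m=n$ and $\tau_{n-1}=p_{n\,n-1}$ otherwise.
   Context: Let $\mathbf{k}$ be a field, $G$ an abelian group, $n\ge3$, $X=\{x_1,\dots,x_n\}$. Fix $g_1,\dots,g_n\in G$ and characters $\chi^1,\dots,\chi^n:G\to\mathbf{k}^*$, $p_{ij}=\chi^i(g_j)$. For words $u,v$ in $X$, $g_u$, $\chi^u$ are obtained by replacing each $x_i$ with $g_i$, resp. $\chi^i$, and $p(u,v)=\chi^u(g_v)$ (bimultiplicative, extended to homogeneous polynomials). $G\langle X\rangle$ is the skew group algebra with $x_ig=\chi^i(g)gx_i$, a Hopf algebra with $\Delta(x_i)=x_i\otimes1+g_i\otimes x_i$, $\Delta(g)=g\otimes g$. Skew bracket: $[u,v]=uv-p(u,v)vu$. Fix $q\in\mathbf{k}^*$, $q\ne-1$, and assume $p_{ii}=q$ ($1\le i\le n$), $p_{i,i-1}p_{i-1,i}=q^{-1}$ ($1<i<n$),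 $p_{n-2,n}p_{n,n-2}=q^{-1}$, $p_{n-1,n}p_{n,n-1}=1$, and $p_{ij}p_{ji}=1$ for all other $i<j$ with $j>i+1$. $U_q^+(\mathfrak{so}_{2n})$ is the quotient Hopf algebra of $G\langle X\rangle$ by the ideal generated by $[x_i,[x_i,x_{i+1}]]$, $[[x_i,x_{i+1}],x_{i+1}]$ ($1\le i\le n-2$), $[x_{n-2},[x_{n-2},x_n]]$, $[[x_{n-2},x_n],x_n]$, $[x_i,x_j]$ for $1\le i<j\le n-1$, $j>i+1$, $[x_i,x_n]$ for $i\le n-3$, and $[x_{n-1},x_n]$. Notation: for $n<i<2n$, $x_i:=x_{2n-i}$, $g_i:=g_{2n-i}$; $\phi(i)=2n-i$. For $1\le k\le m<2n$ the word $e(k,m)$ is: $x_kx_{k+1}\cdots x_m$ if $m<n$ or $k>n$; $x_k\cdots x_{n-2}x_nx_{n+1}\cdots x_m$ if $k<n-1<m$; $x_nx_{n+1}\cdots x_m$ if $k=n-1<m$; $x_nx_{n+2}x_{n+3}\cdots x_m$ if $k=n$ (so $e(n-1,n)=e(n,n)=e(n,n+1)=x_n$). The element $e[k,m]$ is the following bracketing of the letters $y_1y_2\cdots y_r$ of $e(k,m)$ (a one-letter word is left unbracketed): if $m<\phi(k)$, $[[\dots[y_1,y_2],\dots],y_r]$; if $m>\phi(k)$, $[y_1,[y_2,[\dots,[y_{r-1},y_r]\dots]]]$; if $m=\phi(k)\ne n$, $e[k,m]=e[k,m-1]\,x_m-q^{-1}p(e(k,m-1),x_m)\,x_m\,e[k,m-1]$;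 and $e[n,n]=x_n$. *)

theory Defs
  imports Main "HOL-Library.Poly_Mapping"
begin

text \<open>
Model of the skew group algebra G<X> over the field 'k, with G an abelian group
written additively (type 'g :: ab_group_add).  Letters x_1..x_n are natural numbers 1..n.
An element of G<X> is a finitely supported k-linear combination of basis elements
h*w (h in G, w a word), represented as ('g * nat list) =>0 'k.
The tensor square G<X> (x) G<X> is represented on the basis of pairs of basis elements.
The parameters are: chi (chi i is the character chi^i), gg (gg i = g_i).
\<close>

type_synonym ('g) key = "'g \<times> nat list"
type_synonym ('g,'k) alg = "('g key) \<Rightarrow>\<^sub>0 'k"
type_synonym ('g,'k) tens = "('g key \<times> 'g key) \<Rightarrow>\<^sub>0 'k"

definition chi_w :: "(nat \<Rightarrow> 'g::ab_group_add \<Rightarrow> 'k::field) \<Rightarrow> nat list \<Rightarrow> 'g \<Rightarrow> 'k" where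
  "chi_w chi u h = prod_list (map (\<lambda>a. chi a h) u)"

definition gr :: "(nat \<Rightarrow> 'g::ab_group_add) \<Rightarrow> nat list \<Rightarrow> 'g" where
  "gr gg w = sum_list (map gg w)"

definition pw :: "(nat \<Rightarrow> 'g::ab_group_add \<Rightarrow> 'k::field) \<Rightarrow> (nat \<Rightarrow> 'g) \<Rightarrow> nat list \<Rightarrow> nat list \<Rightarrow> 'k" where
  "pw chi gg u v = chi_w chi u (gr gg v)"

definition amul :: "(nat \<Rightarrow> 'g::ab_group_add \<Rightarrow> 'k::field) \<Rightarrow> ('g,'k) alg \<Rightarrow> ('g,'k) alg \<Rightarrow> ('g,'k) alg" where
  "amul chi a b = (\<Sum>P\<in>Poly_Mapping.keys a. \<Sum>Q\<in>Poly_Mapping.keys b.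
      Poly_Mapping.single (fst P + fst Q, snd P @ snd Q)
        (Poly_Mapping.lookup a P * Poly_Mapping.lookup b Q * chi_w chi (snd P) (fst Q)))"

definition aone :: "('g::ab_group_add,'k::field) alg" where
  "aone = Poly_Mapping.single (0, []) 1"

definition grp :: "'g::ab_group_add \<Rightarrow> ('g,'k::field) alg" where
  "grp h = Poly_Mapping.single (h, []) 1"

definition gen :: "nat \<Rightarrow> ('g::ab_group_add,'k::field) alg" where
  "gen i = Poly_Mapping.single (0, [i]) 1"

definition asmult :: "'k::field \<Rightarrow> ('g::ab_group_add,'k) alg \<Rightarrow> ('g,'k) alg" where
  "asmult c a = (\<Sum>P\<in>Poly_Mapping.keys a. Poly_Mapping.single P (c * Poly_Mapping.lookup a P))"

text \<open>skew bracket of homogeneous elements u, v of degrees (words) du, dv\<close>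
definition br :: "(nat \<Rightarrow> 'g::ab_group_add \<Rightarrow> 'k::field) \<Rightarrow> (nat \<Rightarrow> 'g) \<Rightarrow>
    ('g,'k) alg \<Rightarrow> nat list \<Rightarrow> ('g,'k) alg \<Rightarrow> nat list \<Rightarrow> ('g,'k) alg" where
  "br chi gg u du v dv = amul chi u v - asmult (pw chi gg du dv) (amul chi v u)"

definition tensor :: "('g::ab_group_add,'k::field) alg \<Rightarrow> ('g,'k) alg \<Rightarrow> ('g,'k) tens" where
  "tensor a b = (\<Sum>P\<in>Poly_Mapping.keys a. \<Sum>Q\<in>Poly_Mapping.keys b. Poly_Mapping.single (P, Q) (Poly_Mapping.lookup a P * Poly_Mapping.lookup b Q))"

definition tmul :: "(nat \<Rightarrow> 'g::ab_group_add \<Rightarrow> 'k::field) \<Rightarrow> ('g,'k) tens \<Rightarrow> ('g,'k) tens \<Rightarrow> ('g,'k) tens" where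
  "tmul chi S T = (\<Sum>P\<in>Poly_Mapping.keys S. \<Sum>Q\<in>Poly_Mapping.keys T.
      tensor (asmult (Poly_Mapping.lookup S P * Poly_Mapping.lookup T Q)
                 (amul chi (Poly_Mapping.single (fst P) 1) (Poly_Mapping.single (fst Q) 1)))
             (amul chi (Poly_Mapping.single (snd P) 1) (Poly_Mapping.single (snd Q) 1)))"

definition delta_basis :: "(nat \<Rightarrow> 'g::ab_group_add \<Rightarrow> 'k::field) \<Rightarrow> (nat \<Rightarrow> 'g) \<Rightarrow> 'g \<Rightarrow> nat list \<Rightarrow> ('g,'k) tens" where
  "delta_basis chi gg h w = tmul chi (tensor (grp h) (grp h))
      (foldr (\<lambda>i acc. tmul chi (tensor (gen i) aone + tensor (grp (gg i)) (gen i)) acc) w (tensor aone aone))"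

definition Delta :: "(nat \<Rightarrow> 'g::ab_group_add \<Rightarrow> 'k::field) \<Rightarrow> (nat \<Rightarrow> 'g) \<Rightarrow> ('g,'k) alg \<Rightarrow> ('g,'k) tens" where
  "Delta chi gg a = (\<Sum>P\<in>Poly_Mapping.keys a. tmul chi (tensor (asmult (Poly_Mapping.lookup a P) aone) aone) (delta_basis chi gg (fst P) (snd P)))"

inductive_set ideal_gen :: "(nat \<Rightarrow> 'g::ab_group_add \<Rightarrow> 'k::field) \<Rightarrow> ('g,'k) alg set \<Rightarrow> ('g,'k) alg set"
  for chi R where
  gen_in: "r \<in> R \<Longrightarrow> r \<in> ideal_gen chi R"
| zero_in: "0 \<in> ideal_gen chi R"
| add_in: "x \<in> ideal_gen chi R \<Longrightarrow> y \<in> ideal_gen chi R \<Longrightarrow> x + y \<in> ideal_gen chi R"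
| lmul_in: "x \<in> ideal_gen chi R \<Longrightarrow> amul chi a x \<in> ideal_gen chi R"
| rmul_in: "x \<in> ideal_gen chi R \<Longrightarrow> amul chi x a \<in> ideal_gen chi R"

text \<open>kernel I (x) A + A (x) I of the projection G<X>(x)G<X> \<rightarrow> U(x)U (linear span)\<close>
inductive_set tens_ker :: "('g::ab_group_add,'k::field) alg set \<Rightarrow> ('g,'k) tens set"
  for I where
  zero_k: "0 \<in> tens_ker I"
| left_k: "a \<in> I \<Longrightarrow> tensor a b \<in> tens_ker I"
| right_k: "b \<in> I \<Longrightarrow> tensor a b \<in> tens_ker I"
| add_k: "x \<in> tens_ker I \<Longrightarrow> y \<in> tens_ker I \<Longrightarrow> x + y \<in> tens_ker I"

definition relators :: "(nat \<Rightarrow> 'g::ab_group_add \<Rightarrow> 'k::field) \<Rightarrow> (nat \<Rightarrow> 'g) \<Rightarrow> nat \<Rightarrow> ('g,'k) alg set" where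
  "relators chi gg n =
     {br chi gg (gen i) [i] (br chi gg (gen i) [i] (gen (i+1)) [i+1]) [i,i+1] | i. 1 \<le> i \<and> i \<le> n - 2}
   \<union> {br chi gg (br chi gg (gen i) [i] (gen (i+1)) [i+1]) [i,i+1] (gen (i+1)) [i+1] | i. 1 \<le> i \<and> i \<le> n - 2}
   \<union> {br chi gg (gen (n-2)) [n-2] (br chi gg (gen (n-2)) [n-2] (gen n) [n]) [n-2,n],
      br chi gg (br chi gg (gen (n-2)) [n-2] (gen n) [n]) [n-2,n] (gen n) [n]}
   \<union> {br chi gg (gen i) [i] (gen j) [j] | i j. 1 \<le> i \<and> i < j \<and> j \<le> n - 1 \<and> j > i + 1}
   \<union> {br chi gg (gen i) [i] (gen n) [n] | i. 1 \<le> i \<and> i \<le> n - 3}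
   \<union> {br chi gg (gen (n-1)) [n-1] (gen n) [n]}"

text \<open>index convention: for n < i < 2n, x_i := x_{2n-i}\<close>
definition lt :: "nat \<Rightarrow> nat \<Rightarrow> nat" where
  "lt n i = (if i \<le> n then i else 2*n - i)"

definition ew :: "nat \<Rightarrow> nat \<Rightarrow> nat \<Rightarrow> nat list" where
  "ew n k m =
    (if m < n \<or> k > n then map (lt n) [k..<m+1]
     else if k < n - 1 \<and> n - 1 < m then [k..<n-1] @ [n] @ map (lt n) [n+1..<m+1]
     else if k = n - 1 \<and> n - 1 < m then [n] @ map (lt n) [n+1..<m+1]
     else [n] @ map (lt n) [n+2..<m+1])"

fun lbr_acc :: "(nat \<Rightarrow> 'g::ab_group_add \<Rightarrow> 'k::field) \<Rightarrow> (nat \<Rightarrow> 'g) \<Rightarrow> ('g,'k) alg \<Rightarrow> nat list \<Rightarrow> nat list \<Rightarrow> ('g,'k) alg" where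
  "lbr_acc chi gg acc dacc [] = acc"
| "lbr_acc chi gg acc dacc (y # ys) = lbr_acc chi gg (br chi gg acc dacc (gen y) [y]) (dacc @ [y]) ys"

fun lbr :: "(nat \<Rightarrow> 'g::ab_group_add \<Rightarrow> 'k::field) \<Rightarrow> (nat \<Rightarrow> 'g) \<Rightarrow> nat list \<Rightarrow> ('g,'k) alg" where
  "lbr chi gg [] = aone"
| "lbr chi gg (y # ys) = lbr_acc chi gg (gen y) [y] ys"

fun rbr :: "(nat \<Rightarrow> 'g::ab_group_add \<Rightarrow> 'k::field) \<Rightarrow> (nat \<Rightarrow> 'g) \<Rightarrow> nat list \<Rightarrow> ('g,'k) alg" where
  "rbr chi gg [] = aone"
| "rbr chi gg [y] = gen y"
| "rbr chi gg (y # z # ys) = br chi gg (gen y) [y] (rbr chi gg (z # ys)) (z # ys)"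

text \<open>the element e[k,m] (a representative in G<X>)\<close>
definition ebr :: "(nat \<Rightarrow> 'g::ab_group_add \<Rightarrow> 'k::field) \<Rightarrow> (nat \<Rightarrow> 'g) \<Rightarrow> nat \<Rightarrow> 'k \<Rightarrow> nat \<Rightarrow> nat \<Rightarrow> ('g,'k) alg" where
  "ebr chi gg n q k m =
    (if m < 2*n - k then lbr chi gg (ew n k m)
     else if m > 2*n - k then rbr chi gg (ew n k m)
     else if m \<noteq> n then
       amul chi (lbr chi gg (ew n k (m-1))) (gen (lt n m))
       - asmult (inverse q * pw chi gg (ew n k (m-1)) [lt n m])
           (amul chi (gen (lt n m)) (lbr chi gg (ew n k (m-1))))
     else gen n)"

definition tau :: "(nat \<Rightarrow> 'g::ab_group_add \<Rightarrow> 'k::field) \<Rightarrow> (nat \<Rightarrow> 'g) \<Rightarrow> nat \<Rightarrow> nat \<Rightarrow> nat \<Rightarrow> nat \<Rightarrow> 'k" where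
  "tau chi gg n k m i =
    (if i = n then (if k = n then 0 else 1)
     else if i = n - 1 then (if m = n then 0 else chi n (gg (n-1)))
     else 1)"

end

theory Submission
  imports Defs "HOL-Library.Multiset"
begin

text \<open>
  All brackets live in the free algebra \<open>k\<langle>X\<rangle>\<close>, so \<open>G\<langle>X\<rangle> \<otimes> G\<langle>X\<rangle>\<close> is only needed on the
  elements \<open>h b \<otimes> a\<close> with \<open>h \<in> G\<close> and \<open>a, b\<close> in the free algebra. Bracketing such an element with
  \<open>\<Delta>(x) = x \<otimes> 1 + g\<^sub>x \<otimes> x\<close> gives two terms: one brackets \<open>b\<close> with \<open>x\<close> (with coefficient twisted by
  \<open>p(a,x) p(x,a)\<close>), the other brackets \<open>a\<close> with \<open>x\<close>. Adding one letter to \<open>e[k,m]\<close>, on the right if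
  \<open>m \<le> 2n - k\<close> and on the left otherwise, nearly all these terms vanish modulo the relations or are
  terms of the claimed sum. A single index is different; there two terms merge by the identity
  \<open>e[l+1,2n-l] = q r e[l,2n-l-1] + b x\<^sub>l - q r x\<^sub>l b\<close>, where \<open>b = e[l+1,2n-l-1]\<close> and \<open>r = p(b,x\<^sub>l)\<close>.
  The vanishing terms are handled by the fact that, for \<open>q \<noteq> -1\<close>, Serre relations make the middle letter
  of \<open>[[x,y],z]\<close> skew commute with it.
\<close>

section \<open>Finitely supported functions and bilinear operations\<close>

text \<open>The obstacle is the line m = 2n - k, where the bracketing of \<open>e[k,m]\<close>
  changes side. When x_j with j = 2n - m - 1 > k is appended to \<open>e[k,m]\<close>, the tail
  \<open>e[i+1,m]\<close> of the i-th summand stays left-bracketed for i + 1 < j, makes the defining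
  step with q^{-1} for i + 1 = j, and is already beyond the line for i > j. At i = j it leaves the
  line, and there one bracket with x_j does not give \<open>e[j+1,m+1]\<close>. The missing part
  comes from the summand i = j - 1, whose second factor has become [e[k,j-1], x_j] = e[k,j]. This is
  why two terms must merge at one index.

  The scalar 1 - q^{-1} arises as 1 - p(d,x) p(x,d) for a word d whose letters q and q^{-1}
  contributions, read off from the diagram, balance to q^{-1}; on the line the defining factor
  q^{-1} does the same for a product equal to 1.

  The scalar p(x_n,x_{n-1}) in tau has its origin in the skipped position n - 1: cutting
  \<open>e(k,m)\<close>, m > n, at i = n - 1 puts x_{n-1} before x_n, while the word itself has x_n
  before x_{n-1}.\<close>

instantiation list :: (type) monoid_add
begin
definition zero_list :: "'a list" where "zero_list = []"
definition plus_list :: "'a list \<Rightarrow> 'a list \<Rightarrow> 'a list" where "plus_list u v = u @ v"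
instance by standard (simp_all add: zero_list_def plus_list_def)
end

lemma poly_mapping_eq_sum_single:
  "(\<Sum>w\<in>Poly_Mapping.keys u. Poly_Mapping.single w (Poly_Mapping.lookup u w)) = u"
proof (rule poly_mapping_eqI)
  fix k
  have "Poly_Mapping.lookup (\<Sum>w\<in>Poly_Mapping.keys u. Poly_Mapping.single w (Poly_Mapping.lookup u w)) k
      = (\<Sum>w\<in>Poly_Mapping.keys u. if w = k then Poly_Mapping.lookup u w else 0)"
    by (simp add: lookup_sum lookup_single when_def)
  also have "\<dots> = Poly_Mapping.lookup u k"
    by (simp add: in_keys_iff)
  finally show "Poly_Mapping.lookup (\<Sum>w\<in>Poly_Mapping.keys u. Poly_Mapping.single w (Poly_Mapping.lookup u w)) k
      = Poly_Mapping.lookup u k" .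
qed

text \<open>The monomials are restricted to those occurring in \<open>u\<close>, so that an
  induction over a homogeneous element only meets monomials of its degree.\<close>

lemma poly_mapping_induct_single [case_names zero add single]:
  fixes u :: "'a \<Rightarrow>\<^sub>0 'b::comm_monoid_add"
  assumes zero: "P 0" and add: "\<And>u v. P u \<Longrightarrow> P v \<Longrightarrow> P (u + v)"
    and single: "\<And>w c. w \<in> Poly_Mapping.keys u \<Longrightarrow> P (Poly_Mapping.single w c)"
  shows "P u"
proof -
  have "P (\<Sum>w\<in>K. Poly_Mapping.single w (Poly_Mapping.lookup u w))" if "K \<subseteq> Poly_Mapping.keys u" for K
    using finite_subset[OF that finite_keys] that
    by (induction K rule: finite_induct) (auto intro: zero add single)
  from this[OF order_refl] show ?thesis
    by (simp add: poly_mapping_eq_sum_single)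
qed

text \<open>The coefficients of the monomials are arbitrary, so additivity suffices and no linearity
  over the field has to be shown. Most bilinear identities below are checked on monomials in this
  way.\<close>

lemma additive_eqI:
  fixes f g :: "('a \<Rightarrow>\<^sub>0 'b::comm_monoid_add) \<Rightarrow> 'c::cancel_comm_monoid_add"
  assumes f: "\<And>u v. f (u + v) = f u + f v" and g: "\<And>u v. g (u + v) = g u + g v"
    and s: "\<And>w c. w \<in> Poly_Mapping.keys u \<Longrightarrow> f (Poly_Mapping.single w c) = g (Poly_Mapping.single w c)"
  shows "f u = g u"
proof (induction u rule: poly_mapping_induct_single)
  case zero
  have "f 0 = 0" "g 0 = 0"
    using f[of 0 0] g[of 0 0] by simp_all
  then show ?case by simp
next
  case (add u v)
  then show ?case by (simp add: f g)
qed (rule s)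

lemma sum_keys_single:
  assumes "f w 0 = 0"
  shows "(\<Sum>P\<in>Poly_Mapping.keys (Poly_Mapping.single w c). f P (Poly_Mapping.lookup (Poly_Mapping.single w c) P)) = f w c"
  using assms by simp

lemma additive_zero:
  fixes f :: "'a::monoid_add \<Rightarrow> 'b::cancel_comm_monoid_add"
  assumes "\<And>u v. f (u + v) = f u + f v"
  shows "f 0 = 0"
  using assms[of 0 0] by simp

lemma additive_uminus:
  fixes f :: "'a::ab_group_add \<Rightarrow> 'b::ab_group_add"
  assumes "\<And>u v. f (u + v) = f u + f v"
  shows "f (- u) = - f u"
proof -
  have "f (- u) + f u = 0"
    using assms[of "- u" u] additive_zero[of f, OF assms] by simp
  then show ?thesis
    by (simp add: eq_neg_iff_add_eq_0)
qed

lemma additive_diff: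
  fixes f :: "'a::ab_group_add \<Rightarrow> 'b::ab_group_add"
  assumes "\<And>u v. f (u + v) = f u + f v"
  shows "f (u - v) = f u - f v"
  using assms[of u "- v"] additive_uminus[of f v, OF assms] by simp

lemma additive_sum:
  fixes f :: "'a::comm_monoid_add \<Rightarrow> 'b::cancel_comm_monoid_add"
  assumes "\<And>u v. f (u + v) = f u + f v"
  shows "f (sum g K) = (\<Sum>i\<in>K. f (g i))"
  by (induction K rule: infinite_finite_induct) (simp_all add: assms additive_zero[of f, OF assms])

lemma asmult_single: "asmult c (Poly_Mapping.single P d) = Poly_Mapping.single P (c * d)"
  unfolding asmult_def by (rule sum_keys_single) simp

lemma asmult_add: "asmult c (a + b) = asmult c a + asmult c b"
  unfolding asmult_def by (rule setsum_keys_plus_distrib) (simp_all add: algebra_simps single_add)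

lemma amul_add_left: "amul chi (a + b) c = amul chi a c + amul chi b c"
  unfolding amul_def by (rule setsum_keys_plus_distrib)
    (simp_all add: algebra_simps single_add sum.distrib)

lemma amul_add_right: "amul chi a (b + c) = amul chi a b + amul chi a c"
  unfolding amul_def sum.distrib[symmetric]
  by (rule sum.cong[OF refl], rule setsum_keys_plus_distrib) (simp_all add: algebra_simps single_add)

lemma amul_single:
  "amul chi (Poly_Mapping.single P c) (Poly_Mapping.single Q d)
    = Poly_Mapping.single (fst P + fst Q, snd P @ snd Q) (c * d * chi_w chi (snd P) (fst Q))"
  by (simp add: amul_def)

lemma tensor_add_left: "tensor (a + b) c = tensor a c + tensor b c"
  unfolding tensor_def by (rule setsum_keys_plus_distrib)
    (simp_all add: algebra_simps single_add sum.distrib)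

lemma tensor_add_right: "tensor a (b + c) = tensor a b + tensor a c"
  unfolding tensor_def sum.distrib[symmetric]
  by (rule sum.cong[OF refl], rule setsum_keys_plus_distrib) (simp_all add: algebra_simps single_add)

lemma tensor_single:
  "tensor (Poly_Mapping.single P c) (Poly_Mapping.single Q d) = Poly_Mapping.single (P, Q) (c * d)"
  by (simp add: tensor_def)

lemma zero_mul [simp]:
  "amul chi 0 b = 0" "amul chi b 0 = 0" "tensor 0 b = 0" "tensor b 0 = 0" "asmult c 0 = 0"
  "tmul chi 0 S = 0" "tmul chi S 0 = 0" "asmult 0 a = 0"
  by (simp_all add: amul_def tensor_def asmult_def tmul_def)

lemmas tensor_diff_left = additive_diff[of "\<lambda>a. tensor a c" for c, OF tensor_add_left]
lemmas tensor_diff_right = additive_diff[of "tensor a" for a, OF tensor_add_right]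
lemmas tensor_uminus_left = additive_uminus[of "\<lambda>a. tensor a c" for c, OF tensor_add_left]

lemma asmult_add_scalar: "asmult (c + d) a = asmult c a + asmult d a"
  by (simp add: asmult_def algebra_simps single_add sum.distrib)

lemma amul_asmult_left: "amul chi (asmult c a) b = asmult c (amul chi a b)"
proof (rule additive_eqI[where u = a])
  fix w d
  show "amul chi (asmult c (Poly_Mapping.single w d)) b = asmult c (amul chi (Poly_Mapping.single w d) b)"
    by (rule additive_eqI[where u = b])
      (simp_all add: amul_add_right asmult_add asmult_single amul_single mult.assoc)
qed (simp_all add: amul_add_left asmult_add)

lemma tensor_asmult: "tensor (asmult c a) b = tensor a (asmult c b)"
proof (rule additive_eqI[where u = a])
  fix w d
  show "tensor (asmult c (Poly_Mapping.single w d)) b = tensor (Poly_Mapping.single w d) (asmult c b)"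
    by (rule additive_eqI[where u = b])
      (simp_all add: tensor_add_right asmult_add asmult_single tensor_single mult_ac)
qed (simp_all add: tensor_add_left asmult_add)

lemma tmul_add_left: "tmul chi (S + S') T = tmul chi S T + tmul chi S' T"
  unfolding tmul_def by (rule setsum_keys_plus_distrib)
    (simp_all add: algebra_simps asmult_add_scalar tensor_add_left sum.distrib)

lemma tmul_add_right: "tmul chi S (T + T') = tmul chi S T + tmul chi S T'"
  unfolding tmul_def sum.distrib[symmetric]
  by (rule sum.cong[OF refl], rule setsum_keys_plus_distrib)
    (simp_all add: algebra_simps asmult_add_scalar tensor_add_left)

lemmas tmul_diff_left = additive_diff[of "\<lambda>a. tmul chi a c" for chi c, OF tmul_add_left]
lemmas tmul_diff_right = additive_diff[of "tmul chi a" for chi a, OF tmul_add_right]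

lemma tmul_single:
  "tmul chi (Poly_Mapping.single P c) (Poly_Mapping.single Q d)
    = tensor (amul chi (Poly_Mapping.single (fst P) c) (Poly_Mapping.single (fst Q) d))
             (amul chi (Poly_Mapping.single (snd P) 1) (Poly_Mapping.single (snd Q) 1))"
  by (simp add: tmul_def asmult_single amul_single)

lemma tmul_tensor:
  "tmul chi (tensor a b) (tensor c d) = tensor (amul chi a c) (amul chi b d)"
proof (rule additive_eqI[where u = a])
  fix P p
  show "tmul chi (tensor (Poly_Mapping.single P p) b) (tensor c d)
    = tensor (amul chi (Poly_Mapping.single P p) c) (amul chi b d)"
  proof (rule additive_eqI[where u = b])
    fix Q r
    show "tmul chi (tensor (Poly_Mapping.single P p) (Poly_Mapping.single Q r)) (tensor c d)
      = tensor (amul chi (Poly_Mapping.single P p) c) (amul chi (Poly_Mapping.single Q r) d)"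
    proof (rule additive_eqI[where u = c])
      fix R s
      show "tmul chi (tensor (Poly_Mapping.single P p) (Poly_Mapping.single Q r))
             (tensor (Poly_Mapping.single R s) d)
        = tensor (amul chi (Poly_Mapping.single P p) (Poly_Mapping.single R s))
            (amul chi (Poly_Mapping.single Q r) d)"
        by (rule additive_eqI[where u = d])
          (simp_all add: tensor_add_right tmul_add_right amul_add_right tensor_single tmul_single
             amul_single mult_ac)
    qed (simp_all add: tensor_add_left tmul_add_right amul_add_right)
  qed (simp_all add: tensor_add_right tensor_add_left tmul_add_left amul_add_left)
qed (simp_all add: tensor_add_left tmul_add_left amul_add_left)

lemma Delta_add: "Delta chi gg (a + b) = Delta chi gg a + Delta chi gg b"
  unfolding Delta_def by (rule setsum_keys_plus_distrib)
    (simp_all add: asmult_add_scalar tensor_add_left tmul_add_left)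

lemma Delta_single:
  "Delta chi gg (Poly_Mapping.single P c)
    = tmul chi (tensor (asmult c aone) aone) (delta_basis chi gg (fst P) (snd P))"
  by (simp add: Delta_def)

lemma Delta_zero [simp]: "Delta chi gg 0 = 0"
  by (simp add: Delta_def)

section \<open>Ideals and the kernel on the tensor square\<close>

text \<open>A scalar acts as multiplication by a multiple of 1. This closes \<open>ideal_gen\<close>
  under scalars and negation, for which it has no rule.\<close>

lemma asmult_eq_amul: "asmult c a = amul chi (Poly_Mapping.single (0, []) c) a"
  by (rule additive_eqI[where u = a])
    (simp_all add: asmult_add amul_add_right asmult_single amul_single chi_w_def)

lemma ideal_asmult: "x \<in> ideal_gen chi R \<Longrightarrow> asmult c x \<in> ideal_gen chi R"
  unfolding asmult_eq_amul[of c x chi] by (rule ideal_gen.lmul_in)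

lemma asmult_minus_one: "asmult (- 1) a = - (a :: ('g::ab_group_add, 'k::field) alg)"
proof (rule additive_eqI[where u = a])
  fix w :: "'g key" and c :: 'k
  show "asmult (- 1) (Poly_Mapping.single w c) = - Poly_Mapping.single w c"
    by (simp add: asmult_single single_uminus)
qed (simp_all add: asmult_add)

lemma ideal_uminus: "x \<in> ideal_gen chi R \<Longrightarrow> - x \<in> ideal_gen chi R"
  using ideal_asmult[of x chi R "- 1"] by (simp add: asmult_minus_one)

text \<open>The rules of \<open>tens_ker\<close> only form sums of pure tensors; the sign is
  absorbed into the left leg of each of them.\<close>

lemma tens_ker_uminus:
  assumes "x \<in> tens_ker (ideal_gen chi R)"
  shows "- x \<in> tens_ker (ideal_gen chi R)"
  using assms
proof induction
  case (left_k a b)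
  have "tensor (- a) b \<in> tens_ker (ideal_gen chi R)"
    by (intro tens_ker.left_k ideal_uminus left_k)
  then show ?case by (simp add: tensor_uminus_left)
next
  case (right_k b a)
  have "tensor (- a) b \<in> tens_ker (ideal_gen chi R)"
    by (intro tens_ker.right_k right_k)
  then show ?case by (simp add: tensor_uminus_left)
next
  case (add_k x y)
  then have "- x + - y \<in> tens_ker (ideal_gen chi R)"
    by (intro tens_ker.add_k)
  then show ?case by simp
qed (simp add: tens_ker.zero_k)

lemma tens_induct [case_names zero add tensor]:
  assumes zero: "P 0" and add: "\<And>u v. P u \<Longrightarrow> P v \<Longrightarrow> P (u + v)"
    and tensor: "\<And>a b. P (tensor a b)"
  shows "P S"
proof (induction S rule: poly_mapping_induct_single)
  case (single w c)
  show ?case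
    using tensor[of "Poly_Mapping.single (fst w) c" "Poly_Mapping.single (snd w) 1"]
    by (simp add: tensor_single)
qed (auto intro: zero add)

text \<open>One leg of each generator stays in the ideal under multiplication by pure tensors, and
  these span the tensor square. Hence a congruence may be multiplied by the coproduct of a
  letter.\<close>

lemma tens_ker_tmul:
  assumes "x \<in> tens_ker (ideal_gen chi R)"
  shows "tmul chi x S \<in> tens_ker (ideal_gen chi R)" "tmul chi S x \<in> tens_ker (ideal_gen chi R)"
  using assms
proof induction
  case (left_k a b)
  {
    case 1
    show ?case
      by (induction S rule: tens_induct) (auto simp: tmul_add_right tmul_tensor
        intro: tens_ker.intros ideal_gen.intros left_k)
  next
    case 2
    show ?case
      by (induction S rule: tens_induct) (auto simp: tmul_add_left tmul_tensor
        intro: tens_ker.intros ideal_gen.intros left_k)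
  }
next
  case (right_k b a)
  {
    case 1
    show ?case
      by (induction S rule: tens_induct) (auto simp: tmul_add_right tmul_tensor
        intro: tens_ker.intros ideal_gen.intros right_k)
  next
    case 2
    show ?case
      by (induction S rule: tens_induct) (auto simp: tmul_add_left tmul_tensor
        intro: tens_ker.intros ideal_gen.intros right_k)
  }
qed (auto simp: tmul_add_left tmul_add_right intro: tens_ker.intros)

section \<open>Skew brackets in the free algebra\<close>

text \<open>The product of polynomial mappings is convolution along the addition of keys. With
  concatenation as addition of lists this is the product of the free algebra, and the ring laws come
  with it.\<close>

type_synonym 'k free_alg = "nat list \<Rightarrow>\<^sub>0 'k"

definition sm :: "'k::field \<Rightarrow> 'k free_alg \<Rightarrow> 'k free_alg" where
  "sm c u = Poly_Mapping.single 0 c * u"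

lemma sm_add: "sm c (u + v) = sm c u + sm c v"
  by (simp add: sm_def distrib_left)

lemma sm_diff: "sm c (u - v) = sm c u - sm c v"
  by (simp add: sm_def right_diff_distrib)

lemma sm_uminus: "sm c (- u) = - sm c u"
  by (simp add: sm_def)

lemma sm_zero [simp]: "sm c 0 = 0"
  by (simp add: sm_def)

lemma sm_zero_left [simp]: "sm 0 u = 0"
  by (simp add: sm_def)

lemma sm_one [simp]: "sm 1 u = u"
  by (simp add: sm_def)

lemma sm_add_left: "sm (c + d) u = sm c u + sm d u"
  by (simp add: sm_def single_add distrib_right)

lemma sm_diff_left: "sm (c - d) u = sm c u - sm d u"
  by (simp add: sm_def single_diff left_diff_distrib)

lemma sm_uminus_left: "sm (- d) u = - sm d u"
  by (simp add: sm_def single_uminus)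

lemma sm_sm: "sm c (sm d u) = sm (c * d) u"
  by (simp add: sm_def mult.assoc[symmetric] mult_single)

lemma sm_single: "sm c (Poly_Mapping.single w d) = Poly_Mapping.single w (c * d)"
  by (simp add: sm_def mult_single)

lemma sm_mult_left: "sm c u * v = sm c (u * v)"
  by (simp add: sm_def mult.assoc)

lemma sm_mult_right: "u * sm c v = sm c (u * v)"
proof -
  have "u * Poly_Mapping.single 0 c = Poly_Mapping.single 0 c * u"
    by (rule additive_eqI[where u = u]) (simp_all add: distrib_left distrib_right mult_single mult.commute)
  then show ?thesis
    by (simp add: sm_def mult.assoc[symmetric])
qed

lemmas sm_simps = sm_add sm_diff sm_uminus sm_sm sm_mult_left sm_mult_right sm_add_left sm_diff_left
  sm_uminus_left algebra_simps

text \<open>The scalar is an argument instead of being computed from degrees. Identities then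
  involve field elements only, and the bracket with the additional q^{-1} is an instance as
  well.\<close>

definition B :: "'k::field \<Rightarrow> 'k free_alg \<Rightarrow> 'k free_alg \<Rightarrow> 'k free_alg" where
  "B p u v = u * v - sm p (v * u)"

lemma B_sm_right: "B p u (sm c v) = sm c (B p u v)"
  by (simp add: B_def sm_simps)

lemma B_sm_left: "B p (sm c u) v = sm c (B p u v)"
  by (simp add: B_def sm_simps)

text \<open>The relations are abstracted to an arbitrary two-sided ideal; this separates the
  noncommutative identities from the combinatorics of words.\<close>

locale free_alg_ideal =
  fixes J :: "'k::field free_alg set"
  assumes J_0: "0 \<in> J"
    and J_add: "u \<in> J \<Longrightarrow> v \<in> J \<Longrightarrow> u + v \<in> J"
    and J_lmult: "u \<in> J \<Longrightarrow> a * u \<in> J"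
    and J_rmult: "u \<in> J \<Longrightarrow> u * a \<in> J"
begin

lemma J_sm: "u \<in> J \<Longrightarrow> sm c u \<in> J"
  unfolding sm_def by (rule J_lmult)

lemma J_uminus: "u \<in> J \<Longrightarrow> - u \<in> J"
  using J_sm[of u "- 1"] by (simp add: sm_uminus_left)

lemma J_diff: "u \<in> J \<Longrightarrow> v \<in> J \<Longrightarrow> u - v \<in> J"
  using J_add[OF _ J_uminus, of u v] by simp

lemmas J_intros = J_0 J_add J_diff J_uminus J_sm J_lmult J_rmult

lemma J_sm_cancel: "sm c u \<in> J \<Longrightarrow> c \<noteq> 0 \<Longrightarrow> u \<in> J"
  using J_sm[of "sm c u" "inverse c"] by (simp add: sm_sm)

definition cong (infix "\<approx>" 50) where "u \<approx> v \<longleftrightarrow> u - v \<in> J"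

lemma cong_refl [simp]: "u \<approx> u"
  by (simp add: cong_def J_0)

lemma cong_sym: "u \<approx> v \<Longrightarrow> v \<approx> u"
  using J_uminus[of "u - v"] by (simp add: cong_def)

lemma cong_trans [trans]: "u \<approx> v \<Longrightarrow> v \<approx> w \<Longrightarrow> u \<approx> w"
  using J_add[of "u - v" "v - w"] by (simp add: cong_def)

lemma cong_J: "u \<approx> v \<Longrightarrow> v \<in> J \<Longrightarrow> u \<in> J"
  using J_add[of "u - v" v] by (simp add: cong_def)

lemma cong_add: "u \<approx> v \<Longrightarrow> u' \<approx> v' \<Longrightarrow> u + u' \<approx> v + v'"
  using J_add[of "u - v" "u' - v'"] by (simp add: cong_def algebra_simps)

lemma cong_diff: "u \<approx> v \<Longrightarrow> u' \<approx> v' \<Longrightarrow> u - u' \<approx> v - v'"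
  using J_diff[of "u - v" "u' - v'"] by (simp add: cong_def algebra_simps)

lemma cong_sm: "u \<approx> v \<Longrightarrow> sm c u \<approx> sm c v"
  using J_sm[of "u - v" c] by (simp add: cong_def sm_diff)

lemma cong_mult:
  assumes "u \<approx> v" "u' \<approx> v'"
  shows "u * u' \<approx> v * v'"
proof -
  have "u * u' - v * v' = (u - v) * u' + v * (u' - v')"
    by (simp add: algebra_simps)
  also have "\<dots> \<in> J"
    using assms by (auto simp: cong_def intro: J_add J_lmult J_rmult)
  finally show ?thesis by (simp add: cong_def)
qed

lemma cong_B: "u \<approx> v \<Longrightarrow> u' \<approx> v' \<Longrightarrow> B p u u' \<approx> B p v v'"
  unfolding B_def by (intro cong_diff cong_mult cong_sm)

lemma B_in_J_right: "v \<in> J \<Longrightarrow> B p u v \<in> J"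
  unfolding B_def by (intro J_intros)

lemma B_in_J_left: "u \<in> J \<Longrightarrow> B p u v \<in> J"
  unfolding B_def by (intro J_intros)

text \<open>The two bracketings of u v w differ by \<open>pvw [u,w] v - puv v [u,w]\<close>, so
  brackets can be reassociated whenever the outer two elements skew commute.\<close>

lemma B_assoc:
  assumes "B puw u w \<in> J"
  shows "B (puw * pvw) (B puv u v) w \<approx> B (puv * puw) u (B pvw v w)"
proof -
  have "B (puw * pvw) (B puv u v) w - B (puv * puw) u (B pvw v w)
     = sm pvw (B puw u w * v) - sm puv (v * B puw u w)"
    by (simp add: B_def sm_simps)
  also have "\<dots> \<in> J"
    by (intro J_intros assms)
  finally show ?thesis by (simp add: cong_def)
qed

lemma B_commute:
  assumes "B p u v \<in> J" "p * p' = 1"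
  shows "B p' v u \<in> J"
proof -
  have "B p' v u = sm (- p') (B p u v)"
    using assms(2) by (simp add: B_def sm_simps)
  then show ?thesis
    using J_sm[OF assms(1), of "- p'"] by simp
qed

lemma B_mult_commute:
  assumes "B p u z \<in> J" "B p' v z \<in> J"
  shows "B (p * p') (u * v) z \<in> J"
proof -
  have "B (p * p') (u * v) z = u * B p' v z + sm p' (B p u z * v)"
    by (simp add: B_def sm_simps)
  also have "\<dots> \<in> J"
    by (intro J_intros assms)
  finally show ?thesis .
qed

text \<open>Both Serre elements are combinations of y x x, x y x and x x y. With a = p(y,x), b =
  p(x,y) and a b q = 1 their coefficients are proportional, with factor
  \<open>q * b * b\<close>.\<close>

lemma serre_left_to_right:
  assumes "B (a * q) (B a y x) x \<in> J" "a * b * q = 1"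
  shows "B (q * b) x (B b x y) \<in> J"
proof -
  have c: "q * b * b * (a * (1 + q)) = b * (1 + q)" "q * b * b * (a * a * q) = 1"
    using assms(2) by algebra+
  have e: "B (a * q) (B a y x) x = y * x * x - sm (a * (1 + q)) (x * y * x) + sm (a * a * q) (x * x * y)"
    by (simp add: B_def sm_simps)
  have "sm (q * b * b) (B (a * q) (B a y x) x)
      = sm (q * b * b) (y * x * x) - sm (b * (1 + q)) (x * y * x) + x * x * y"
    unfolding e sm_add sm_diff sm_sm c by simp
  also have "\<dots> = B (q * b) x (B b x y)"
    by (simp add: B_def sm_simps)
  finally show ?thesis
    using J_sm[OF assms(1), of "q * b * b"] by simp
qed

lemma serre_right_to_left:
  assumes "B (q * b) x (B b x y) \<in> J" "a * b * q = 1"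
  shows "B (a * q) (B a y x) x \<in> J"
proof -
  have c: "a * a * q * (b * (1 + q)) = a * (1 + q)" "a * a * q * (b * b * q) = 1"
    using assms(2) by algebra+
  have e: "B (q * b) x (B b x y) = sm (b * b * q) (y * x * x) - sm (b * (1 + q)) (x * y * x) + x * x * y"
    by (simp add: B_def sm_simps)
  have "sm (a * a * q) (B (q * b) x (B b x y))
      = y * x * x - sm (a * (1 + q)) (x * y * x) + sm (a * a * q) (x * x * y)"
    unfolding e sm_add sm_diff sm_sm c by simp
  also have "\<dots> = B (a * q) (B a y x) x"
    by (simp add: B_def sm_simps)
  finally show ?thesis
    using J_sm[OF assms(1), of "a * a * q"] by simp
qed

text \<open>
  With \<open>T = [[x,y],z]\<close> and \<open>K = [[x,y],[y,z]]\<close>, the two Serre relations give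
  \<open>p(y,z) T y + K = q p(x,y) y T\<close> and \<open>p(x,y) y T + K = q p(y,z) T y\<close>;
  their difference is divisible by \<open>1 + q\<close>.
\<close>

lemma middle_letter_commutes:
  assumes xz: "B pxz x z \<in> J"
    and left: "B (pxy * q) (B pxy x y) y \<in> J"
    and right: "B (q * pyz) y (B pyz y z) \<in> J"
    and inv: "pyz * pzy * q = 1" and q: "1 + q \<noteq> 0"
  shows "B (pxy * q * pzy) (B (pxz * pyz) (B pxy x y) z) y \<in> J"
proof -
  let ?a = "B pxy x y" and ?c = "B pyz y z"
  let ?l = "B (pxy * q) ?a y" and ?r = "B (q * pyz) y ?c"
  let ?T = "B (pxz * pyz) ?a z" and ?S = "B (pxy * pxz) x ?c"
  let ?K = "?a * ?c - sm (q * pxy * pxz * pyz) (?c * ?a)"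
  have TS: "?T \<approx> ?S"
    by (rule B_assoc[OF xz])
  have "sm pyz (?T * y) - sm (q * pxy) (y * ?T) + ?K = ?l * z - sm (pyz * pxz * pyz) (z * ?l)"
    by (simp add: B_def sm_simps)
  also have "\<dots> \<in> J"
    by (intro J_intros left)
  finally have 1: "sm pyz (?T * y) - sm (q * pxy) (y * ?T) + ?K \<in> J" .
  have "sm pxy (y * ?S) - sm (q * pyz) (?S * y) + ?K = x * ?r - sm (pxy * pxz * pxy) (?r * x)"
    by (simp add: B_def sm_simps)
  also have "\<dots> \<in> J"
    by (intro J_intros right)
  finally have "sm pxy (y * ?S) - sm (q * pyz) (?S * y) + ?K \<in> J" .
  moreover have "sm pxy (y * ?T) - sm (q * pyz) (?T * y) + ?K \<approx> sm pxy (y * ?S) - sm (q * pyz) (?S * y) + ?K"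
    by (intro cong_add cong_diff cong_sm cong_mult TS cong_refl)
  ultimately have 2: "sm pxy (y * ?T) - sm (q * pyz) (?T * y) + ?K \<in> J"
    by (rule cong_J[rotated])
  have c: "(1 + q) * pyz * (pxy * q * pzy) = (1 + q) * pxy"
    using inv by algebra
  have "pyz \<noteq> 0" using inv by auto
  define U where "U = ?T"
  have "sm ((1 + q) * pyz) (B (pxy * q * pzy) U y) = sm ((1 + q) * pyz) (U * y) - sm ((1 + q) * pxy) (y * U)"
    unfolding B_def[of _ U] sm_diff sm_sm c ..
  also have "\<dots> = (sm pyz (U * y) - sm (q * pxy) (y * U) + ?K) - (sm pxy (y * U) - sm (q * pyz) (U * y) + ?K)"
    by (simp add: sm_simps)
  also have "\<dots> \<in> J"
    unfolding U_def by (rule J_diff[OF 1 2])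
  finally show ?thesis
    unfolding U_def by (rule J_sm_cancel) (use q \<open>pyz \<noteq> 0\<close> in auto)
qed

text \<open>Since P and y skew commute, [[x,P],y] is congruent to \<open>c\<close> times [[x,y],P].
  Bracketing both with x, and using that x skew commutes with [x,P] and with [x,y], leaves two
  combinations of [x,P][x,y] and [x,y][x,P]; their difference is divisible by 1 + q.\<close>

lemma common_first_letter_commute:
  assumes Py: "B c P y \<in> J"
    and xP: "B (q * a) x (B a x P) \<in> J"
    and xy: "B (q * b) x (B b x y) \<in> J"
    and inv: "c * c' = 1" "a * d * q = 1" and q: "1 + q \<noteq> 0"
  shows "B (q * d * b * c) (B a x P) (B b x y) \<in> J"
proof -
  let ?w = "B a x P" and ?v = "B b x y"
  let ?h = "B (q * a) x ?w" and ?g = "B (q * b) x ?v"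
  let ?F = "B (b * c) ?w y" and ?G = "B (a * c') ?v P"
  have cc: "c * (a * c') = a" "c * (c' * z) = z" for z
    using inv(1) by algebra+
  have eG: "sm c ?G = sm c (x * y * P) - sm (b * c) (y * x * P) - sm a (P * x * y) + sm (a * b) (P * y * x)"
    unfolding B_def[of "a * c'"] sm_diff sm_sm cc by (simp add: B_def sm_simps)
  have "?F - sm c ?G = x * B c P y - sm (a * b) (B c P y * x)"
    unfolding eG by (simp add: B_def sm_simps)
  also have "\<dots> \<in> J"
    using Py by (auto intro: J_intros)
  finally have FG: "?F \<approx> sm c ?G"
    by (simp add: cong_def)
  have F: "B (q * a * b) x ?F = sm (q * a) (?w * ?v) - sm (b * c) (?v * ?w) + (?h * y - sm (b * c * b) (y * ?h))"
    by (simp add: B_def sm_simps)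
  have G: "B (q * a * b) x ?G = sm (q * b) (?v * ?w) - sm (a * c') (?w * ?v) + (?g * P - sm (a * a * c') (P * ?g))"
    by (simp add: B_def sm_simps)
  define W V where "W = ?w" and "V = ?v"
  note WV = W_def[symmetric] V_def[symmetric]
  have "sm (q * a) (W * V) - sm (b * c) (V * W) \<approx> B (q * a * b) x ?F"
    unfolding F unfolding WV cong_def using xP by (auto intro: J_intros simp: WV)
  also have "\<dots> \<approx> B (q * a * b) x (sm c ?G)"
    by (intro cong_B cong_refl FG)
  also have "\<dots> = sm c (B (q * a * b) x ?G)"
    by (rule B_sm_right)
  also have "\<dots> \<approx> sm c (sm (q * b) (V * W) - sm (a * c') (W * V))"
    unfolding G unfolding WV cong_def sm_diff[symmetric] using xy by (auto intro: J_intros simp: WV)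
  also have "\<dots> = sm (q * b * c) (V * W) - sm a (W * V)"
    unfolding sm_diff sm_sm cc by (simp add: mult_ac)
  finally have 1: "(sm (q * a) (W * V) - sm (b * c) (V * W)) - (sm (q * b * c) (V * W) - sm a (W * V)) \<in> J"
    by (simp add: cong_def)
  \<comment> \<open>\<open>a * d * q = 1\<close> turns the quotient b c / a of the two coefficients
    into \<open>q * d * b * c\<close>.\<close>
  have e: "(1 + q) * a * (q * d * b * c) = (1 + q) * (b * c)"
    using inv(2) by algebra
  have "sm ((1 + q) * a) (B (q * d * b * c) W V) = sm ((1 + q) * a) (W * V) - sm ((1 + q) * (b * c)) (V * W)"
    unfolding B_def[of _ W] sm_diff sm_sm e ..
  also have "\<dots> \<in> J"
    using 1 by (simp add: sm_simps)
  finally show ?thesis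
    unfolding W_def V_def by (rule J_sm_cancel) (use q inv(2) in auto)
qed

text \<open>An exact identity, without the ideal: on the right the words x u y and y u x cancel, and
  what remains is the double bracket. The cancellation of y u x rests on the factor
  \<open>iq\<close>, which explains the q^{-1} in the special case m = 2n - k.\<close>

lemma double_letter_identity:
  assumes "pxu * pux * q = 1" "pxy * pyx * q = 1" "q * iq = 1"
  shows "B (puy * pux) u (B pyx y x)
    = sm (q * (pux * pyx)) (B (pxy * puy) (B pxu x u) y) + B (iq * puy) u y * x
      - sm (q * (pux * pyx)) (x * B (iq * puy) u y)"
proof -
  have c: "q * (pux * pyx) * pxu = pyx" "q * (pux * pyx) * (pxy * puy) = puy * pux"
    "q * (pux * pyx) * (pxy * puy * pxu) = iq * puy" "q * (pux * pyx) * (iq * puy) = pux * pyx * puy"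
    using assms by algebra+
  have e: "B (pxy * puy) (B pxu x u) y
      = x * u * y - sm pxu (u * x * y) - sm (pxy * puy) (y * x * u) + sm (pxy * puy * pxu) (y * u * x)"
    "x * B (iq * puy) u y = x * u * y - sm (iq * puy) (x * y * u)"
    by (simp_all add: B_def sm_simps)
  show ?thesis
    unfolding e sm_add sm_diff sm_sm c by (simp add: B_def sm_simps)
qed

text \<open>Modulo the Serre relations both [x,E] and [x,[x,b]] are combinations of [x,u][x,y] and
  [x,y][x,u], and (1 + q) times the former is q times the latter. By the form of \<open>E'\<close>
  this means that x can be attached to \<open>E'\<close> on the left or to \<open>E\<close> on the
  right with the same result.\<close>

lemma closing_letter_identity:
  assumes inv: "pxu * pux * q = 1" "pxy * pyx * q = 1" "q * iq = 1"
    and xu: "B (q * pxu) x (B pxu x u) \<in> J"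
    and xy: "B (q * pxy) x (B pxy x y) \<in> J"
    and E: "E = B (pxy * puy) (B pxu x u) y" and b: "b = B (iq * puy) u y"
    and E': "E' = sm (q * (pux * pyx)) E + b * x - sm (q * (pux * pyx)) (x * b)"
  shows "B (pxu * pxy) x E' \<approx> B (pux * pyx) E x"
proof -
  let ?w = "B pxu x u" and ?v = "B pxy x y"
  let ?h = "B (q * pxu) x ?w" and ?g = "B (q * pxy) x ?v"
  have 1: "B (q * pxu * pxy) x E = sm (q * pxu) (?w * ?v) - sm (pxy * puy) (?v * ?w)
      + (?h * y - sm (pxy * puy * pxy) (y * ?h))"
    by (simp add: E B_def sm_simps)
  have 2: "B (q * (pxu * pxy)) x (B (pxu * pxy) x b)
     = sm (pxu * (1 + q)) (?w * ?v) - sm (iq * puy * pxy * (1 + q)) (?v * ?w)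
      + (?h * y + sm (pxu * pxu) (u * ?g) - sm (iq * puy) (?g * u + sm (pxy * pxy) (y * ?h)))"
    by (simp add: b B_def sm_simps)
  define W V where "W = ?w" and "V = ?v"
  note WV = W_def[symmetric] V_def[symmetric]
  have "sm (1 + q) (B (q * pxu * pxy) x E) \<approx> sm (1 + q) (sm (q * pxu) (W * V) - sm (pxy * puy) (V * W))"
    unfolding 1 WV by (rule cong_sm) (use xu in \<open>auto simp: cong_def WV intro: J_intros\<close>)
  also have "\<dots> = sm q (sm (pxu * (1 + q)) (W * V) - sm (iq * puy * pxy * (1 + q)) (V * W))"
  proof -
    have c: "q * (iq * puy * pxy * (1 + q)) = (1 + q) * (pxy * puy)"
      using inv(3) by algebra
    show ?thesis
      unfolding sm_diff sm_sm c by (simp add: sm_simps)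
  qed
  also have "\<dots> \<approx> sm q (B (q * (pxu * pxy)) x (B (pxu * pxy) x b))"
    unfolding 2 WV using xu xy
    by (intro cong_sm cong_sym[of "_ + _"])
      (auto simp: cong_def WV intro!: J_add J_diff J_sm intro: J_lmult J_rmult)
  finally have 3: "sm (1 + q) (B (q * pxu * pxy) x E)
     - sm q (B (q * (pxu * pxy)) x (B (pxu * pxy) x b)) \<in> J" (is "?X \<in> J")
    by (simp add: cong_def)
  \<comment> \<open>\<open>?X\<close> is the relation obtained so far; rescaled, it is exactly the
    difference of the two brackets to be compared.\<close>
  have "sm (pux * pyx) ?X = B (pxu * pxy) x E' - B (pux * pyx) E x"
  proof -
    have c: "pux * pyx * (1 + q) * (q * pxu * pxy) = iq * (1 + q)"
      "pux * pyx * q * (pxu * pxy) = iq"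
      "pux * pyx * q * (q * (pxu * pxy) * (pxu * pxy)) = pxu * pxy"
      "pux * pyx * q * (q * (pxu * pxy)) = 1"
      "pxu * pxy * (q * (pux * pyx)) = iq"
      using inv by algebra+
    have "sm (pux * pyx) ?X = sm (pux * pyx * (1 + q)) (x * E) - sm (iq * (1 + q)) (E * x)
       - (sm (pux * pyx * q) (x * x * b) - sm iq (x * b * x) - x * b * x + sm (pxu * pxy) (b * x * x))"
    proof -
      have "sm (pux * pyx) ?X = sm (pux * pyx * (1 + q)) (x * E)
        - sm (pux * pyx * (1 + q) * (q * pxu * pxy)) (E * x)
       - (sm (pux * pyx * q) (x * x * b) - sm (pux * pyx * q * (pxu * pxy)) (x * b * x)
         - sm (pux * pyx * q * (q * (pxu * pxy))) (x * b * x)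
         + sm (pux * pyx * q * (q * (pxu * pxy) * (pxu * pxy))) (b * x * x))"
        by (simp add: B_def sm_simps)
      then show ?thesis unfolding c by simp
    qed
    also have "\<dots> = B (pxu * pxy) x E' - B (pux * pyx) E x"
    proof -
      have "B (pxu * pxy) x E' = sm (q * (pux * pyx)) (x * E) + x * b * x - sm (q * (pux * pyx)) (x * x * b)
         - sm (pxu * pxy * (q * (pux * pyx))) (E * x) - sm (pxu * pxy) (b * x * x)
         + sm (pxu * pxy * (q * (pux * pyx))) (x * b * x)"
        by (simp add: E' B_def sm_simps)
      then have "B (pxu * pxy) x E' = sm (q * (pux * pyx)) (x * E) + x * b * x - sm (q * (pux * pyx)) (x * x * b)
         - sm iq (E * x) - sm (pxu * pxy) (b * x * x) + sm iq (x * b * x)"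
        unfolding c .
      moreover have "sm (iq * (1 + q)) (E * x) = sm iq (E * x) + E * x"
        using inv(3) by (simp add: distrib_left sm_add_left mult.commute)
      ultimately show ?thesis
        by (simp add: B_def[of "pux * pyx"] sm_simps)
    qed
    finally show ?thesis .
  qed
  then show ?thesis
    using J_sm[OF 3, of "pux * pyx"] by (simp add: cong_def)
qed

end

section \<open>The coproduct on the free algebra\<close>

abbreviation X :: "nat \<Rightarrow> 'k::field free_alg" where "X j \<equiv> Poly_Mapping.single [j] 1"

lemma chi_w_append: "chi_w chi (u @ v) h = chi_w chi u h * chi_w chi v h"
  by (simp add: chi_w_def)

lemma chi_w_Nil [simp]: "chi_w chi [] h = 1"
  by (simp add: chi_w_def)

lemma chi_w_Cons: "chi_w chi (a # u) h = chi a h * chi_w chi u h"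
  by (simp add: chi_w_def)

lemma gr_Nil [simp]: "gr gg [] = 0"
  by (simp add: gr_def)

lemma gr_append: "gr gg (u @ v) = gr gg u + gr gg v"
  by (simp add: gr_def)

locale quantum_so =
  fixes chi :: "nat \<Rightarrow> 'g::ab_group_add \<Rightarrow> 'k::field"
    and gg :: "nat \<Rightarrow> 'g"
    and n :: nat
    and q :: 'k
  assumes n3: "n \<ge> 3"
    and char_hom: "\<And>i a b. 1 \<le> i \<Longrightarrow> i \<le> n \<Longrightarrow> chi i (a + b) = chi i a * chi i b"
    and char_nz: "\<And>i a. 1 \<le> i \<Longrightarrow> i \<le> n \<Longrightarrow> chi i a \<noteq> 0"
    and q_nz: "q \<noteq> 0" and q_ne: "q \<noteq> -1"
    and p_ii: "\<And>i. 1 \<le> i \<Longrightarrow> i \<le> n \<Longrightarrow> chi i (gg i) = q"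
    and p_adj: "\<And>i. 1 < i \<Longrightarrow> i < n \<Longrightarrow> chi i (gg (i-1)) * chi (i-1) (gg i) = inverse q"
    and p_n2n: "chi (n-2) (gg n) * chi n (gg (n-2)) = inverse q"
    and p_n1n: "chi (n-1) (gg n) * chi n (gg (n-1)) = 1"
    and p_other: "\<And>i j. 1 \<le> i \<Longrightarrow> i < j \<Longrightarrow> j \<le> n \<Longrightarrow> j > i + 1 \<Longrightarrow>
                    \<not> (i = n - 2 \<and> j = n) \<Longrightarrow> chi i (gg j) * chi j (gg i) = 1"
begin

abbreviation "good w \<equiv> set w \<subseteq> {1..n}"

abbreviation "rel_ideal \<equiv> ideal_gen chi (relators chi gg n)"

lemma chi_w_add: "good w \<Longrightarrow> chi_w chi w (a + b) = chi_w chi w a * chi_w chi w b"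
  by (induction w) (simp_all add: chi_w_Cons char_hom mult_ac)

lemma chi_w_nz: "good w \<Longrightarrow> chi_w chi w a \<noteq> 0"
  by (induction w) (simp_all add: chi_w_Cons char_nz)

lemma chi_w_zero: "good w \<Longrightarrow> chi_w chi w 0 = 1"
  using chi_w_add[of w 0 0] chi_w_nz[of w 0] by (metis add_0 mult_cancel_right1)

text \<open>
  \<open>emh h u\<close> is \<open>h \<cdot> u\<close> in \<open>G\<langle>X\<rangle>\<close>. Words with a letter outside \<open>1..n\<close>, on which \<open>chi\<close>
  need not be a character, are sent to \<open>0\<close>; this makes \<open>emh 0\<close> multiplicative everywhere.
\<close>

definition emh :: "'g \<Rightarrow> 'k free_alg \<Rightarrow> ('g, 'k) alg" where
  "emh h u = (\<Sum>w\<in>Poly_Mapping.keys u.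
     if good w then Poly_Mapping.single (h, w) (Poly_Mapping.lookup u w) else 0)"

lemma emh_single: "emh h (Poly_Mapping.single w c) = (if good w then Poly_Mapping.single (h, w) c else 0)"
  by (simp add: emh_def)

lemma emh_add: "emh h (u + v) = emh h u + emh h v"
  unfolding emh_def by (rule setsum_keys_plus_distrib) (simp_all add: single_add)

lemmas emh_zero [simp] = additive_zero[of "emh h" for h, OF emh_add]
lemmas emh_diff = additive_diff[of "emh h" for h, OF emh_add]

lemma emh_sm: "emh h (sm c u) = asmult c (emh h u)"
  by (rule additive_eqI[where u = u]) (simp_all add: sm_add emh_add asmult_add sm_single emh_single asmult_single)

lemma amul_emh: "amul chi (emh h u) (emh 0 v) = emh h (u * v)"
proof (rule additive_eqI[where u = u])
  fix w c
  show "amul chi (emh h (Poly_Mapping.single w c)) (emh 0 v) = emh h (Poly_Mapping.single w c * v)"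
    by (rule additive_eqI[where u = v])
      (simp_all add: emh_add amul_add_right distrib_left mult_single emh_single amul_single plus_list_def chi_w_zero)
qed (simp_all add: emh_add amul_add_left distrib_right)

lemma amul_grp_emh: "amul chi (grp g) (emh h u) = emh (g + h) u"
  by (rule additive_eqI[where u = u])
    (simp_all add: emh_add amul_add_right emh_single amul_single grp_def)

lemma amul_emh_grp:
  assumes "\<And>w. w \<in> Poly_Mapping.keys u \<Longrightarrow> chi_w chi w g = c"
  shows "amul chi (emh h u) (grp g) = emh (h + g) (sm c u)"
  by (rule additive_eqI[where u = u])
    (simp_all add: assms sm_add emh_add amul_add_left emh_single amul_single grp_def sm_single mult.commute)

lemma amul_gen_emh:
  assumes "1 \<le> j" "j \<le> n"
  shows "amul chi (gen j) (emh h u) = emh h (sm (chi j h) (X j * u))"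
  by (rule additive_eqI[where u = u])
    (use assms in \<open>simp_all add: distrib_left sm_add emh_add amul_add_right emh_single amul_single gen_def
       sm_single mult_single plus_list_def chi_w_Cons mult.commute\<close>)

lemma gen_eq_emh: "1 \<le> j \<Longrightarrow> j \<le> n \<Longrightarrow> gen j = emh 0 (X j)"
  by (simp add: gen_def emh_single)

lemma aone_eq_emh: "aone = emh 0 1"
  by (simp add: aone_def emh_single zero_list_def flip: single_one)

text \<open>Pulling the ideal back along \<open>emh 0\<close> moves all relations to the free
  algebra, where no group elements occur.\<close>

definition J :: "'k free_alg set" where "J = {u. emh 0 u \<in> rel_ideal}"

sublocale free_alg_ideal J
proof
  show "0 \<in> J"
    by (simp add: J_def ideal_gen.zero_in)
  show "u + v \<in> J" if "u \<in> J" "v \<in> J" for u v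
    using that by (auto simp: J_def emh_add intro: ideal_gen.add_in)
  show "a * u \<in> J" "u * a \<in> J" if "u \<in> J" for u a
    using that by (auto simp: J_def amul_emh[symmetric] intro: ideal_gen.intros)
qed

notation cong (infix "\<approx>" 50)

lemma emh_in_rel_ideal: "u \<in> J \<Longrightarrow> emh h u \<in> rel_ideal"
  using amul_grp_emh[of h 0 u] ideal_gen.lmul_in[of "emh 0 u" chi _ "grp h"] by (simp add: J_def)

definition TT :: "'g \<Rightarrow> 'k free_alg \<Rightarrow> 'k free_alg \<Rightarrow> ('g, 'k) tens" where
  "TT h b a = tensor (emh h b) (emh 0 a)"

lemma TT_add_left: "TT h (b + b') a = TT h b a + TT h b' a"
  by (simp add: TT_def emh_add tensor_add_left)

lemma TT_add_right: "TT h b (a + a') = TT h b a + TT h b a'"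
  by (simp add: TT_def emh_add tensor_add_right)

lemma TT_diff_left: "TT h (b - b') a = TT h b a - TT h b' a"
  by (simp add: TT_def emh_diff tensor_diff_left)

lemma TT_diff_right: "TT h b (a - a') = TT h b a - TT h b a'"
  by (simp add: TT_def emh_diff tensor_diff_right)

lemma TT_zero [simp]: "TT h 0 a = 0" "TT h b 0 = 0"
  by (simp_all add: TT_def)

lemma TT_sm: "TT h b (sm c a) = TT h (sm c b) a"
  by (simp add: TT_def emh_sm tensor_asmult)

definition tcong (infix "\<simeq>" 50) where "S \<simeq> T \<longleftrightarrow> S - T \<in> tens_ker rel_ideal"

lemma tcong_refl [simp]: "S \<simeq> S"
  by (simp add: tcong_def tens_ker.zero_k)

lemma tcong_trans [trans]: "S \<simeq> T \<Longrightarrow> T \<simeq> U \<Longrightarrow> S \<simeq> U"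
  using tens_ker.add_k[of "S - T" rel_ideal "T - U"] by (simp add: tcong_def)

lemma tcong_add: "S \<simeq> T \<Longrightarrow> S' \<simeq> T' \<Longrightarrow> S + S' \<simeq> T + T'"
  using tens_ker.add_k[of "S - T" rel_ideal "S' - T'"] by (simp add: tcong_def algebra_simps)

lemma tcong_diff: "S \<simeq> T \<Longrightarrow> S' \<simeq> T' \<Longrightarrow> S - S' \<simeq> T - T'"
  using tens_ker.add_k[of "S - T" rel_ideal "- (S' - T')"] tens_ker_uminus[of "S' - T'"]
  by (simp add: tcong_def algebra_simps)

lemma tcong_sum: "(\<And>i. i \<in> A \<Longrightarrow> f i \<simeq> g i) \<Longrightarrow> sum f A \<simeq> sum g A"
  by (induction A rule: infinite_finite_induct) (simp_all add: tcong_add)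

lemma tcong_tmul_left: "S \<simeq> T \<Longrightarrow> tmul chi U S \<simeq> tmul chi U T"
  using tens_ker_tmul(2)[of "S - T"] by (simp add: tcong_def tmul_diff_right)

lemma tcong_tmul_right: "S \<simeq> T \<Longrightarrow> tmul chi S U \<simeq> tmul chi T U"
  using tens_ker_tmul(1)[of "S - T"] by (simp add: tcong_def tmul_diff_left)

lemma TT_cong:
  assumes "b \<approx> b'" "a \<approx> a'"
  shows "TT h b a \<simeq> TT h b' a'"
proof -
  have "TT h b a - TT h b' a' = TT h (b - b') a + TT h b' (a - a')"
    by (simp add: TT_diff_left TT_diff_right)
  also have "\<dots> \<in> tens_ker rel_ideal"
    using assms emh_in_rel_ideal[of "b - b'" h] emh_in_rel_ideal[of "a - a'" 0]
    by (auto simp: cong_def TT_def intro: tens_ker.intros)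
  finally show ?thesis by (simp add: tcong_def)
qed

lemma TT_J_left: "b \<in> J \<Longrightarrow> TT h b a \<simeq> 0"
  using TT_cong[of b 0 a a h] by (simp add: cong_def)

lemma TT_J_right: "a \<in> J \<Longrightarrow> TT h b a \<simeq> 0"
  using TT_cong[of b b a 0 h] by (simp add: cong_def)

section \<open>Multiplication by the coproduct of a letter, on either side\<close>

definition LX :: "nat \<Rightarrow> ('g, 'k) tens \<Rightarrow> ('g, 'k) tens" where
  "LX j S = tmul chi (tensor (gen j) aone + tensor (grp (gg j)) (gen j)) S"

definition RX :: "nat \<Rightarrow> ('g, 'k) tens \<Rightarrow> ('g, 'k) tens" where
  "RX j S = tmul chi S (tensor (gen j) aone + tensor (grp (gg j)) (gen j))"

definition SC :: "'k \<Rightarrow> ('g, 'k) tens \<Rightarrow> ('g, 'k) tens" where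
  "SC c S = tmul chi (tensor (asmult c aone) aone) S"

lemma LX_add: "LX j (S + T) = LX j S + LX j T"
  and RX_add: "RX j (S + T) = RX j S + RX j T"
  and SC_add: "SC c (S + T) = SC c S + SC c T"
  by (simp_all add: LX_def RX_def SC_def tmul_add_left tmul_add_right)

lemma LX_RX_SC_zero [simp]: "LX j 0 = 0" "RX j 0 = 0" "SC c 0 = 0"
  by (simp_all add: LX_def RX_def SC_def)

lemma LX_cong: "S \<simeq> T \<Longrightarrow> LX j S \<simeq> LX j T"
  and RX_cong: "S \<simeq> T \<Longrightarrow> RX j S \<simeq> RX j T"
  and SC_cong: "S \<simeq> T \<Longrightarrow> SC c S \<simeq> SC c T"
  by (simp_all add: LX_def RX_def SC_def tcong_tmul_left tcong_tmul_right)

lemma LX_TT: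
  assumes "1 \<le> j" "j \<le> n"
  shows "LX j (TT h b a) = TT h (sm (chi j h) (X j * b)) a + TT (gg j + h) b (X j * a)"
  using assms amul_emh[of 0 1 a] amul_emh[of 0 "X j" a]
  by (simp add: LX_def TT_def tmul_add_left tmul_tensor amul_grp_emh
      aone_eq_emh gen_eq_emh amul_gen_emh[OF assms, unfolded gen_eq_emh[OF assms]])

text \<open>Moving \<open>gg j\<close> to the left past \<open>b\<close> multiplies each word of
  \<open>b\<close> by its character value; a common value \<open>c\<close> is available when
  \<open>b\<close> is homogeneous.\<close>

lemma RX_TT:
  assumes j: "1 \<le> j" "j \<le> n" and c: "\<And>w. w \<in> Poly_Mapping.keys b \<Longrightarrow> chi_w chi w (gg j) = c"
  shows "RX j (TT h b a) = TT h (b * X j) a + TT (h + gg j) (sm c b) (a * X j)"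
  using j amul_emh[of 0 a 1] amul_emh[of 0 a "X j"] amul_emh[of h b "X j"]
  by (simp add: RX_def TT_def tmul_add_right tmul_tensor amul_emh_grp[OF c] aone_eq_emh gen_eq_emh)

lemma SC_TT: "SC c (TT h b a) = TT h (sm c b) a"
  using amul_emh[of 0 1 a]
  by (simp add: SC_def TT_def tmul_tensor aone_eq_emh[symmetric] amul_asmult_left)
    (simp add: amul_grp_emh[of 0, unfolded grp_def, folded aone_def] emh_sm)

text \<open>\<open>chi j\<close> is known to be a character only for letters in 1..n. In this span
  the other words are killed by \<open>emh\<close>, so left and right multiplications by letters
  commute on it.\<close>

inductive_set monomial_span :: "('g, 'k) tens set" where
  "0 \<in> monomial_span"
| "TT h (Poly_Mapping.single u c) (Poly_Mapping.single v d) \<in> monomial_span"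
| "S \<in> monomial_span \<Longrightarrow> T \<in> monomial_span \<Longrightarrow> S + T \<in> monomial_span"

lemma RX_monomial:
  assumes j: "1 \<le> j" "j \<le> n"
  shows "RX j (TT h (Poly_Mapping.single u c) (Poly_Mapping.single v d))
    = TT h (Poly_Mapping.single (u @ [j]) c) (Poly_Mapping.single v d)
     + TT (h + gg j) (Poly_Mapping.single u (chi_w chi u (gg j) * c)) (Poly_Mapping.single (v @ [j]) d)"
  by (subst RX_TT[OF j, where c = "chi_w chi u (gg j)"])
    (auto simp: mult_single plus_list_def sm_single split: if_splits)

lemma LX_monomial:
  assumes j: "1 \<le> j" "j \<le> n"
  shows "LX j (TT h (Poly_Mapping.single u c) (Poly_Mapping.single v d))
    = TT h (Poly_Mapping.single (j # u) (chi j h * c)) (Poly_Mapping.single v d)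
     + TT (gg j + h) (Poly_Mapping.single u c) (Poly_Mapping.single (j # v) d)"
  by (simp add: LX_TT[OF j] mult_single plus_list_def sm_single)

lemma SC_monomial:
  "SC r (TT h (Poly_Mapping.single u c) (Poly_Mapping.single v d))
    = TT h (Poly_Mapping.single u (r * c)) (Poly_Mapping.single v d)"
  by (simp add: SC_TT sm_single)

lemma LX_monomial_span: "S \<in> monomial_span \<Longrightarrow> 1 \<le> j \<Longrightarrow> j \<le> n \<Longrightarrow> LX j S \<in> monomial_span"
  by (induction rule: monomial_span.induct) (auto simp: LX_monomial LX_add intro: monomial_span.intros)

text \<open>Associativity of the product in the form needed: \<open>delta_basis\<close> multiplies
  letters from the left, while \<open>e[k,m]\<close> also grows on the right.\<close>

lemma LX_RX_commute:
  assumes "S \<in> monomial_span" "1 \<le> i" "i \<le> n" "1 \<le> j" "j \<le> n"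
  shows "RX j (LX i S) = LX i (RX j S)"
  using assms by (induction rule: monomial_span.induct)
    (simp_all add: RX_monomial LX_monomial RX_add LX_add chi_w_Cons char_hom add_ac mult_ac)

lemma SC_RX_commute: "S \<in> monomial_span \<Longrightarrow> 1 \<le> j \<Longrightarrow> j \<le> n \<Longrightarrow> SC c (RX j S) = RX j (SC c S)"
  by (induction rule: monomial_span.induct)
    (simp_all add: RX_monomial SC_monomial RX_add SC_add mult_ac)

lemma SC_LX_commute: "S \<in> monomial_span \<Longrightarrow> 1 \<le> j \<Longrightarrow> j \<le> n \<Longrightarrow> SC c (LX j S) = LX j (SC c S)"
  by (induction rule: monomial_span.induct)
    (simp_all add: LX_monomial SC_monomial LX_add SC_add mult_ac)

lemma grp_zero_tmul: "S \<in> monomial_span \<Longrightarrow> tmul chi (tensor (grp 0) (grp 0)) S = S"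
  by (induction rule: monomial_span.induct)
    (simp_all add: TT_def tmul_tensor amul_grp_emh tmul_add_right)

definition DB :: "nat list \<Rightarrow> ('g, 'k) tens" where
  "DB w = List.foldr LX w (tensor aone aone)"

lemma tensor_aone: "tensor aone aone = TT 0 1 1"
  by (simp add: TT_def aone_eq_emh)

lemma one_monomial_span: "TT 0 1 1 \<in> monomial_span"
  using monomial_span.intros(2)[of 0 0 1 0 1] by simp

lemma DB_simps: "DB [] = TT 0 1 1" "DB (j # w) = LX j (DB w)"
  by (simp_all add: DB_def tensor_aone)

lemma DB_monomial_span: "good w \<Longrightarrow> DB w \<in> monomial_span"
  by (induction w) (simp_all add: DB_simps one_monomial_span LX_monomial_span)

text \<open>In the fold the last letter meets 1 \<otimes> 1 before all others. There left and right
  multiplication agree, and the right multiplication is then pulled out past the other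
  letters.\<close>

lemma DB_snoc: "good (w @ [j]) \<Longrightarrow> DB (w @ [j]) = RX j (DB w)"
proof (induction w)
  case Nil
  have "LX j (TT 0 (Poly_Mapping.single 0 1) (Poly_Mapping.single 0 1))
      = RX j (TT 0 (Poly_Mapping.single 0 1) (Poly_Mapping.single 0 1))"
    using Nil chi_w_zero[of "[j]"] by (simp add: LX_monomial RX_monomial chi_w_Cons zero_list_def del: single_one)
  then show ?case by (simp add: DB_simps)
qed (simp add: DB_simps LX_RX_commute DB_monomial_span)

definition D :: "'k free_alg \<Rightarrow> ('g, 'k) tens" where
  "D u = Delta chi gg (emh 0 u)"

lemma D_add: "D (u + v) = D u + D v"
  by (simp add: D_def emh_add Delta_add)

lemmas D_zero [simp] = additive_zero[of D, OF D_add]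
lemmas D_diff = additive_diff[of D, OF D_add]

lemma D_single: "D (Poly_Mapping.single w c) = (if good w then SC c (DB w) else 0)"
proof -
  have "delta_basis chi gg 0 w = DB w" if "good w"
    using grp_zero_tmul[OF DB_monomial_span[OF that]]
    unfolding delta_basis_def DB_def LX_def[abs_def] .
  then show ?thesis
    by (simp add: D_def emh_single Delta_single SC_def)
qed

lemma D_one: "D 1 = TT 0 1 1"
  using D_single[of 0 1] by (simp add: zero_list_def DB_simps SC_TT flip: single_one)

lemma D_sm: "D (sm c u) = SC c (D u)"
proof (rule additive_eqI[where u = u])
  fix w d
  have "SC (c * d) S = SC c (SC d S)" if "S \<in> monomial_span" for S
    using that by induction (simp_all add: SC_add SC_monomial mult.assoc)
  then show "D (sm c (Poly_Mapping.single w d)) = SC c (D (Poly_Mapping.single w d))"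
    by (simp add: sm_single D_single DB_monomial_span)
qed (simp_all add: sm_add D_add SC_add)

lemma D_X_mult: "1 \<le> j \<Longrightarrow> j \<le> n \<Longrightarrow> D (X j * u) = LX j (D u)"
  by (rule additive_eqI[where u = u])
    (auto simp: distrib_left D_add LX_add mult_single plus_list_def D_single DB_simps
      SC_LX_commute DB_monomial_span)

lemma D_mult_X: "1 \<le> j \<Longrightarrow> j \<le> n \<Longrightarrow> D (u * X j) = RX j (D u)"
  by (rule additive_eqI[where u = u])
    (auto simp: distrib_right D_add RX_add mult_single plus_list_def D_single DB_snoc
      SC_RX_commute DB_monomial_span)

end

section \<open>The words \<open>e(k,m)\<close>\<close>

lemma chi_w_mset: "mset u = mset v \<Longrightarrow> chi_w chi u h = chi_w chi v h"
  unfolding chi_w_def by (metis mset_map prod_mset_prod_list)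

lemma gr_mset: "mset u = mset v \<Longrightarrow> gr gg u = gr gg v"
  unfolding gr_def by (metis mset_map sum_mset_sum_list)

lemma pw_mset: "mset u = mset u' \<Longrightarrow> mset v = mset v' \<Longrightarrow> pw chi gg u v = pw chi gg u' v'"
  unfolding pw_def by (metis chi_w_mset gr_mset)

text \<open>A letter a < n sits at the positions a and 2n - a, the letter n only at position
  n.\<close>

lemma count_letters_interval:
  assumes "y \<le> 2 * n"
  shows "count (mset (map (lt n) [x..<y])) a
    = of_bool (a \<le> n \<and> x \<le> a \<and> a < y) + of_bool (a < n \<and> x \<le> 2 * n - a \<and> 2 * n - a < y)"
  using assms
proof (induction y)
  case (Suc y)
  show ?case
  proof (cases "x \<le> y")
    case True
    with Suc show ?thesis
      by (auto simp: lt_def)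
  qed auto
qed auto

context quantum_so
begin

abbreviation "W k m \<equiv> ew n k m"
abbreviation "pp u v \<equiv> pw chi gg u v"

text \<open>
  \<open>pr m\<close> is the position whose letter precedes that of position \<open>m\<close> in \<open>e(k,m)\<close> for \<open>k < n\<close>
  (position \<open>n - 1\<close> is skipped before \<open>n\<close>). For \<open>m > 2n - k\<close> the word \<open>e(k,m)\<close> is the letter \<open>fl k\<close>
  followed by \<open>e(sc k,m)\<close>.
\<close>

definition pr :: "nat \<Rightarrow> nat" where "pr m = (if m = n then n - 2 else m - 1)"

definition sc :: "nat \<Rightarrow> nat" where
  "sc k = (if k = n then n + 2 else if k = n - 1 then n + 1 else k + 1)"

definition fl :: "nat \<Rightarrow> nat" where "fl k = (if k = n - 1 then n else lt n k)"

text \<open>Characters and degrees depend only on letter multiplicities, so with this table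
  comparisons of degrees become linear arithmetic. The letters n - 1 and n are listed separately
  because of the skipped positions.\<close>

lemma count_W:
  assumes "1 \<le> k" "k \<le> m" "m < 2 * n"
  shows "count (mset (W k m)) a =
   (if a + 1 < n then (if k \<le> a \<and> a \<le> m then 1 else 0) + (if k + a \<le> 2 * n \<and> 2 * n \<le> m + a then 1 else 0)
    else if a + 1 = n then (if k < n \<and> (m + 1 = n \<or> n < m) \<or> k = n + 1 then 1 else 0)
    else if a = n then (if k \<le> n \<and> n \<le> m then 1 else 0) else 0)"
proof -
  \<comment> \<open>\<open>r\<close> and \<open>b\<close> stand for the truncated differences n - 1
    and 2n - a, to keep the arithmetic linear.\<close>
  obtain r where r: "n = r + 1" "n - 1 = r" using n3 by (cases n) auto
  define b where "b = 2 * n - a"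
  have ab: "n < a \<or> a + b = 2 * n" by (auto simp: b_def)
  have c: "count (mset (map (lt n) [x..<m + 1])) a = (if a \<le> n \<and> x \<le> a \<and> a \<le> m then 1 else 0)
      + (if a < n \<and> x \<le> 2 * n - a \<and> 2 * n - a \<le> m then 1 else 0)" for x
    using assms by (subst count_letters_interval) (auto simp: of_bool_def)
  have "[k..<n - 1] = map (lt n) [k..<n - 1]"
    by (rule sym, rule map_idI) (auto simp: lt_def)
  then have d: "count (mset [k..<n - 1]) a = (if k \<le> a \<and> a < n - 1 then 1 else 0)"
    by (metis (no_types, lifting) atLeastLessThan_iff count_mset_0_iff distinct_count_atmost_1 distinct_upt set_upt)
  consider "m < n" | "k > n" | "k < n - 1" "n - 1 < m" | "k = n - 1" "n - 1 < m" | "k = n" "n \<le> m"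
    using assms by linarith
  then show ?thesis
  proof cases
    case 1
    then have "count (mset (W k m)) a = count (mset (map (lt n) [k..<m + 1])) a"
      by (simp add: ew_def)
    then show ?thesis unfolding c b_def[symmetric] r(2) using 1 assms n3 r ab by (auto split: if_split)
  next
    case 2
    then have "count (mset (W k m)) a = count (mset (map (lt n) [k..<m + 1])) a"
      by (simp add: ew_def)
    then show ?thesis unfolding c b_def[symmetric] r(2) using 2 assms n3 r ab by (auto split: if_split)
  next
    case 3
    then have "W k m = [k..<n - 1] @ n # map (lt n) [n + 1..<m + 1]"
      by (auto simp: ew_def simp del: upt_Suc)
    then have "count (mset (W k m)) a = count (mset [k..<n - 1]) a + (if a = n then 1 else 0)
       + count (mset (map (lt n) [n + 1..<m + 1])) a"
      by (simp del: upt_Suc mset_map mset_upt)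
    then show ?thesis unfolding c d b_def[symmetric] r(2) using 3 assms n3 r ab by (auto split: if_split)
  next
    case 4
    then have "W k m = n # map (lt n) [n + 1..<m + 1]"
      using n3 by (auto simp: ew_def simp del: upt_Suc)
    then have "count (mset (W k m)) a = (if a = n then 1 else 0)
       + count (mset (map (lt n) [n + 1..<m + 1])) a"
      by (simp del: upt_Suc mset_map)
    then show ?thesis unfolding c b_def[symmetric] r(2) using 4 assms n3 r ab by (auto split: if_split)
  next
    case 5
    then have "W k m = n # map (lt n) [n + 2..<m + 1]"
      using n3 by (auto simp: ew_def simp del: upt_Suc)
    then have "count (mset (W k m)) a = (if a = n then 1 else 0)
       + count (mset (map (lt n) [n + 2..<m + 1])) a"
      by (simp del: upt_Suc mset_map)
    then show ?thesis unfolding c b_def[symmetric] r(2) using 5 assms n3 r ab by (auto split: if_split)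
  qed
qed

lemma good_W:
  assumes "1 \<le> k" "k \<le> m" "m < 2 * n"
  shows "good (W k m)"
proof
  fix a assume "a \<in> set (W k m)"
  then have "count (mset (W k m)) a \<noteq> 0"
    by simp
  then show "a \<in> {1..n}"
    unfolding count_W[OF assms] using assms n3 by (auto split: if_splits)
qed

lemma set_W_bounds:
  assumes "1 \<le> k" "k \<le> m" "m < 2 * n" "a \<in> set (W k m)"
  shows "a \<le> n" "k \<le> a \<or> 2 * n \<le> m + a" "n < k \<Longrightarrow> k + a \<le> 2 * n" "m < n \<Longrightarrow> a \<le> m"
proof -
  have "count (mset (W k m)) a \<noteq> 0"
    using assms by simp
  then show "a \<le> n" "k \<le> a \<or> 2 * n \<le> m + a" "n < k \<Longrightarrow> k + a \<le> 2 * n" "m < n \<Longrightarrow> a \<le> m"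
    unfolding count_W[OF assms(1-3)] using assms n3 by (auto split: if_splits)
qed

lemma W_self: "1 \<le> k \<Longrightarrow> k < 2 * n \<Longrightarrow> W k k = [lt n k]"
  using n3 by (auto simp: ew_def lt_def)

lemma W_special: "W (n - 1) n = [n]" "W n (n + 1) = [n]"
  using n3 by (auto simp: ew_def)

lemma W_pr:
  assumes "1 \<le> k" "k < n" "k < m" "k \<le> pr m" "m < 2 * n"
  shows "W k m = W k (pr m) @ [lt n m]"
proof -
  have s: "[a..<Suc b] = [a..<b] @ [b]" if "a \<le> b" for a b
    using that by simp
  consider "m < n" | "m = n" "k \<le> n - 2" | "m = n + 1" | "n + 1 < m"
    using assms by (fastforce simp: pr_def split: if_splits)
  then show ?thesis
  proof cases
    case 2
    moreover have "[k..<Suc (n - 2)] = map (lt n) [k..<Suc (n - 2)]"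
      by (rule sym, rule map_idI) (auto simp: lt_def)
    moreover have "Suc (n - 2) = n - 1"
      using n3 by simp
    ultimately show ?thesis
      using n3 by (auto simp: ew_def pr_def lt_def)
  next
    case 4
    then have "[n + 1..<m + 1] = [n + 1..<m] @ [m]"
      by simp
    with 4 assms show ?thesis
      by (auto simp: ew_def pr_def)
  qed (use assms n3 in \<open>auto simp: ew_def pr_def lt_def\<close>)
qed

lemma W_sc:
  assumes "1 \<le> k" "2 * n - k < m" "sc k \<le> m" "m < 2 * n"
  shows "W k m = fl k # W (sc k) m"
proof -
  consider "k < n - 2" | "k = n - 2" | "k = n - 1" | "k = n" | "k > n"
    using assms by linarith
  then show ?thesis
  proof cases
    case 1
    then have "[k..<n - 1] = k # [k + 1..<n - 1]"
      by (simp add: upt_conv_Cons)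
    moreover have "k < n - 1" "k + 1 < n - 1" "\<not> m < n" "\<not> n < k" "n - 1 < m" "sc k = k + 1" "fl k = k"
      using 1 assms by (auto simp: sc_def fl_def lt_def)
    ultimately show ?thesis
      by (simp add: ew_def del: upt_Suc)
  next
    case 2
    then have "[k..<n - 1] = [k]" "k + 1 = n - 1"
      using n3 by (simp_all add: upt_conv_Cons)
    moreover have "k < n - 1" "\<not> m < n" "\<not> n < k" "n - 1 < m" "sc k = k + 1" "fl k = k"
      using 2 assms n3 by (auto simp: sc_def fl_def lt_def)
    ultimately show ?thesis
      by (simp add: ew_def del: upt_Suc)
  next
    case 3
    then have "k < n" "\<not> m < n" "n - 1 < m" "sc k = n + 1" "fl k = n" "n + 1 > n"
      using assms n3 by (auto simp: sc_def fl_def)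
    with 3 show ?thesis
      by (simp add: ew_def del: upt_Suc)
  next
    case 4
    then have "\<not> m < n" "sc k = n + 2" "fl k = n" "n \<noteq> n - 1" "\<not> n < n - 1"
      using assms n3 by (auto simp: sc_def fl_def lt_def)
    with 4 show ?thesis
      by (simp add: ew_def del: upt_Suc)
  next
    case 5
    moreover from 5 have "sc k = k + 1" "fl k = lt n k"
      using n3 by (auto simp: sc_def fl_def)
    moreover from this assms have "[k..<m + 1] = k # [k + 1..<m + 1]"
      by (subst upt_conv_Cons) auto
    ultimately have "[k..<m + 1] = k # [k + 1..<m + 1]" "sc k = k + 1" "fl k = lt n k"
      by blast+
    with 5 show ?thesis
      by (simp add: ew_def del: upt_Suc)
  qed
qed

text \<open>An equality of multisets only: for i = n - 1 the concatenation has the letters n - 1 and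
  n in the opposite order to \<open>e(k,m)\<close>. In both excluded cases the concatenation has one
  letter n - 1 too many.\<close>

lemma mset_W_split:
  assumes "1 \<le> k" "k \<le> i" "i < m" "m < 2 * n"
    and "\<not> (i = n - 1 \<and> m = n)" "\<not> (i = n \<and> k = n)"
  shows "mset (W k m) = mset (W k i @ W (i + 1) m)"
proof (rule multiset_eqI)
  fix a
  have "\<not> (i + 1 = n \<and> m = n)"
    using assms(5) n3 by auto
  then have "count (mset (W k m)) a = count (mset (W k i)) a + count (mset (W (i + 1) m)) a"
    using assms n3 by (simp add: count_W) auto
  then show "count (mset (W k m)) a = count (mset (W k i @ W (i + 1) m)) a"
    by simp
qed

lemma pp_append_left: "pp (u @ v) w = pp u w * pp v w"
  by (simp add: pw_def chi_w_append)

lemma pp_append_right: "good u \<Longrightarrow> pp u (v @ w) = pp u v * pp u w"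
  by (simp add: pw_def gr_append chi_w_add)

lemma pp_Cons_left: "pp (a # u) w = pp [a] w * pp u w"
  using pp_append_left[of "[a]" u w] by simp

lemma pp_Cons_right: "good u \<Longrightarrow> pp u (a # v) = pp u [a] * pp u v"
  using pp_append_right[of u "[a]" v] by simp

lemma pp_Nil [simp]: "pp [] u = 1" "good u \<Longrightarrow> pp u [] = 1"
  by (simp_all add: pw_def chi_w_zero)

lemma pp_letters: "pp [a] [b] = chi a (gg b)"
  by (simp add: pw_def chi_w_def gr_def)

definition adj :: "nat \<Rightarrow> nat \<Rightarrow> bool" where
  "adj a b \<longleftrightarrow> a < n \<and> b < n \<and> (a = b + 1 \<or> b = a + 1) \<or> a = n \<and> b = n - 2 \<or> a = n - 2 \<and> b = n"

text \<open>
  \<open>sy d j = p(d,x\<^sub>j) p(x\<^sub>j,d)\<close> only depends on the number of occurrences in \<open>d\<close> of \<open>x\<^sub>j\<close> and of its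
  neighbours in the Dynkin diagram \<open>D\<^sub>n\<close>.
\<close>

definition sy :: "nat list \<Rightarrow> nat \<Rightarrow> 'k" where
  "sy d j = pp d [j] * pp [j] d"

lemma sy_letters_less:
  assumes "1 \<le> a" "a < j" "j \<le> n"
  shows "chi a (gg j) * chi j (gg a) = (if adj a j then inverse q else 1)"
proof -
  consider "j = a + 1" "j < n" | "a = n - 1" "j = n" | "a = n - 2" "j = n" | "a + 1 < j" "\<not> (a = n - 2 \<and> j = n)"
    using assms by linarith
  then show ?thesis
  proof cases
    case 1
    with p_adj[of j] assms show ?thesis
      by (auto simp: adj_def mult.commute)
  next
    case 2
    with p_n1n n3 show ?thesis
      by (auto simp: adj_def)
  next
    case 3
    with p_n2n n3 show ?thesis
      by (auto simp: adj_def)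
  next
    case 4
    with p_other[of a j] assms show ?thesis
      by (auto simp: adj_def)
  qed
qed

lemma sy_letters:
  assumes "1 \<le> a" "a \<le> n" "1 \<le> j" "j \<le> n"
  shows "sy [a] j = (if a = j then q ^ 2 else if adj a j then inverse q else 1)"
proof -
  consider "a = j" | "a < j" | "j < a" by linarith
  then show ?thesis
  proof cases
    case 1
    with assms p_ii show ?thesis
      by (simp add: sy_def pp_letters power2_eq_square)
  next
    case 2
    with assms sy_letters_less[of a j] show ?thesis
      by (simp add: sy_def pp_letters)
  next
    case 3
    moreover have "adj j a = adj a j"
      by (auto simp: adj_def)
    ultimately show ?thesis
      using assms sy_letters_less[of j a] by (simp add: sy_def pp_letters mult.commute)
  qed
qed

text \<open>Counts the letters of \<open>d\<close> next to j in the diagram. For j = 1 the entry j -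
  1 is 0, which is no letter.\<close>

definition adj_count :: "nat list \<Rightarrow> nat \<Rightarrow> nat" where
  "adj_count d j = (if j = n then count (mset d) (n - 2)
    else count (mset d) (j - 1) + (if j + 1 < n then count (mset d) (j + 1) else 0)
       + (if j = n - 2 then count (mset d) n else 0))"

lemma adj_count_Cons:
  assumes "1 \<le> a" "a \<le> n" "1 \<le> j" "j \<le> n"
  shows "adj_count (a # d) j = adj_count d j + (if adj a j then 1 else 0)"
proof -
  obtain r i b where r: "n = r + 3" "j = i + 1" "a = b + 1"
    using n3 assms by (metis le_add_diff_inverse2 add.commute)
  show ?thesis
    using assms unfolding adj_count_def adj_def unfolding r by auto
qed

lemma sy_count:
  assumes "good d" "1 \<le> j" "j \<le> n"
  shows "sy d j = (q ^ 2) ^ count (mset d) j * inverse q ^ adj_count d j"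
  using assms(1)
proof (induction d)
  case Nil
  then show ?case
    using assms chi_w_zero[of "[j]"] by (simp add: sy_def adj_count_def pp_Nil(2)[of "[j]"])
next
  case (Cons a d)
  have "sy (a # d) j = sy [a] j * sy d j"
    using assms by (simp add: sy_def pp_Cons_left[of a d] pp_Cons_right[of "[j]" a d])
  then show ?case
    using Cons assms by (auto simp: adj_count_Cons sy_letters adj_def)
qed

lemma sy_W:
  assumes "1 \<le> k" "k \<le> m" "m < 2 * n" "1 \<le> j" "j \<le> n"
  shows "sy (W k m) j = (q ^ 2) ^ count (mset (W k m)) j * inverse q ^ adj_count (W k m) j"
  by (rule sy_count) (use assms good_W in auto)

section \<open>Homogeneous elements and the elements \<open>e[k,m]\<close>\<close>

text \<open>Degrees are multisets of letters: they determine both the character and the element of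
  G.\<close>

definition hm :: "nat list \<Rightarrow> 'k free_alg \<Rightarrow> bool" where
  "hm d u \<longleftrightarrow> (\<forall>w\<in>Poly_Mapping.keys u. mset w = mset d)"

lemma hm_X: "hm [j] (X j)"
  by (simp add: hm_def)

lemma hm_mult: "hm d u \<Longrightarrow> hm d' v \<Longrightarrow> mset d'' = mset d + mset d' \<Longrightarrow> hm d'' (u * v)"
  using keys_mult[of u v] by (fastforce simp: hm_def plus_list_def)

lemma hm_diff: "hm d u \<Longrightarrow> hm d v \<Longrightarrow> hm d (u - v)"
  unfolding hm_def by (metis (no_types, lifting) in_keys_iff lookup_minus diff_zero diff_self)

lemma hm_sm: "hm d u \<Longrightarrow> hm d (sm c u)"
  using keys_mult[of "Poly_Mapping.single 0 c" u]
  by (fastforce simp: hm_def sm_def plus_list_def zero_list_def split: if_splits)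

lemma hm_B: "hm d u \<Longrightarrow> hm d' v \<Longrightarrow> mset d'' = mset d + mset d' \<Longrightarrow> hm d'' (B p u v)"
  unfolding B_def by (intro hm_diff hm_sm) (auto intro: hm_mult)

fun flb_acc :: "'k free_alg \<Rightarrow> nat list \<Rightarrow> nat list \<Rightarrow> 'k free_alg" where
  "flb_acc u d [] = u"
| "flb_acc u d (y # ys) = flb_acc (B (pp d [y]) u (X y)) (d @ [y]) ys"

definition flb :: "nat list \<Rightarrow> 'k free_alg" where
  "flb w = (case w of [] \<Rightarrow> 1 | y # ys \<Rightarrow> flb_acc (X y) [y] ys)"

fun frb :: "nat list \<Rightarrow> 'k free_alg" where
  "frb [] = 1"
| "frb [y] = X y"
| "frb (y # z # ys) = B (pp [y] (z # ys)) (X y) (frb (z # ys))"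

text \<open>Counterpart of \<open>ebr\<close> in the free algebra. The two are identified by
  \<open>emh_e\<close>, so the recursions can be proved on this side.\<close>

definition e :: "nat \<Rightarrow> nat \<Rightarrow> 'k free_alg" where
  "e k m = (if m < 2 * n - k then flb (W k m) else if m > 2 * n - k then frb (W k m)
    else if m \<noteq> n then B (inverse q * pp (W k (m - 1)) [lt n m]) (flb (W k (m - 1))) (X (lt n m))
    else X n)"

lemma flb_acc_snoc: "flb_acc u d (w @ [y]) = B (pp (d @ w) [y]) (flb_acc u d w) (X y)"
  by (induction u d w rule: flb_acc.induct) simp_all

lemma flb_snoc: "w \<noteq> [] \<Longrightarrow> flb (w @ [y]) = B (pp w [y]) (flb w) (X y)"
  by (cases w) (simp_all add: flb_def flb_acc_snoc)

lemma emh_br: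
  assumes "emh 0 u = u'" "emh 0 v = v'"
  shows "emh 0 (B (pp d d') u v) = br chi gg u' d v' d'"
  using assms by (simp add: B_def br_def emh_diff emh_sm amul_emh[symmetric])

lemma emh_flb_acc:
  "good w \<Longrightarrow> emh 0 (flb_acc u d w) = lbr_acc chi gg (emh 0 u) d w"
  by (induction u d w rule: flb_acc.induct) (simp_all add: emh_br gen_eq_emh)

lemma emh_flb: "good w \<Longrightarrow> emh 0 (flb w) = lbr chi gg w"
  by (cases w) (simp_all add: flb_def emh_flb_acc gen_eq_emh aone_eq_emh)

lemma emh_frb: "good w \<Longrightarrow> emh 0 (frb w) = rbr chi gg w"
  by (induction w rule: frb.induct) (simp_all add: emh_br gen_eq_emh aone_eq_emh)

lemma emh_e:
  assumes "1 \<le> k" "k \<le> m" "m < 2 * n"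
  shows "emh 0 (e k m) = ebr chi gg n q k m"
proof -
  consider "m < 2 * n - k" | "m > 2 * n - k" | "m = 2 * n - k" "m = n" | "m = 2 * n - k" "m \<noteq> n"
    by linarith
  then show ?thesis
  proof cases
    case 4
    then have "k \<le> m - 1" "m - 1 < 2 * n" "1 \<le> lt n m" "lt n m \<le> n"
      using assms by (auto simp: lt_def)
    with 4 assms good_W[of k "m - 1"] show ?thesis
      by (simp add: e_def ebr_def B_def emh_diff emh_sm amul_emh[symmetric] emh_flb gen_eq_emh)
  qed (use assms good_W[of k m] n3 in \<open>simp_all add: e_def ebr_def emh_flb emh_frb gen_eq_emh\<close>)
qed

lemma hm_flb_acc: "hm d u \<Longrightarrow> hm (d @ w) (flb_acc u d w)"
proof (induction u d w rule: flb_acc.induct)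
  case (2 u d y ys)
  have "hm (d @ [y]) (B (pp d [y]) u (X y))"
    by (rule hm_B[OF 2(2) hm_X]) simp
  from 2(1)[OF this] show ?case by simp
qed simp

lemma hm_flb: "hm w (flb w)"
  using hm_flb_acc[OF hm_X] by (cases w) (simp_all add: flb_def hm_def zero_list_def)

lemma hm_frb: "hm w (frb w)"
proof (induction w rule: frb.induct)
  case (3 y z ys)
  show ?case
    unfolding frb.simps by (rule hm_B[OF hm_X 3]) simp
qed (simp_all add: hm_def zero_list_def)

lemma e_self: "1 \<le> k \<Longrightarrow> k < 2 * n \<Longrightarrow> e k k = X (lt n k)"
  by (auto simp: e_def W_self flb_def lt_def)

lemma e_special: "e (n - 1) n = X n" "e n (n + 1) = X n"
  using n3 W_special by (auto simp: e_def flb_def)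

lemma W_nonempty: "1 \<le> k \<Longrightarrow> k \<le> m \<Longrightarrow> m < 2 * n \<Longrightarrow> W k m \<noteq> []"
  by (auto simp: ew_def)

lemma e_left:
  assumes "1 \<le> k" "k < m" "k \<le> pr m" "m + k < 2 * n"
  shows "e k m = B (pp (W k (pr m)) [lt n m]) (e k (pr m)) (X (lt n m))"
proof -
  have p: "pr m < m"
    using assms n3 by (auto simp: pr_def)
  have "W k m = W k (pr m) @ [lt n m]"
    by (rule W_pr) (use assms p in auto)
  moreover have "W k (pr m) \<noteq> []"
    by (rule W_nonempty) (use assms p in auto)
  moreover have "m < 2 * n - k" "pr m < 2 * n - k"
    using assms p by auto
  ultimately show ?thesis
    by (simp add: e_def flb_snoc)
qed

lemma e_left_step:
  assumes "1 \<le> k" "k \<le> m" "m + k + 1 < 2 * n" "m + 1 \<noteq> n"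
  shows "e k (m + 1) = B (pp (W k m) [lt n (m + 1)]) (e k m) (X (lt n (m + 1)))"
  using e_left[of k "m + 1"] assms by (simp add: pr_def)

lemma e_mid:
  assumes "1 \<le> k" "k < n" "k + m + 1 = 2 * n"
  shows "e k (m + 1) = B (inverse q * pp (W k m) [k]) (e k m) (X k)"
proof -
  have "lt n (m + 1) = k" "m + 1 = 2 * n - k" "m < 2 * n - k" "m + 1 \<noteq> n" "2 * n - Suc k = m"
    using assms by (auto simp: lt_def)
  then show ?thesis
    by (simp add: e_def)
qed

lemma e_right:
  assumes "1 \<le> k" "2 * n < m + k" "sc k \<le> m" "m < 2 * n"
  shows "e k m = B (pp [fl k] (W (sc k) m)) (X (fl k)) (e (sc k) m)"
proof -
  have s: "k < sc k"
    by (auto simp: sc_def)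
  have "W k m = fl k # W (sc k) m"
    using assms s by (intro W_sc) auto
  moreover have "W (sc k) m \<noteq> []"
    using assms s by (intro W_nonempty) auto
  then obtain z zs where "W (sc k) m = z # zs"
    by (cases "W (sc k) m") auto
  moreover have "m > 2 * n - k" "m > 2 * n - sc k"
    using assms s by auto
  ultimately show ?thesis
    by (simp add: e_def)
qed

lemma hm_e:
  assumes "1 \<le> k" "k \<le> m" "m < 2 * n"
  shows "hm (W k m) (e k m)"
proof -
  consider "m < 2 * n - k" | "m > 2 * n - k" | "m = n" "k = n" | "k + m = 2 * n" "k < n"
    using assms by linarith
  then show ?thesis
  proof cases
    case 3
    then show ?thesis
      using n3 W_self[of n] by (simp add: e_def hm_X lt_def)
  next
    case 4
    then obtain p where p: "m = p + 1" "k \<le> p"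
      using assms by (cases m) auto
    have "mset (W k m) = mset (W k p) + mset [k]"
      using 4 assms p W_pr[of k m] by (auto simp: pr_def lt_def)
    moreover have "p < 2 * n - k"
      using 4 p by auto
    then have "hm (W k p) (e k p)"
      by (simp add: e_def hm_flb)
    ultimately have "hm (W k m) (B (inverse q * pp (W k p) [k]) (e k p) (X k))"
      using hm_B[OF _ hm_X] by blast
    moreover have "e k m = B (inverse q * pp (W k p) [k]) (e k p) (X k)"
      using e_mid[of k p] 4 assms p by simp
    ultimately show ?thesis by simp
  qed (simp_all add: e_def hm_flb hm_frb)
qed

section \<open>Skew commutation relations\<close>

lemma relatorsI:
  "1 \<le> i \<Longrightarrow> i \<le> n - 2 \<Longrightarrow>
    br chi gg (gen i) [i] (br chi gg (gen i) [i] (gen (i+1)) [i+1]) [i,i+1] \<in> relators chi gg n"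
  "1 \<le> i \<Longrightarrow> i \<le> n - 2 \<Longrightarrow>
    br chi gg (br chi gg (gen i) [i] (gen (i+1)) [i+1]) [i,i+1] (gen (i+1)) [i+1] \<in> relators chi gg n"
  "br chi gg (gen (n-2)) [n-2] (br chi gg (gen (n-2)) [n-2] (gen n) [n]) [n-2,n] \<in> relators chi gg n"
  "1 \<le> i \<Longrightarrow> i < j \<Longrightarrow> j \<le> n - 1 \<Longrightarrow> j > i + 1 \<Longrightarrow>
    br chi gg (gen i) [i] (gen j) [j] \<in> relators chi gg n"
  "1 \<le> i \<Longrightarrow> i \<le> n - 3 \<Longrightarrow> br chi gg (gen i) [i] (gen n) [n] \<in> relators chi gg n"
  "br chi gg (gen (n-1)) [n-1] (gen n) [n] \<in> relators chi gg n"
  unfolding relators_def by blast+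

lemma serre_right:
  assumes "1 \<le> i" "i + 2 \<le> n"
  shows "B (pp [i] [i, i + 1]) (X i) (B (pp [i] [i + 1]) (X i) (X (i + 1))) \<in> J"
  unfolding J_def mem_Collect_eq
  using assms relatorsI(1)[of i] ideal_gen.gen_in[of _ "relators chi gg n" chi]
  by (simp add: emh_br[OF gen_eq_emh[symmetric] emh_br[OF gen_eq_emh[symmetric] gen_eq_emh[symmetric]]])

lemma serre_left:
  assumes "1 \<le> i" "i + 2 \<le> n"
  shows "B (pp [i, i + 1] [i + 1]) (B (pp [i] [i + 1]) (X i) (X (i + 1))) (X (i + 1)) \<in> J"
  unfolding J_def mem_Collect_eq
  using assms relatorsI(2)[of i] ideal_gen.gen_in[of _ "relators chi gg n" chi]
  by (simp add: emh_br[OF emh_br[OF gen_eq_emh[symmetric] gen_eq_emh[symmetric]] gen_eq_emh[symmetric]])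

lemma serre_right_n:
  "B (pp [n - 2] [n - 2, n]) (X (n - 2)) (B (pp [n - 2] [n]) (X (n - 2)) (X n)) \<in> J"
  unfolding J_def mem_Collect_eq
  using n3 relatorsI(3) ideal_gen.gen_in[of _ "relators chi gg n" chi]
  by (simp add: emh_br[OF gen_eq_emh[symmetric] emh_br[OF gen_eq_emh[symmetric] gen_eq_emh[symmetric]]])

lemma pp_letter_self: "1 \<le> j \<Longrightarrow> j \<le> n \<Longrightarrow> pp [j] [j] = q"
  by (simp add: pp_letters p_ii)

lemma sy_adj:
  assumes "1 \<le> a" "a \<le> n" "1 \<le> b" "b \<le> n" "adj a b"
  shows "pp [a] [b] * pp [b] [a] * q = 1"
  using sy_letters[OF assms(1-4)] assms q_nz by (auto simp: sy_def adj_def)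

text \<open>The relators have their letters in increasing order, whereas the second half of
  \<open>e(k,m)\<close> runs downwards. Proportionality of the two Serre elements converts one order
  into the other.\<close>

lemma serre_reversed_right:
  assumes "1 \<le> i" "i + 2 \<le> n"
  shows "B (pp [i + 1] [i + 1, i]) (X (i + 1)) (B (pp [i + 1] [i]) (X (i + 1)) (X i)) \<in> J"
proof -
  have "B (pp [i] [i + 1] * q) (B (pp [i] [i + 1]) (X i) (X (i + 1))) (X (i + 1)) \<in> J"
    using serre_left[OF assms] assms by (simp add: pp_Cons_left[of i "[Suc i]"] pp_letter_self)
  moreover have "pp [i] [i + 1] * pp [i + 1] [i] * q = 1"
    using assms by (intro sy_adj) (auto simp: adj_def)
  ultimately show ?thesis
    using serre_left_to_right assms
    by (simp add: pp_Cons_right[of "[Suc i]" "Suc i" "[i]"] pp_letter_self)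
qed

lemma serre_reversed_left:
  assumes "1 \<le> i" "i + 2 \<le> n"
  shows "B (pp [i + 1, i] [i]) (B (pp [i + 1] [i]) (X (i + 1)) (X i)) (X i) \<in> J"
proof -
  have "B (q * pp [i] [i + 1]) (X i) (B (pp [i] [i + 1]) (X i) (X (i + 1))) \<in> J"
    using serre_right[OF assms] assms by (simp add: pp_Cons_right[of "[i]" i "[Suc i]"] pp_letter_self)
  moreover have "pp [i + 1] [i] * pp [i] [i + 1] * q = 1"
    using assms by (intro sy_adj) (auto simp: adj_def)
  ultimately show ?thesis
    using serre_right_to_left assms
    by (simp add: pp_Cons_left[of "Suc i" "[i]"] pp_letter_self)
qed

lemma serre_reversed_left_n:
  "B (pp [n, n - 2] [n - 2]) (B (pp [n] [n - 2]) (X n) (X (n - 2))) (X (n - 2)) \<in> J"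
proof -
  have "B (q * pp [n - 2] [n]) (X (n - 2)) (B (pp [n - 2] [n]) (X (n - 2)) (X n)) \<in> J"
    using serre_right_n n3 by (simp add: pp_Cons_right[of "[n - 2]" "n - 2" "[n]"] pp_letter_self)
  moreover have "pp [n] [n - 2] * pp [n - 2] [n] * q = 1"
    using n3 by (intro sy_adj) (auto simp: adj_def)
  ultimately show ?thesis
    using serre_right_to_left n3
    by (simp add: pp_Cons_left[of n "[n - 2]"] pp_letter_self)
qed

text \<open>The relators cover a < b; the other order follows because p(x_a,x_b) p(x_b,x_a) = 1 for
  distinct letters that are not joined.\<close>

lemma letters_commute:
  assumes "1 \<le> a" "a \<le> n" "1 \<le> b" "b \<le> n" "a \<noteq> b" "\<not> adj a b"
  shows "B (pp [a] [b]) (X a) (X b) \<in> J"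
proof -
  have less: "B (pp [a] [b]) (X a) (X b) \<in> J" if ab: "1 \<le> a" "a < b" "b \<le> n" "\<not> adj a b" for a b
  proof -
    have "b \<noteq> a + 1 \<or> b = n" "b \<noteq> n \<or> a \<noteq> n - 2"
      using ab by (auto simp: adj_def)
    then consider "b \<le> n - 1" "b > a + 1" | "b = n" "a \<le> n - 3" | "b = n" "a = n - 1"
      using ab n3 by linarith
    then have "br chi gg (gen a) [a] (gen b) [b] \<in> relators chi gg n"
    proof cases
      case 1
      with ab show ?thesis by (intro relatorsI) auto
    next
      case 2
      with ab relatorsI(5)[of a] show ?thesis by simp
    next
      case 3
      with relatorsI(6) show ?thesis by simp
    qed
    then have "emh 0 (B (pp [a] [b]) (X a) (X b)) \<in> rel_ideal"
      using ab by (subst emh_br[OF gen_eq_emh[symmetric] gen_eq_emh[symmetric]])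
        (auto intro: ideal_gen.gen_in)
    then show ?thesis by (simp add: J_def)
  qed
  have adj: "adj b a = adj a b"
    by (auto simp: adj_def)
  show ?thesis
  proof (cases "a < b")
    case True
    with less assms show ?thesis by blast
  next
    case False
    then have "B (pp [b] [a]) (X b) (X a) \<in> J"
      using less assms adj by simp
    moreover have "pp [b] [a] * pp [a] [b] = 1"
      using sy_letters[of b a] assms adj by (simp add: sy_def)
    ultimately show ?thesis
      by (rule B_commute)
  qed
qed

section \<open>Skew commutation of words without common or neighbouring letters\<close>

lemma B_mult_commute_right:
  assumes "B p z u \<in> J" "B p' z v \<in> J"
  shows "B (p * p') z (u * v) \<in> J"
proof -
  have "B (p * p') z (u * v) = B p z u * v + sm p (u * B p' z v)"
    by (simp add: B_def sm_simps)
  also have "\<dots> \<in> J"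
    by (intro J_add J_sm J_rmult[OF assms(1)] J_lmult[OF assms(2)])
  finally show ?thesis .
qed

lemma single_Cons: "Poly_Mapping.single (a # w) (1::'k) = X a * Poly_Mapping.single w 1"
  by (simp add: mult_single plus_list_def)

definition far :: "nat list \<Rightarrow> nat list \<Rightarrow> bool" where
  "far u v \<longleftrightarrow> (\<forall>a\<in>set u. \<forall>b\<in>set v. a \<noteq> b \<and> \<not> adj a b)"

lemma words_commute:
  assumes "good u" "good v" "far u v"
  shows "B (pp u v) (Poly_Mapping.single u 1) (Poly_Mapping.single v 1) \<in> J"
  using assms
proof (induction u)
  case Nil
  have "B 1 1 z = 0" for z :: "'k free_alg"
    by (simp add: B_def)
  moreover have "Poly_Mapping.single ([] :: nat list) (1 :: 'k) = 1"
    by (simp flip: zero_list_def)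
  ultimately show ?case
    using J_0 by simp
next
  case (Cons a u)
  have "B (pp [a] v) (X a) (Poly_Mapping.single v 1) \<in> J"
    using Cons.prems
  proof (induction v)
    case Nil
    have "B 1 z 1 = 0" for z :: "'k free_alg"
      by (simp add: B_def)
    moreover have "Poly_Mapping.single ([] :: nat list) (1 :: 'k) = 1"
      by (simp flip: zero_list_def)
    ultimately show ?case
      using J_0 Nil by (simp add: pp_Nil(2)[of "[a]"])
  next
    case (Cons b v)
    then have "B (pp [a] [b]) (X a) (X b) \<in> J"
      by (intro letters_commute) (auto simp: far_def)
    moreover have "B (pp [a] v) (X a) (Poly_Mapping.single v 1) \<in> J"
      using Cons by (auto simp: far_def)
    ultimately show ?case
      unfolding single_Cons[of b v]
      using Cons.prems by (subst pp_Cons_right) (auto intro: B_mult_commute_right)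
  qed
  moreover have "B (pp u v) (Poly_Mapping.single u 1) (Poly_Mapping.single v 1) \<in> J"
    using Cons by (auto simp: far_def)
  ultimately show ?case
    unfolding single_Cons[of a u] by (subst pp_Cons_left) (rule B_mult_commute)
qed

lemma far_commute:
  assumes "hm du u" "hm dv v" "good du" "good dv" "far du dv"
  shows "B (pp du dv) u v \<in> J"
proof -
  have B_add: "B p (x + x') y = B p x y + B p x' y" "B p x (y + y') = B p x y + B p x y'"
    for p x x' y y'
    by (simp_all add: B_def sm_simps)
  have B0: "B p 0 y = 0" "B p x 0 = 0" for p x y
    by (simp_all add: B_def)
  show ?thesis
  proof (induction u rule: poly_mapping_induct_single)
    case (single w c)
    then have w: "mset w = mset du"
      using assms(1) by (simp add: hm_def)
    show ?case
    proof (induction v rule: poly_mapping_induct_single)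
      case (single w' c')
      then have w': "mset w' = mset dv"
        using assms(2) by (simp add: hm_def)
      have s: "set w = set du" "set w' = set dv"
        using w w' by (metis set_mset_mset)+
      have "B (pp w w') (Poly_Mapping.single w 1) (Poly_Mapping.single w' 1) \<in> J"
        using assms s by (intro words_commute) (auto simp: far_def)
      moreover have "Poly_Mapping.single w c = sm c (Poly_Mapping.single w 1)"
        "Poly_Mapping.single w' c' = sm c' (Poly_Mapping.single w' 1)"
        by (simp_all add: sm_single)
      ultimately show ?case
        using pw_mset[OF w w', of chi gg] by (simp add: B_sm_left B_sm_right J_sm)
    qed (auto simp: B_add B0 intro: J_0 J_add)
  qed (auto simp: B_add B0 intro: J_0 J_add)
qed

lemma br_assoc:
  assumes "B (pp du dw) u w \<in> J" "good du" "mset d1 = mset du + mset dv" "mset d2 = mset dv + mset dw"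
  shows "B (pp d1 dw) (B (pp du dv) u v) w \<approx> B (pp du d2) u (B (pp dv dw) v w)"
proof -
  have "pp d1 dw = pp du dw * pp dv dw"
    using pw_mset[of d1 "du @ dv" dw dw chi gg] assms by (simp add: pp_append_left)
  moreover have "pp du d2 = pp du dv * pp du dw"
    using pw_mset[of du du d2 "dv @ dw" chi gg] assms by (simp add: pp_append_right)
  ultimately show ?thesis
    using B_assoc[OF assms(1)] by simp
qed

section \<open>The scalars p(d,x_j) p(x_j,d) for the words e(k,m)\<close>

lemma sy_Cons: "good (a # d) \<Longrightarrow> 1 \<le> j \<Longrightarrow> j \<le> n \<Longrightarrow> sy (a # d) j = sy [a] j * sy d j"
  by (simp add: sy_def pp_Cons_left[of a d] pp_Cons_right[of "[j]" a d])

lemma far_sy: "good d \<Longrightarrow> 1 \<le> j \<Longrightarrow> j \<le> n \<Longrightarrow> far d [j] \<Longrightarrow> sy d j = 1"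
proof (induction d)
  case Nil
  then show ?case by (simp add: sy_def pp_Nil(2)[of "[j]"])
next
  case (Cons a d)
  then have "sy d j = 1"
    by (simp add: far_def)
  with Cons.prems show ?case
    by (subst sy_Cons) (auto simp: sy_letters far_def)
qed

lemma adj_count_Suc:
  "j + 2 \<le> n \<Longrightarrow> adj_count d (j + 1) = count (mset d) j + (if j + 2 < n then count (mset d) (j + 2) else 0)
    + (if j + 3 = n then count (mset d) n else 0)"
  by (auto simp: adj_count_def)

lemma sy_W_eval:
  assumes "1 \<le> k" "k \<le> m" "m < 2 * n" "1 \<le> j" "j \<le> n"
    and "count (mset (W k m)) j = c" "adj_count (W k m) j = a"
  shows "sy (W k m) j = (q ^ 2) ^ c * inverse q ^ a"
  using sy_W[OF assms(1-5)] assms(6,7) by simp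

text \<open>Each value is q^(2c - a), where c counts the letter in question and a its neighbours in
  the word; every item exhibits c and a.\<close>

lemma sy_values_left:
  assumes "1 \<le> k"
  shows "k \<le> l \<Longrightarrow> l + 2 \<le> n \<Longrightarrow> sy (W k l) (l + 1) = inverse q"
    and "k + 2 \<le> n \<Longrightarrow> sy (W k (n - 2)) n = inverse q"
    and "k < j \<Longrightarrow> j + 2 \<le> n \<Longrightarrow> sy (W k j) j = q"
    and "k < j \<Longrightarrow> j + 2 \<le> n \<Longrightarrow> j < m \<Longrightarrow> m + j + 2 \<le> 2 * n \<Longrightarrow> sy (W k m) j = 1"
    and "k < j \<Longrightarrow> j + 1 \<le> n \<Longrightarrow> m + j + 1 = 2 * n \<Longrightarrow> sy (W k m) j = inverse q"
    and "k + 2 \<le> n \<Longrightarrow> k < m \<Longrightarrow> m + k + 2 \<le> 2 * n \<Longrightarrow> sy (W k m) k = q"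
    and "k + 1 \<le> n \<Longrightarrow> m + k + 1 = 2 * n \<Longrightarrow> sy (W k m) k = 1"
    and "k + 2 \<le> n \<Longrightarrow> k < m \<Longrightarrow> m + k + 2 \<le> 2 * n \<Longrightarrow> sy (W (k + 1) m) k = inverse q"
    and "k + 2 \<le> n \<Longrightarrow> m + k + 1 = 2 * n \<Longrightarrow> sy (W (k + 1) m) k = inverse q ^ 2"
proof -
  obtain i where i: "k = i + 1"
    using assms by (metis le_add_diff_inverse2)
  have ev: "(q ^ 2) ^ 0 * inverse q ^ 1 = inverse q" "(q ^ 2) ^ 1 * inverse q ^ 1 = q"
    "(q ^ 2) ^ 1 * inverse q ^ 2 = 1" "(q ^ 2) ^ 1 * inverse q ^ 3 = inverse q"
    "(q ^ 2) ^ 0 * inverse q ^ 2 = inverse q ^ 2"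
    using q_nz by (simp_all add: power2_eq_square power3_eq_cube field_simps)
  show "sy (W k l) (l + 1) = inverse q" if "k \<le> l" "l + 2 \<le> n"
    by (subst sy_W_eval[where c = 0 and a = 1])
      (use that assms ev in \<open>auto simp: adj_count_Suc count_W simp del: One_nat_def\<close>)
  show "sy (W k (n - 2)) n = inverse q" if "k + 2 \<le> n"
    by (subst sy_W_eval[where c = 0 and a = 1])
      (use that assms ev in \<open>auto simp: adj_count_def count_W simp del: One_nat_def\<close>)
  show "sy (W k j) j = q" if "k < j" "j + 2 \<le> n"
  proof -
    from \<open>k < j\<close> obtain l where "j = l + 1" by (cases j) auto
    then show ?thesis
      by (subst sy_W_eval[where c = 1 and a = 1])
        (use that assms ev in \<open>auto simp: adj_count_Suc count_W simp del: One_nat_def\<close>)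
  qed
  show "sy (W k m) j = 1" if "k < j" "j + 2 \<le> n" "j < m" "m + j + 2 \<le> 2 * n"
  proof -
    from \<open>k < j\<close> obtain l where "j = l + 1" by (cases j) auto
    then show ?thesis
      by (subst sy_W_eval[where c = 1 and a = 2])
        (use that assms ev in \<open>auto simp: adj_count_Suc count_W simp del: One_nat_def\<close>)
  qed
  show "sy (W k m) j = inverse q" if "k < j" "j + 1 \<le> n" "m + j + 1 = 2 * n"
  proof -
    from \<open>k < j\<close> obtain l where l: "j = l + 1" by (cases j) auto
    show ?thesis
    \<comment> \<open>For j = n - 1 the word ends at position n, before which n - 1 is skipped: the
      letter j itself is absent.\<close>
    proof (cases "j + 1 = n")
      case True
      then show ?thesis
        using l by (subst sy_W_eval[where c = 0 and a = 1])
          (use that assms ev in \<open>auto simp: adj_count_Suc count_W simp del: One_nat_def\<close>)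
    next
      case False
      then show ?thesis
        using l by (subst sy_W_eval[where c = 1 and a = 3])
          (use that assms ev in \<open>auto simp: adj_count_Suc count_W simp del: One_nat_def\<close>)
    qed
  qed
  show "sy (W k m) k = q" if "k + 2 \<le> n" "k < m" "m + k + 2 \<le> 2 * n"
    by (subst sy_W_eval[where c = 1 and a = 1])
      (use that ev i in \<open>auto simp: adj_count_Suc count_W simp del: One_nat_def\<close>)
  show "sy (W k m) k = 1" if "k + 1 \<le> n" "m + k + 1 = 2 * n"
  proof (cases "k + 1 = n")
    case True
    then show ?thesis
      by (subst sy_W_eval[where c = 0 and a = 0])
        (use that i in \<open>auto simp: adj_count_Suc count_W simp del: One_nat_def\<close>)
  next
    case False
    then show ?thesis
      by (subst sy_W_eval[where c = 1 and a = 2])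
        (use that ev i in \<open>auto simp: adj_count_Suc count_W simp del: One_nat_def\<close>)
  qed
  show "sy (W (k + 1) m) k = inverse q" if "k + 2 \<le> n" "k < m" "m + k + 2 \<le> 2 * n"
    by (subst sy_W_eval[where c = 0 and a = 1])
      (use that ev i in \<open>auto simp: adj_count_Suc count_W simp del: One_nat_def\<close>)
  show "sy (W (k + 1) m) k = inverse q ^ 2" if "k + 2 \<le> n" "m + k + 1 = 2 * n"
    by (subst sy_W_eval[where c = 0 and a = 2])
      (use that ev i in \<open>auto simp: adj_count_Suc count_W simp del: One_nat_def\<close>)
qed

lemma sy_values_right:
  assumes "m < 2 * n" "1 \<le> j" "j + 1 \<le> n"
  shows "j + 2 \<le> n \<Longrightarrow> 2 * n < j + m \<Longrightarrow> sy (W (j + 1) m) j = inverse q"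
    and "j + 2 \<le> n \<Longrightarrow> 2 * n < j + m \<Longrightarrow> j + 2 \<le> k \<Longrightarrow> k + j + 1 \<le> 2 * n \<Longrightarrow> sy (W k m) j = 1"
    and "2 * n < j + m \<Longrightarrow> k + j = 2 * n \<Longrightarrow> sy (W k m) j = q"
    and "k + j = 2 * n + 1 \<Longrightarrow> k \<le> m \<Longrightarrow> sy (W k m) j = inverse q"
    and "j + 2 \<le> n \<Longrightarrow> j + 2 \<le> k \<Longrightarrow> k \<le> m \<Longrightarrow> m + j + 1 = 2 * n \<Longrightarrow> sy (W k m) j = inverse q"
    and "n + 2 \<le> m \<Longrightarrow> sy (W (n + 2) m) n = inverse q"
    and "n + 2 \<le> m \<Longrightarrow> sy (W (n + 1) m) n = inverse q"
proof -
  obtain i where i: "j = i + 1"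
    using assms by (metis le_add_diff_inverse2)
  have ev: "(q ^ 2) ^ 0 * inverse q ^ 1 = inverse q" "(q ^ 2) ^ 1 * inverse q ^ 1 = q"
    "(q ^ 2) ^ 1 * inverse q ^ 2 = 1" "(q ^ 2) ^ 1 * inverse q ^ 3 = inverse q"
    using q_nz by (simp_all add: power2_eq_square power3_eq_cube field_simps)
  show "sy (W (j + 1) m) j = inverse q" if "j + 2 \<le> n" "2 * n < j + m"
    by (subst sy_W_eval[where c = 1 and a = 3])
      (use that assms ev i in \<open>auto simp: adj_count_Suc count_W simp del: One_nat_def\<close>)
  show "sy (W k m) j = 1" if "j + 2 \<le> n" "2 * n < j + m" "j + 2 \<le> k" "k + j + 1 \<le> 2 * n"
    by (subst sy_W_eval[where c = 1 and a = 2])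
      (use that assms ev i in \<open>auto simp: adj_count_Suc count_W simp del: One_nat_def\<close>)
  show "sy (W k m) j = q" if "2 * n < j + m" "k + j = 2 * n"
    by (subst sy_W_eval[where c = 1 and a = 1])
      (use that assms ev i in \<open>auto simp: adj_count_Suc count_W simp del: One_nat_def\<close>)
  show "sy (W k m) j = inverse q" if "k + j = 2 * n + 1" "k \<le> m"
    by (subst sy_W_eval[where c = 0 and a = 1])
      (use that assms ev i in \<open>auto simp: adj_count_Suc count_W simp del: One_nat_def\<close>)
  show "sy (W k m) j = inverse q" if "j + 2 \<le> n" "j + 2 \<le> k" "k \<le> m" "m + j + 1 = 2 * n"
    by (subst sy_W_eval[where c = 0 and a = 1])
      (use that assms ev i in \<open>auto simp: adj_count_Suc count_W simp del: One_nat_def\<close>)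
  show "sy (W (n + 2) m) n = inverse q" if "n + 2 \<le> m"
    by (subst sy_W_eval[where c = 0 and a = 1])
      (use that assms ev in \<open>auto simp: adj_count_def count_W simp del: One_nat_def\<close>)
  show "sy (W (n + 1) m) n = inverse q" if "n + 2 \<le> m"
    by (subst sy_W_eval[where c = 0 and a = 1])
      (use that assms ev in \<open>auto simp: adj_count_def count_W simp del: One_nat_def\<close>)
qed

section \<open>Rebracketing and vanishing brackets for words with m < 2n - k\<close>

lemma farI_less:
  assumes "\<And>a. a \<in> set u \<Longrightarrow> a \<le> s" "\<And>b. b \<in> set v \<Longrightarrow> s + 2 \<le> b" "s + 3 \<le> n"
  shows "far u v"
  unfolding far_def adj_def using assms by fastforce

lemma farI_greater:
  assumes "\<And>a. a \<in> set u \<Longrightarrow> s + 2 \<le> a" "\<And>b. b \<in> set v \<Longrightarrow> b \<le> s" "s + 3 \<le> n"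
  shows "far u v"
  unfolding far_def adj_def using assms by fastforce

text \<open>\<open>e[k,i]\<close> is bracketed from the left; x_k can be pulled out because the
  letters after the second one are neither equal nor adjacent to k. The exception k = n - 2, i = n
  is the single bracket [x_{n-2}, x_n] and needs no rearrangement.\<close>

lemma e_cons:
  assumes "1 \<le> k" "k + 1 \<le> i" "i + k + 1 < 2 * n" "k + 2 \<le> n"
  shows "e k i \<approx> B (pp [k] (W (k + 1) i)) (X k) (e (k + 1) i)"
  using assms(2,3)
proof (induction i rule: less_induct)
  case (less i)
  have kk: "W k k = [k]" "e k k = X k"
    using W_self[of k] e_self[of k] assms by (simp_all add: lt_def)
  consider "i = k + 1" | "i = n" "k = n - 2" | "k + 1 < i" "i \<noteq> n \<or> k + 3 \<le> n"
    using less.prems assms by linarith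
  then show ?case
  proof cases
    case 1
    then have "pr i = k" "W (k + 1) i = [k + 1]" "e (k + 1) i = X (k + 1)" "lt n i = k + 1"
      using W_self[of "k + 1"] e_self[of "k + 1"] assms by (auto simp: pr_def lt_def)
    with e_left[of k i] 1 assms kk show ?thesis
      by simp
  next
    case 2
    then have "pr i = k" "W (k + 1) i = [n]" "e (k + 1) i = X n" "lt n i = n" "n - 1 = k + 1"
      using W_special e_special n3 by (auto simp: pr_def lt_def numeral_2_eq_2 Suc_diff_Suc)
    with e_left[of k i] 2 assms kk show ?thesis
      by simp
  next
    case 3
    define p where "p = pr i"
    define t where "t = lt n i"
    have p: "p < i" "k + 1 \<le> p"
      using 3 by (auto simp: p_def pr_def)
    have pk: "k + 1 \<le> pr i"
      using 3 by (auto simp: pr_def)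
    have t: "k + 2 \<le> t" "t \<le> n" "t = n \<Longrightarrow> k + 3 \<le> n"
      using 3 less.prems assms by (auto simp: t_def lt_def)
    have "e k i = B (pp (W k p) [t]) (e k p) (X t)"
      unfolding p_def t_def by (rule e_left) (use 3 pk less.prems assms in auto)
    also have "\<dots> \<approx> B (pp (W k p) [t]) (B (pp [k] (W (k + 1) p)) (X k) (e (k + 1) p)) (X t)"
      by (intro cong_B cong_refl less.IH) (use p less.prems in auto)
    also have "\<dots> \<approx> B (pp [k] (W (k + 1) i)) (X k) (B (pp (W (k + 1) p) [t]) (e (k + 1) p) (X t))"
    proof (rule br_assoc)
      show "B (pp [k] [t]) (X k) (X t) \<in> J"
        by (rule letters_commute) (use t assms in \<open>auto simp: adj_def\<close>)
      have "mset (W k p) = mset (W k k @ W (k + 1) p)"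
        by (rule mset_W_split) (use p less.prems assms in auto)
      then show "mset (W k p) = mset [k] + mset (W (k + 1) p)"
        by (simp add: kk)
      have "W (k + 1) i = W (k + 1) p @ [t]"
        unfolding p_def t_def by (rule W_pr) (use 3 pk p less.prems assms in auto)
      then show "mset (W (k + 1) i) = mset (W (k + 1) p) + mset [t]"
        by simp
    qed (use assms in auto)
    also have "B (pp (W (k + 1) p) [t]) (e (k + 1) p) (X t) = e (k + 1) i"
      unfolding p_def t_def by (rule e_left[symmetric]) (use 3 pk less.prems assms in auto)
    finally show ?thesis .
  qed
qed

lemma W_letter: "1 \<le> k \<Longrightarrow> k < n \<Longrightarrow> W k k = [k]"
  and e_letter: "1 \<le> k \<Longrightarrow> k < n \<Longrightarrow> e k k = X k"
  using W_self[of k] e_self[of k] by (simp_all add: lt_def)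

lemma mset_W_Cons:
  assumes "1 \<le> k" "k + 2 \<le> n" "k < m" "m < 2 * n"
  shows "mset (W k m) = mset [k] + mset (W (k + 1) m)"
  using mset_W_split[of k k m] assms by (fastforce simp: W_letter)

text \<open>Induction lowers k from j: for k < j the letter x_k is far from every letter of
  \<open>e(j+1,i)\<close>, so it can be bracketed into the first factor.\<close>

lemma e_split_left:
  assumes "1 \<le> k" "k \<le> j" "j < i" "i + j + 1 < 2 * n" "j + 2 \<le> n"
  shows "e k i \<approx> B (pp (W k j) (W (j + 1) i)) (e k j) (e (j + 1) i)"
  using assms(2,1)
proof (induction k rule: inc_induct)
  case base
  then show ?case
    using e_cons[of j i] assms by (simp add: W_letter e_letter)
next
  case (step k)
  have "e k i \<approx> B (pp [k] (W (k + 1) i)) (X k) (e (k + 1) i)"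
    by (rule e_cons) (use step assms in auto)
  also have "\<dots> \<approx> B (pp [k] (W (k + 1) i)) (X k)
      (B (pp (W (k + 1) j) (W (j + 1) i)) (e (k + 1) j) (e (j + 1) i))"
    using step by (intro cong_B cong_refl) auto
  also have "\<dots> \<approx> B (pp (W k j) (W (j + 1) i)) (B (pp [k] (W (k + 1) j)) (X k) (e (k + 1) j)) (e (j + 1) i)"
  proof (rule cong_sym, rule br_assoc)
    have "b \<le> n" "k + 2 \<le> b" if "b \<in> set (W (j + 1) i)" for b
      using set_W_bounds(1,2)[OF _ _ _ that] step assms by auto
    then have "far [k] (W (j + 1) i)"
      by (intro farI_less[of _ k]) (use step assms in auto)
    then show "B (pp [k] (W (j + 1) i)) (X k) (e (j + 1) i) \<in> J"
      using step assms by (intro far_commute hm_X hm_e good_W) auto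
    show "mset (W k j) = mset [k] + mset (W (k + 1) j)"
      by (rule mset_W_Cons) (use step assms in auto)
    have "mset (W (k + 1) i) = mset (W (k + 1) j @ W (j + 1) i)"
      by (rule mset_W_split) (use step assms in auto)
    then show "mset (W (k + 1) i) = mset (W (k + 1) j) + mset (W (j + 1) i)"
      by simp
  qed (use step assms in auto)
  also have "\<dots> \<approx> B (pp (W k j) (W (j + 1) i)) (e k j) (e (j + 1) i)"
    by (intro cong_B cong_refl cong_sym[OF e_cons]) (use step assms in auto)
  finally show ?case .
qed

text \<open>A Serre relation settles two letters; all further letters skew commute with x_k and are
  carried along by reassociation.\<close>

lemma first_letter_commutes:
  assumes "1 \<le> k" "k < i" "i + k + 2 \<le> 2 * n" "k + 2 \<le> n"
  shows "B (pp [k] (W k i)) (X k) (e k i) \<in> J"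
  using assms(2,3)
proof (induction i rule: less_induct)
  case (less i)
  note kk = W_letter[of k] e_letter[of k]
  have ei: "e k i = B (pp (W k (pr i)) [lt n i]) (e k (pr i)) (X (lt n i))"
    "W k i = W k (pr i) @ [lt n i]"
    by (rule e_left W_pr; use less.prems assms in \<open>auto simp: pr_def\<close>)+
  consider "i = k + 1" | "i = n" "k = n - 2" | "k + 1 < i" "i \<noteq> n \<or> k + 3 \<le> n"
    using less.prems assms by linarith
  then show ?case
  proof cases
    case 1
    then have "pr i = k" "lt n i = k + 1"
      using assms by (auto simp: pr_def lt_def)
    then show ?thesis
      using serre_right[of k] assms unfolding ei by (simp add: kk)
  next
    case 2
    then have "pr i = n - 2" "lt n i = n"
      by (auto simp: pr_def lt_def)
    with 2 show ?thesis
      using serre_right_n assms unfolding ei by (simp add: W_letter e_letter)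
  next
    case 3
    define p where "p = pr i"
    define t where "t = lt n i"
    have p: "p < i" "k < p"
      using 3 by (auto simp: p_def pr_def)
    have pk: "k + 1 \<le> pr i"
      using 3 by (auto simp: pr_def)
    have t: "k + 2 \<le> t" "t \<le> n" "t = n \<Longrightarrow> k + 3 \<le> n"
      using 3 less.prems assms by (auto simp: t_def lt_def)
    have "B (pp ([k] @ W k p) [t]) (B (pp [k] (W k p)) (X k) (e k p)) (X t)
        \<approx> B (pp [k] (W k i)) (X k) (B (pp (W k p) [t]) (e k p) (X t))"
      by (rule br_assoc[OF letters_commute])
        (use t assms in \<open>auto simp: adj_def ei(2) p_def t_def\<close>)
    moreover have "B (pp ([k] @ W k p) [t]) (B (pp [k] (W k p)) (X k) (e k p)) (X t) \<in> J"
      by (rule B_in_J_left, rule less.IH) (use p less.prems in auto)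
    ultimately show ?thesis
      unfolding ei(1) p_def[symmetric] t_def[symmetric] by (rule cong_J[OF cong_sym])
  qed
qed

lemma last_letter_commutes:
  assumes "1 \<le> k" "k < j" "j + 1 \<le> n"
  shows "B (pp (W k j) [j]) (e k j) (X j) \<in> J"
proof -
  obtain l where l: "j = l + 1"
    using assms by (cases j) auto
  have "k \<le> l" using assms l by simp
  from this assms(1) show ?thesis
  proof (induction k rule: inc_induct)
    case base
    have "e l j = B (pp [l] [j]) (X l) (X j)" "W l j = [l, j]"
      using e_left_step[of l l] W_pr[of l j] base assms l
      by (auto simp: pr_def lt_def W_letter e_letter)
    then show ?case
      using serre_left[of l] base assms l by simp
  next
    case (step k)
    have "B (pp (W k j) [j]) (e k j) (X j)
        \<approx> B (pp (W k j) [j]) (B (pp [k] (W (k + 1) j)) (X k) (e (k + 1) j)) (X j)"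
      by (intro cong_B cong_refl e_cons) (use step assms l in auto)
    also have "\<dots> \<approx> B (pp [k] (W (k + 1) j @ [j])) (X k) (B (pp (W (k + 1) j) [j]) (e (k + 1) j) (X j))"
    proof (rule br_assoc)
      show "B (pp [k] [j]) (X k) (X j) \<in> J"
        by (rule letters_commute) (use step assms l in \<open>auto simp: adj_def\<close>)
      show "mset (W k j) = mset [k] + mset (W (k + 1) j)"
        by (rule mset_W_Cons) (use step assms l in auto)
    qed (use step assms l in auto)
    finally show ?case
      by (rule cong_J) (rule B_in_J_right, use step in auto)
  qed
qed

text \<open>Middle letter argument with x = e[k,j-1], y = x_j, z = e[j+1,i]. The outer two are far
  apart, and the Serre conditions are \<open>last_letter_commutes\<close> and
  \<open>first_letter_commutes\<close>.\<close>

lemma inner_letter_commutes: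
  assumes "1 \<le> k" "k < j" "j + 2 \<le> n" "j < i" "i + j + 2 \<le> 2 * n"
  shows "B (pp (W k i) [j]) (e k i) (X j) \<in> J"
proof -
  obtain l where l: "j = l + 1" "k \<le> l"
    using assms by (cases j) auto
  let ?z = "W (j + 1) i"
  have Wj: "W k j = W k l @ [j]"
    using W_pr[of k j] assms l by (auto simp: pr_def lt_def)
  have ej: "e k j = B (pp (W k l) [j]) (e k l) (X j)"
    using e_left_step[of k l] assms l by (simp add: lt_def)
  have g: "good (W k l)" "good [j]" "good ?z"
    using assms l good_W[of k l] good_W[of "j + 1" i] by auto
  have "B (pp (W k l) [j] * q * pp ?z [j])
     (B (pp (W k l) ?z * pp [j] ?z) (B (pp (W k l) [j]) (e k l) (X j)) (e (j + 1) i)) (X j) \<in> J"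
  proof (rule middle_letter_commutes)
    have "b \<le> n" "l + 2 \<le> b" if "b \<in> set ?z" for b
      using set_W_bounds(1,2)[OF _ _ _ that] assms l by auto
    moreover have "b \<le> l" if "b \<in> set (W k l)" for b
      using set_W_bounds(4)[OF _ _ _ that] assms l by auto
    ultimately have "far (W k l) ?z"
      by (intro farI_less[of _ l]) (use assms l in auto)
    then show "B (pp (W k l) ?z) (e k l) (e (j + 1) i) \<in> J"
      using assms l by (intro far_commute hm_e good_W) auto
    show "B (pp (W k l) [j] * q) (B (pp (W k l) [j]) (e k l) (X j)) (X j) \<in> J"
      using last_letter_commutes[of k j] assms unfolding ej Wj
      by (simp add: pp_append_left pp_letter_self)
    have "B (pp [j] (W j i)) (X j) (B (pp [j] ?z) (X j) (e (j + 1) i))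
        \<approx> B (pp [j] (W j i)) (X j) (e j i)"
      by (intro cong_B cong_refl cong_sym[OF e_cons]) (use assms in auto)
    then have "B (pp [j] (W j i)) (X j) (B (pp [j] ?z) (X j) (e (j + 1) i)) \<in> J"
      by (rule cong_J) (rule first_letter_commutes, use assms in auto)
    moreover have "pp [j] (W j i) = q * pp [j] ?z"
      using pw_mset[OF refl mset_W_Cons[of j i, folded mset_append], of chi gg "[j]"] assms g
      by (simp add: pp_Cons_right[of "[j]" j] pp_letter_self)
    ultimately show "B (q * pp [j] ?z) (X j) (B (pp [j] ?z) (X j) (e (j + 1) i)) \<in> J"
      by simp
    show "pp [j] ?z * pp ?z [j] * q = 1"
      using sy_values_left(8)[of j i] assms q_nz by (simp add: sy_def mult.commute)
    show "1 + q \<noteq> 0"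
      using q_ne by (metis add_eq_0_iff)
  qed
  moreover have "pp (W k i) [j] = pp (W k l) [j] * q * pp ?z [j]"
  proof -
    have "mset (W k i) = mset (W k j @ ?z)"
      by (rule mset_W_split) (use assms in auto)
    moreover have "pp [j] [j] = q"
      using assms by (intro pp_letter_self) auto
    ultimately show ?thesis
      using pw_mset[of "W k i" "W k j @ ?z" "[j]" "[j]" chi gg] by (simp only: Wj pp_append_left)
  qed
  moreover have "pp (W k j) ?z = pp (W k l) ?z * pp [j] ?z"
    by (simp add: Wj pp_append_left)
  ultimately have 1: "B (pp (W k i) [j]) (B (pp (W k j) ?z) (e k j) (e (j + 1) i)) (X j) \<in> J"
    by (simp add: ej)
  have "B (pp (W k i) [j]) (e k i) (X j)
      \<approx> B (pp (W k i) [j]) (B (pp (W k j) ?z) (e k j) (e (j + 1) i)) (X j)"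
    by (intro cong_B cong_refl e_split_left) (use assms in auto)
  then show ?thesis
    by (rule cong_J) (rule 1)
qed

section \<open>Rebracketing and vanishing brackets for words with m > 2n - k\<close>

lemma descending:
  assumes "s + t = 2 * n" "n < t" "t < 2 * n"
  shows "W t t = [s]" "e t t = X s"
    and "t < m \<Longrightarrow> m < 2 * n \<Longrightarrow> W t m = s # W (t + 1) m"
    and "t < m \<Longrightarrow> m < 2 * n \<Longrightarrow> e t m = B (pp [s] (W (t + 1) m)) (X s) (e (t + 1) m)"
proof -
  have l: "lt n t = s" "sc t = t + 1" "fl t = s"
    using assms by (auto simp: lt_def sc_def fl_def)
  show "W t t = [s]" "e t t = X s"
    using W_self[of t] e_self[of t] assms l by auto
  show "W t m = s # W (t + 1) m" if "t < m" "m < 2 * n"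
    using W_sc[of t m] that assms l by auto
  show "e t m = B (pp [s] (W (t + 1) m)) (X s) (e (t + 1) m)" if "t < m" "m < 2 * n"
    using e_right[of t m] that assms l by auto
qed

lemma set_W_descending:
  assumes "n < t" "t \<le> m" "m < 2 * n" "b \<in> set (W t m)"
  shows "t + b \<le> 2 * n"
  using set_W_bounds(3)[OF _ assms(2-4)] assms by auto

lemma first_letter_commutes_right:
  assumes "1 \<le> l" "l + 2 \<le> n" "l + 1 + t = 2 * n" "t < m" "m < 2 * n"
  shows "B (pp [l + 1] (W t m)) (X (l + 1)) (e t m) \<in> J"
proof -
  have t: "n < t" "t < 2 * n" "l + 1 + t = 2 * n" "l + (t + 1) = 2 * n"
    using assms by auto
  note d = descending[OF t(3,1,2)] descending[OF t(4)]
  show ?thesis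
  proof (cases "m = t + 1")
    case True
    then show ?thesis
      using serre_reversed_right[of l] assms t d by simp
  next
    case False
    let ?z = "W (t + 2) m"
    let ?V = "B (pp [l + 1] [l]) (X (l + 1)) (X l)"
    have d': "e t m = B (pp [l + 1] (W (t + 1) m)) (X (l + 1)) (e (t + 1) m)"
      "e (t + 1) m = B (pp [l] ?z) (X l) (e (t + 2) m)" "W (t + 1) m = l # ?z" "W t m = (l + 1) # l # ?z"
      using d(3,4)[of m] d(7,8)[of m] t assms False by auto
    have "b \<le> l - 1" if "b \<in> set ?z" for b
      using set_W_descending[OF _ _ _ that] t assms False by auto
    then have "far [l + 1] ?z"
      by (intro farI_greater[of _ "l - 1"]) (use assms in auto)
    then have c: "B (pp [l + 1] ?z) (X (l + 1)) (e (t + 2) m) \<in> J"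
      using assms t False by (intro far_commute hm_X hm_e good_W) auto
    have g: "good [l + 1]"
      using assms by auto
    have "e t m \<approx> B (pp [l + 1, l] ?z) ?V (e (t + 2) m)"
      unfolding d'(1,2) by (rule cong_sym, rule br_assoc[OF c g]) (simp_all only: d', simp_all)
    then have "B (pp [l + 1] (W t m)) (X (l + 1)) (e t m)
        \<approx> B (pp [l + 1] (W t m)) (X (l + 1)) (B (pp [l + 1, l] ?z) ?V (e (t + 2) m))"
      by (intro cong_B cong_refl)
    also have "\<dots> \<approx> B (pp [l + 1, l + 1, l] ?z) (B (pp [l + 1] [l + 1, l]) (X (l + 1)) ?V) (e (t + 2) m)"
      by (rule cong_sym, rule br_assoc[OF c g]) (simp_all only: d', simp_all)
    finally show ?thesis
      by (rule cong_J) (rule B_in_J_left, rule serre_reversed_right, use assms in auto)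
  qed
qed

lemma e_split_right:
  assumes "s + 2 \<le> n" "s + t = 2 * n" "t < m" "m < 2 * n" "s < i" "i \<le> t"
  shows "e i m \<approx> B (pp (W i t) (W (t + 1) m)) (e i t) (e (t + 1) m)"
  using assms(5,6)
proof (induction "t - i" arbitrary: i rule: less_induct)
  case less
  have t: "n < t" "t < 2 * n" "1 \<le> i"
    using assms less.prems by auto
  note d = descending[OF assms(2) t(1,2)]
  show ?case
  proof (cases "i = t")
    case True
    then show ?thesis
      using d(1,2) d(4)[of m] assms by simp
  next
    case False
    let ?z = "W (t + 1) m"
    have sc: "sc i \<le> t" "i < sc i"
      using False less.prems assms t by (auto simp: sc_def)
    have fl: "s + 1 \<le> fl i" "fl i \<le> n"
      using False less.prems assms t by (auto simp: fl_def lt_def)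
    have Wt: "W i t = fl i # W (sc i) t"
      by (rule W_sc) (use less.prems sc t assms in auto)
    have "e i m = B (pp [fl i] (W (sc i) m)) (X (fl i)) (e (sc i) m)"
      by (rule e_right) (use less.prems sc t assms in auto)
    also have "\<dots> \<approx> B (pp [fl i] (W (sc i) m)) (X (fl i)) (B (pp (W (sc i) t) ?z) (e (sc i) t) (e (t + 1) m))"
      by (rule cong_B[OF cong_refl], rule less.hyps) (use less.prems sc False in auto)
    also have "\<dots> \<approx> B (pp (W i t) ?z) (B (pp [fl i] (W (sc i) t)) (X (fl i)) (e (sc i) t)) (e (t + 1) m)"
    proof (rule cong_sym, rule br_assoc)
      have "b \<le> s - 1" if "b \<in> set ?z" for b
        using set_W_descending[OF _ _ _ that] t assms by auto
      then have "far [fl i] ?z"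
        using fl t assms by (intro farI_greater[of _ "s - 1"]) auto
      then show "B (pp [fl i] ?z) (X (fl i)) (e (t + 1) m) \<in> J"
        using assms t fl by (intro far_commute hm_X hm_e good_W) auto
      have "mset (W (sc i) m) = mset (W (sc i) t @ ?z)"
        by (rule mset_W_split) (use assms t sc in auto)
      then show "mset (W (sc i) m) = mset (W (sc i) t) + mset ?z"
        by simp
    qed (use fl Wt in auto)
    also have "B (pp [fl i] (W (sc i) t)) (X (fl i)) (e (sc i) t) = e i t"
      by (rule e_right[symmetric]) (use less.prems sc t assms in auto)
    finally show ?thesis .
  qed
qed

text \<open>Beyond the line the elements are bracketed from the right. Detaching the last letter
  lets them grow on the right as well, as appending a letter to \<open>e[k,m]\<close> requires of
  its tails.\<close>

lemma e_snoc_right: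
  assumes "1 \<le> k" "k + 2 \<le> n" "k + s + 1 = 2 * n" "k + 2 \<le> i" "i \<le> s"
  shows "e i (s + 1) \<approx> B (pp (W i s) [k]) (e i s) (X k)"
proof -
  have s: "n < s + 1" "s + 1 < 2 * n" "k + (s + 1) = 2 * n"
    using assms by auto
  note d = descending[OF s(3,1,2)]
  show ?thesis
  proof (cases "k + 3 \<le> n")
    case True
    then show ?thesis
      using e_split_right[of "k + 1" s "s + 1" i] assms s d by simp
  next
    \<comment> \<open>With k = n - 2 only i = n and i = n + 1 remain, and both words have just two
      letters.\<close>
    case False
    then have k: "k = n - 2" "s = n + 1"
      using assms by auto
    then consider "i = n" | "i = n + 1"
      using assms by linarith
    then show ?thesis
    proof cases
      case 1
      have "e n (n + 2) = B (pp [n] (W (n + 2) (n + 2))) (X n) (e (n + 2) (n + 2))"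
        using e_right[of n "n + 2"] n3 by (simp add: sc_def fl_def lt_def)
      then show ?thesis
        using 1 k d W_special e_special by simp
    next
      case 2
      have "e (n + 1) (n + 2) = B (pp [n - 1] (W (n + 2) (n + 2))) (X (n - 1)) (e (n + 2) (n + 2))"
        "W (n + 1) (n + 1) = [n - 1]" "e (n + 1) (n + 1) = X (n - 1)"
        using descending(1,2)[of "n - 1" "n + 1"] descending(4)[of "n - 1" "n + 1" "n + 2"] n3 by auto
      then show ?thesis
        using 2 k d by simp
    qed
  qed
qed

lemma last_letter_commutes_right:
  assumes "1 \<le> k" "k + 2 \<le> n" "k + s + 1 = 2 * n" "k + 2 \<le> i" "i \<le> s"
  shows "B (pp (W i (s + 1)) [k]) (e i (s + 1)) (X k) \<in> J"
  using assms(4,5)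
proof (induction "s - i" arbitrary: i rule: less_induct)
  case less
  have s: "n < s" "s < 2 * n" "(k + 1) + s = 2 * n" "k + (s + 1) = 2 * n" "s + 1 < 2 * n" "n < s + 1"
    using assms by auto
  note d = descending[OF s(3,1,2)] descending[OF s(4,6,5)]
  consider "i = s" | "i = n" "k = n - 2" | "i < s" "i \<noteq> n \<or> k + 3 \<le> n"
    using less.prems assms by linarith
  then show ?case
  proof cases
    case 1
    then show ?thesis
      using d(3,4)[of "s + 1"] d(5,6) serre_reversed_left[of k] assms s by simp
  next
    case 2
    then have "s + 1 = n + 2"
      using assms by auto
    moreover have "e n (n + 2) = B (pp [n] (W (n + 2) (n + 2))) (X n) (e (n + 2) (n + 2))"
      "W n (n + 2) = n # W (n + 2) (n + 2)"
      using e_right[of n "n + 2"] W_sc[of n "n + 2"] n3 by (simp_all add: sc_def fl_def lt_def)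
    ultimately show ?thesis
      using 2 d(5,6) serre_reversed_left_n by simp
  next
    case 3
    have sc: "sc i \<le> s" "i < sc i"
      using 3 less.prems assms s by (auto simp: sc_def)
    have fl: "k + 2 \<le> fl i" "fl i \<le> n" "fl i = n \<Longrightarrow> k + 3 \<le> n"
      using 3 less.prems assms s by (auto simp: fl_def lt_def)
    have ei: "W i (s + 1) = fl i # W (sc i) (s + 1)"
      "e i (s + 1) = B (pp [fl i] (W (sc i) (s + 1))) (X (fl i)) (e (sc i) (s + 1))"
      by (rule W_sc e_right; use less.prems sc s assms in auto)+
    have "B (pp (W i (s + 1)) [k]) (e i (s + 1)) (X k) \<approx> B (pp [fl i] (W (sc i) (s + 1) @ [k])) (X (fl i))
        (B (pp (W (sc i) (s + 1)) [k]) (e (sc i) (s + 1)) (X k))"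
      unfolding ei(2)
    proof (rule br_assoc)
      show "B (pp [fl i] [k]) (X (fl i)) (X k) \<in> J"
        by (rule letters_commute) (use fl assms in \<open>auto simp: adj_def\<close>)
      show "mset (W i (s + 1)) = mset [fl i] + mset (W (sc i) (s + 1))"
        unfolding ei(1) by simp
    qed (use fl assms in auto)
    moreover have "\<dots> \<in> J"
      by (rule B_in_J_right, rule less.hyps) (use less.prems sc 3 in auto)
    ultimately show ?thesis
      by (rule cong_J)
  qed
qed

lemma q_plus_nz: "1 + q \<noteq> 0"
  using q_ne by (metis add_eq_0_iff)

text \<open>Middle letter argument at position 2n - k, the only occurrence of x_k in
  \<open>e(i,m)\<close>. It treats [e[i,m], x_k]; the order is reversed at the end because the two
  scalars of this pair multiply to 1.\<close>

lemma inner_letter_commutes_right: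
  assumes "1 \<le> k" "k + 2 \<le> n" "k + s + 1 = 2 * n" "k + 2 \<le> i" "i \<le> s" "s + 1 < m" "m < 2 * n"
  shows "B (pp [k] (W i m)) (X k) (e i m) \<in> J"
proof -
  define t where "t = s + 1"
  have t: "n < t" "t < 2 * n" "k + t = 2 * n" "t < m"
    using assms by (auto simp: t_def)
  note d = descending[OF t(3,1,2)]
  let ?z = "W (t + 1) m"
  have Wit: "mset (W i t) = mset (W i s @ [k])"
    using mset_W_split[of i s t] assms t d(1) by (auto simp: t_def)
  have a: "B (pp (W i s) [k]) (e i s) (X k) \<approx> e i t"
    unfolding t_def by (rule cong_sym, rule e_snoc_right) (use assms in auto)
  have g: "good (W i s)" "good [k]" "good ?z"
    using assms t good_W[of i s] good_W[of "t + 1" m] by auto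
  have "B (pp (W i s) [k] * q * pp ?z [k])
     (B (pp (W i s) ?z * pp [k] ?z) (B (pp (W i s) [k]) (e i s) (X k)) (e (t + 1) m)) (X k) \<in> J"
  proof (rule middle_letter_commutes)
    have "b \<le> k - 1" if "b \<in> set ?z" for b
      using set_W_descending[OF _ _ _ that] t assms by auto
    moreover have "k + 1 \<le> b" if "b \<in> set (W i s)" for b
      using set_W_bounds(2)[OF _ _ _ that] assms t by auto
    ultimately have "far (W i s) ?z"
      by (intro farI_greater[of _ "k - 1"]) (use assms in auto)
    then show "B (pp (W i s) ?z) (e i s) (e (t + 1) m) \<in> J"
      using assms t g by (intro far_commute hm_e) auto
    have "pp (W i t) [k] = pp (W i s) [k] * q"
      using pw_mset[OF Wit refl, of chi gg "[k]"] pp_letter_self[of k] assms by (simp only: pp_append_left)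
    moreover have "B (pp (W i t) [k]) (B (pp (W i s) [k]) (e i s) (X k)) (X k) \<approx> B (pp (W i t) [k]) (e i t) (X k)"
      by (intro cong_B a cong_refl)
    then have "B (pp (W i t) [k]) (B (pp (W i s) [k]) (e i s) (X k)) (X k) \<in> J"
      by (rule cong_J) (unfold t_def, rule last_letter_commutes_right, use assms in auto)
    ultimately show "B (pp (W i s) [k] * q) (B (pp (W i s) [k]) (e i s) (X k)) (X k) \<in> J"
      by simp
    obtain l where "k = l + 1" "1 \<le> l"
      using t assms by (cases k) auto
    then have "B (pp [k] (W t m)) (X k) (e t m) \<in> J"
      using first_letter_commutes_right[of l t m] assms t by simp
    moreover have "pp [k] (W t m) = q * pp [k] ?z"
      using d(3)[of m] pp_append_right[of "[k]" "[k]" ?z] pp_letter_self[of k] assms t by simp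
    ultimately show "B (q * pp [k] ?z) (X k) (B (pp [k] ?z) (X k) (e (t + 1) m)) \<in> J"
      using d(4)[of m] assms t by simp
    show "pp [k] ?z * pp ?z [k] * q = 1"
      using sy_values_right(4)[of m k "t + 1"] assms t q_nz by (simp add: sy_def mult.commute)
  qed (rule q_plus_nz)
  moreover have "pp (W i m) [k] = pp (W i s) [k] * q * pp ?z [k]"
  proof -
    have "mset (W i m) = mset (W i t @ ?z)"
      by (rule mset_W_split) (use assms t in auto)
    then have "mset (W i m) = mset (W i s @ [k] @ ?z)"
      using Wit by simp
    then show ?thesis
      using pw_mset[of "W i m" "W i s @ [k] @ ?z" "[k]" "[k]" chi gg] pp_letter_self[of k] assms
      by (simp only: pp_append_left mult.assoc)
  qed
  moreover have "pp (W i t) ?z = pp (W i s) ?z * pp [k] ?z"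
    using pw_mset[OF Wit refl, of chi gg ?z] by (simp only: pp_append_left)
  ultimately have 1: "B (pp (W i m) [k]) (B (pp (W i t) ?z) (B (pp (W i s) [k]) (e i s) (X k)) (e (t + 1) m)) (X k) \<in> J"
    by simp
  have "e i m \<approx> B (pp (W i t) ?z) (e i t) (e (t + 1) m)"
    by (rule e_split_right) (use assms t in auto)
  also have "\<dots> \<approx> B (pp (W i t) ?z) (B (pp (W i s) [k]) (e i s) (X k)) (e (t + 1) m)"
    by (intro cong_B cong_refl cong_sym[OF a])
  finally have "B (pp (W i m) [k]) (e i m) (X k) \<approx> B (pp (W i m) [k])
      (B (pp (W i t) ?z) (B (pp (W i s) [k]) (e i s) (X k)) (e (t + 1) m)) (X k)"
    by (intro cong_B cong_refl)
  then have "B (pp (W i m) [k]) (e i m) (X k) \<in> J"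
    by (rule cong_J) (rule 1)
  moreover have "pp (W i m) [k] * pp [k] (W i m) = 1"
    using sy_values_right(2)[of m k i] assms by (simp add: sy_def)
  ultimately show ?thesis
    by (rule B_commute)
qed

section \<open>Crossing the line m = 2n - k\<close>

lemma first_letter_pair_commute:
  assumes "1 \<le> l" "l + 3 \<le> n" "l + t + 3 = 2 * n"
  defines "j \<equiv> l + 1"
  shows "B (pp (W j t) [j, l]) (e j t) (B (pp [j] [l]) (X j) (X l)) \<in> J"
proof -
  let ?P = "W (j + 1) t"
  have j: "1 \<le> j" "j + 2 \<le> n" "t + j + 2 = 2 * n" "j < t" "t < 2 * n" "j + 1 \<le> t"
    using assms by (auto simp: j_def)
  have b: "l + 2 \<le> b" if "b \<in> set ?P" for b
    using set_W_bounds(2)[OF _ _ _ that] assms j by auto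
  have f: "far ?P [l]"
    by (intro farI_greater[of _ l]) (use assms b in auto)
  have g: "good ?P"
    using j good_W[of "j + 1" t] by auto
  have "B (q * pp ?P [j] * pp [j] [l] * pp ?P [l])
      (B (pp [j] ?P) (X j) (e (j + 1) t)) (B (pp [j] [l]) (X j) (X l)) \<in> J"
  \<comment> \<open>The common letter is x_j: \<open>e[j,t]\<close> is congruent to the bracket of
    x_j with P = e[j+1,t], and y = x_l is far from P.\<close>
  proof (rule common_first_letter_commute)
    show "B (pp ?P [l]) (e (j + 1) t) (X l) \<in> J"
      using f g assms j by (intro far_commute hm_e hm_X) auto
    have "B (pp [j] (W j t)) (X j) (B (pp [j] ?P) (X j) (e (j + 1) t)) \<approx> B (pp [j] (W j t)) (X j) (e j t)"
      by (intro cong_B cong_refl cong_sym[OF e_cons]) (use j in auto)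
    then have "B (pp [j] (W j t)) (X j) (B (pp [j] ?P) (X j) (e (j + 1) t)) \<in> J"
      by (rule cong_J) (rule first_letter_commutes, use j in auto)
    moreover have "pp [j] (W j t) = q * pp [j] ?P"
    proof -
      have "mset (W j t) = mset ([j] @ ?P)"
        using mset_W_Cons[of j t] j by simp
      moreover have "good [j]"
        using j by simp
      ultimately show ?thesis
        using pw_mset[of "[j]" "[j]" "W j t" "[j] @ ?P" chi gg] pp_letter_self[of j] j
        by (simp only: pp_append_right)
    qed
    ultimately show "B (q * pp [j] ?P) (X j) (B (pp [j] ?P) (X j) (e (j + 1) t)) \<in> J"
      by simp
    have "B (pp [j] [j, l]) (X j) (B (pp [j] [l]) (X j) (X l)) \<in> J"
      unfolding j_def by (rule serre_reversed_right) (use assms in auto)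
    moreover have "pp [j] [j, l] = q * pp [j] [l]"
      using pp_append_right[of "[j]" "[j]" "[l]"] pp_letter_self[of j] j by simp
    ultimately show "B (q * pp [j] [l]) (X j) (B (pp [j] [l]) (X j) (X l)) \<in> J"
      by simp
    show "pp ?P [l] * pp [l] ?P = 1"
      using far_sy[OF g _ _ f] assms by (simp add: sy_def)
    show "pp [j] ?P * pp ?P [j] * q = 1"
      using sy_values_left(8)[of j t] j q_nz by (simp add: sy_def mult.commute)
  qed (rule q_plus_nz)
  moreover have "pp (W j t) [j, l] = q * pp ?P [j] * pp [j] [l] * pp ?P [l]"
  proof -
    have "mset (W j t) = mset ([j] @ ?P)"
      using mset_W_Cons[of j t] j by simp
    then have "pp (W j t) [j, l] = pp ([j] @ ?P) ([j] @ [l])"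
      using pw_mset[of "W j t" "[j] @ ?P" "[j, l]" "[j] @ [l]" chi gg] by simp
    also have "\<dots> = (pp [j] [j] * pp [j] [l]) * (pp ?P [j] * pp ?P [l])"
      unfolding pp_append_left using g j by (subst (1 2) pp_append_right) auto
    finally show ?thesis
      using pp_letter_self[of j] j by (simp add: mult_ac)
  qed
  ultimately have 1: "B (pp (W j t) [j, l]) (B (pp [j] ?P) (X j) (e (j + 1) t)) (B (pp [j] [l]) (X j) (X l)) \<in> J"
    by simp
  have "B (pp (W j t) [j, l]) (e j t) (B (pp [j] [l]) (X j) (X l))
     \<approx> B (pp (W j t) [j, l]) (B (pp [j] ?P) (X j) (e (j + 1) t)) (B (pp [j] [l]) (X j) (X l))"
    by (intro cong_B cong_refl e_cons) (use j in auto)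
  then show ?thesis
    by (rule cong_J) (rule 1)
qed

text \<open>The right-bracketed \<open>e[l+1,2n-l]\<close> is tied to the left-bracketed
  \<open>e[l+1,2n-l-2]\<close>, stepping over the special element between them. The induction goes
  down from l = n - 2: x_{l+1} is removed in front, the shorter element is rewritten, and x_{l+1}
  and x_{l+2} are moved into the left-bracketed factor.\<close>

lemma e_past_middle:
  assumes "1 \<le> l" "l + 2 \<le> n" "l + t + 2 = 2 * n"
  shows "e (l + 1) (t + 2) \<approx> B (pp (W (l + 1) t) [l + 1, l]) (e (l + 1) t)
    (B (pp [l + 1] [l]) (X (l + 1)) (X l))"
  using assms
proof (induction "n - l" arbitrary: l t rule: less_induct)
  case less
  note prems = less.prems
  show ?case
  proof (cases "l + 2 = n")
    case True
    then have t: "t = n" "l + 1 = n - 1" "l = n - 2"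
      using prems by auto
    have "e (n - 1) (n + 2) = B (pp [n] (W (n + 1) (n + 2))) (X n) (e (n + 1) (n + 2))"
    proof -
      have "sc (n - 1) = n + 1" "fl (n - 1) = n"
        using n3 by (auto simp: sc_def fl_def)
      then show ?thesis
        using e_right[of "n - 1" "n + 2"] n3 by simp
    qed
    moreover have "W (n + 1) (n + 2) = [n - 1, n - 2]"
      "e (n + 1) (n + 2) = B (pp [n - 1] [n - 2]) (X (n - 1)) (X (n - 2))"
      using descending(3,4)[of "n - 1" "n + 1" "n + 2"] descending(1,2)[of "n - 2" "n + 2"] n3 by auto
    ultimately show ?thesis
      unfolding t(1,2) unfolding t(3) by (simp add: W_special[simplified] e_special[simplified])
  next
    case False
    define j where "j = l + 1"
    define s where "s = t - 1"
    have ls: "t = s + 1" "l + 1 = j" "l + 2 = j + 1" "1 \<le> j" "j + 2 \<le> n" "j + s + 2 = 2 * n"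
      "l + s + 3 = 2 * n" "l + 3 \<le> n"
      using False prems by (auto simp: j_def s_def)
    have pt: "pr t = s" "lt n t = j + 1"
      using ls prems by (auto simp: pr_def lt_def)
    let ?P = "W (j + 1) s" and ?p = "e (j + 1) s"
    let ?V = "B (pp [j] [l]) (X j) (X l)"
    let ?S = "B (pp [j + 1] [j, l]) (X (j + 1)) ?V"
    have gP: "good ?P"
      using ls good_W[of "j + 1" s] by auto
    have far_l: "far ?P [l]"
    proof -
      have "l + 2 \<le> b" if "b \<in> set ?P" for b
        using set_W_bounds(2)[OF _ _ _ that] ls prems by auto
      then show ?thesis
        by (intro farI_greater[of _ l]) (use ls in auto)
    qed
    have bounds: "j + 1 \<le> s" "s + 3 < 2 * n" "n \<le> s"
      using ls prems by auto
    have S: "e (s + 1) (s + 3) = ?S" "W (s + 1) (s + 3) = [j + 1, j, l]"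
    proof -
      have a: "j + 1 + (s + 1) = 2 * n" "n < s + 1" "s + 1 < 2 * n" "s + 1 < s + 3" "s + 3 < 2 * n"
        "j + (s + 2) = 2 * n" "n < s + 2" "s + 2 < 2 * n" "s + 2 < s + 3"
        "l + (s + 3) = 2 * n" "n < s + 3"
        using ls bounds by auto
      have s: "s + 1 + 1 = s + 2" "s + 2 + 1 = s + 3"
        by simp_all
      show "W (s + 1) (s + 3) = [j + 1, j, l]"
        unfolding descending(3)[OF a(1-5)] s descending(3)[OF a(6-9,5)] descending(1)[OF a(10,11,5)] ..
      show "e (s + 1) (s + 3) = ?S"
        unfolding descending(4)[OF a(1-5)] s descending(4)[OF a(6-9,5)] descending(3)[OF a(6-9,5)]
          descending(1,2)[OF a(10,11,5)] ..
    qed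
    have e0: "e (j + 1) (s + 3) \<approx> B (pp ?P [j + 1, j, l]) ?p ?S"
    proof -
      have "e (j + 1) (s + 3) \<approx> B (pp (W (j + 1) (s + 2)) [l]) (e (j + 1) (s + 2)) (X l)"
        using e_snoc_right[of l "s + 2" "j + 1"] ls bounds prems by (simp add: numeral_3_eq_3)
      also have "\<dots> \<approx> B (pp (W (j + 1) (s + 2)) [l])
          (B (pp ?P [j + 1, j]) ?p (B (pp [j + 1] [j]) (X (j + 1)) (X j))) (X l)"
        by (intro cong_B cong_refl less.hyps) (use ls in auto)
      also have "\<dots> \<approx> B (pp ?P [j + 1, j, l]) ?p (B (pp [j + 1, j] [l]) (B (pp [j + 1] [j]) (X (j + 1)) (X j)) (X l))"
      proof (rule br_assoc)
        show "B (pp ?P [l]) ?p (X l) \<in> J"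
          using gP far_l ls bounds prems by (intro far_commute hm_e hm_X) auto
        have d1: "mset (W (j + 1) (s + 1)) = mset (?P @ W (s + 1) (s + 1))"
          by (rule mset_W_split) (use ls bounds in auto)
        have d2: "mset (W (j + 1) (s + 2)) = mset (W (j + 1) (s + 1) @ W (s + 2) (s + 2))"
          using mset_W_split[of "j + 1" "s + 1" "s + 2"] ls bounds by simp
        have "W (s + 1) (s + 1) = [j + 1]" "W (s + 2) (s + 2) = [j]"
          using descending(1)[of "j + 1" "s + 1"] descending(1)[of j "s + 2"] ls bounds by auto
        with d1 d2 show "mset (W (j + 1) (s + 2)) = mset ?P + mset [j + 1, j]"
          by simp
      qed (use gP in auto)
      also have "\<dots> \<approx> B (pp ?P [j + 1, j, l]) ?p ?S"
      proof (rule cong_B[OF cong_refl], rule br_assoc)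
        show "B (pp [j + 1] [l]) (X (j + 1)) (X l) \<in> J"
          by (rule letters_commute) (use ls prems in \<open>auto simp: adj_def\<close>)
      qed (use ls in auto)
      finally show ?thesis .
    qed
    have "e j (s + 3) = B (pp [j] (W (j + 1) (s + 3))) (X j) (e (j + 1) (s + 3))"
    proof -
      have "sc j = j + 1" "fl j = j" "2 * n < s + 3 + j"
        using ls by (auto simp: sc_def fl_def lt_def)
      then show ?thesis
        using e_right[of j "s + 3"] ls bounds by simp
    qed
    also have "\<dots> \<approx> B (pp [j] (W (j + 1) (s + 3))) (X j) (B (pp ?P [j + 1, j, l]) ?p ?S)"
      by (intro cong_B cong_refl e0)
    \<comment> \<open>x_j is the middle letter of \<open>?S\<close>, hence skew commutes with it and
      can join the first factor.\<close>
    also have "\<dots> \<approx> B (pp (W j s) [j + 1, j, l]) (B (pp [j] ?P) (X j) ?p) ?S"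
    proof (rule cong_sym, rule br_assoc)
      show "B (pp [j] [j + 1, j, l]) (X j) ?S \<in> J"
        using S inner_letter_commutes_right[of j "s + 1" "s + 1" "s + 3"] ls bounds by simp
      show "mset (W j s) = mset [j] + mset ?P"
        by (rule mset_W_Cons) (use ls bounds in auto)
      have "mset (W (j + 1) (s + 3)) = mset (?P @ W (s + 1) (s + 3))"
        using mset_W_split[of "j + 1" s "s + 3"] ls bounds by simp
      then show "mset (W (j + 1) (s + 3)) = mset ?P + mset [j + 1, j, l]"
        using S by simp
    qed (use ls in auto)
    also have "\<dots> \<approx> B (pp (W j s) [j + 1, j, l]) (e j s) ?S"
      by (intro cong_B cong_refl cong_sym[OF e_cons]) (use ls bounds in auto)
    \<comment> \<open>x_{j+1} leaves \<open>?S\<close> for the first factor; this is allowed because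
      \<open>e[j,s]\<close> and \<open>?V\<close> share their first letter x_j and skew
      commute.\<close>
    also have "\<dots> \<approx> B (pp (W j t) [j, l]) (B (pp (W j s) [j + 1]) (e j s) (X (j + 1))) ?V"
    proof (rule cong_sym)
      have c: "B (pp (W j s) [j, l]) (e j s) ?V \<in> J"
        by (rule first_letter_pair_commute[of l s, unfolded ls(2)]) (use ls prems in auto)
      have Wt: "W j t = W j s @ [j + 1]"
        using W_pr[of j t] pt ls bounds by auto
      define u v w where "u = e j s" and "v = (X (j + 1) :: 'k free_alg)" and "w = ?V"
      have gj: "good (W j s)" "good [j + 1]"
        using good_W[of j s] ls bounds by auto
      have "B (pp (W j s @ [j + 1]) [j, l]) (B (pp (W j s) [j + 1]) u v) w
        \<approx> B (pp (W j s) ([j + 1] @ [j, l])) u (B (pp [j + 1] [j, l]) v w)"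
        by (rule br_assoc) (use c gj in \<open>auto simp: u_def w_def\<close>)
      then show "B (pp (W j t) [j, l]) (B (pp (W j s) [j + 1]) (e j s) (X (j + 1))) ?V
         \<approx> B (pp (W j s) [j + 1, j, l]) (e j s) ?S"
        by (simp add: Wt u_def v_def w_def)
    qed
    also have "B (pp (W j s) [j + 1]) (e j s) (X (j + 1)) = e j t"
      using e_left[of j t] pt ls bounds by simp
    finally show ?thesis
      unfolding ls(2) by (simp add: ls(1) numeral_3_eq_3)
  qed
qed

text \<open>With \<open>t = 2n - l - 2\<close>, the words here are \<open>e(l+1,2n-l-1)\<close>, \<open>e(l+1,2n-l)\<close>, \<open>e(l,2n-l-1)\<close> and
  \<open>e(l,2n-l)\<close>: the first relation crosses the special case \<open>m = 2n - k\<close> of the definition of \<open>e[k,m]\<close>.\<close>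

lemma closing_relations:
  assumes "1 \<le> l" "l + 2 \<le> n" "l + t + 2 = 2 * n"
  defines "b \<equiv> e (l + 1) (t + 1)" and "r \<equiv> pp (W (l + 1) (t + 1)) [l]"
  shows "e (l + 1) (t + 2) \<approx> sm (q * r) (e l (t + 1)) + b * X l - sm (q * r) (X l * b)"
    and "B (inverse q * pp [l] (W (l + 1) (t + 2))) (X l) (e (l + 1) (t + 2)) \<approx> e l (t + 2)"
proof -
  let ?x = "X l" and ?y = "X (l + 1)" and ?u = "e (l + 1) t" and ?U = "W (l + 1) t"
  define pxu pux pxy pyx puy where p: "pxu = pp [l] ?U" "pux = pp ?U [l]" "pxy = pp [l] [l + 1]"
    "pyx = pp [l + 1] [l]" "puy = pp ?U [l + 1]"
  have bd: "n \<le> t" "l + 1 \<le> t" "t + 2 < 2 * n" "l < n" "l + 1 < n"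
    using assms by auto
  have gU: "good ?U"
    using good_W[of "l + 1" t] bd by auto
  have inv: "pxu * pux * q = 1" "pxy * pyx * q = 1" "q * inverse q = 1"
  proof -
    show "pxu * pux * q = 1" "q * inverse q = 1"
      using sy_values_left(8)[of l t] assms bd q_nz by (simp_all add: sy_def p mult.commute)
    show "pxy * pyx * q = 1"
      unfolding p by (rule sy_adj) (use assms bd in \<open>auto simp: adj_def\<close>)
  qed
  have W1: "W (l + 1) (t + 1) = ?U @ [l + 1]"
    using W_pr[of "l + 1" "t + 1"] assms bd by (auto simp: pr_def lt_def)
  have r: "r = pux * pyx"
    unfolding r_def W1 p pp_append_left ..
  have b: "b = B (inverse q * puy) ?u ?y"
    unfolding b_def p by (rule e_mid) (use assms bd in auto)
  define E where "E = B (pxy * puy) (B pxu ?x ?u) ?y"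
  have Wl: "mset (W l t) = mset ([l] @ ?U)"
    using mset_W_Cons[of l t] assms bd by simp
  have E: "e l (t + 1) \<approx> E"
  proof -
    have "e l (t + 1) = B (pp (W l t) [l + 1]) (e l t) ?y"
    proof -
      have "lt n (t + 1) = l + 1" "t + 1 \<noteq> n" "t + l + 1 < 2 * n"
        using assms(3) bd by (auto simp: lt_def)
      then show ?thesis
        using e_left_step[of l t] assms(1) bd by simp
    qed
    also have "\<dots> \<approx> B (pp (W l t) [l + 1]) (B pxu ?x ?u) ?y"
      unfolding p by (intro cong_B cong_refl e_cons) (use assms bd in auto)
    also have "pp (W l t) [l + 1] = pxy * puy"
      using pw_mset[OF Wl refl, of chi gg "[l + 1]"] by (simp only: pp_append_left p)
    finally show ?thesis
      by (simp add: E_def)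
  qed
  define E' where "E' = sm (q * (pux * pyx)) E + b * ?x - sm (q * (pux * pyx)) (?x * b)"
  have R: "e (l + 1) (t + 2) \<approx> E'"
  proof -
    have "pp ?U [l + 1, l] = puy * pux"
      using pp_append_right[OF gU, of "[l + 1]" "[l]"] by (simp add: p)
    then have "e (l + 1) (t + 2) \<approx> B (puy * pux) ?u (B pyx ?y ?x)"
      using e_past_middle[OF assms(1-3)] by (simp add: p)
    also have "\<dots> = E'"
      unfolding E'_def E_def b by (rule double_letter_identity[OF inv])
    finally show ?thesis .
  qed
  also have "E' \<approx> sm (q * r) (e l (t + 1)) + b * ?x - sm (q * r) (?x * b)"
    unfolding E'_def r by (intro cong_add cong_diff cong_sm cong_sym[OF E] cong_refl)
  finally show "e (l + 1) (t + 2) \<approx> sm (q * r) (e l (t + 1)) + b * ?x - sm (q * r) (?x * b)" .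
  have W2: "mset (W (l + 1) (t + 2)) = mset (?U @ [l + 1] @ [l])"
  proof -
    have "mset (W (l + 1) (t + 2)) = mset (W (l + 1) (t + 1) @ W (t + 2) (t + 2))"
      using mset_W_split[of "l + 1" "t + 1" "t + 2"] assms bd by simp
    moreover have "W (t + 2) (t + 2) = [l]"
      by (rule descending) (use assms bd in auto)
    ultimately show ?thesis
      by (simp add: W1[simplified])
  qed
  have gl: "good [l]" "pp [l] [l] = q"
    using assms pp_letter_self[of l] by auto
  have "pp [l] (W (l + 1) (t + 2)) = pxu * (pxy * q)"
    using pw_mset[OF refl W2, of chi gg "[l]"] gl by (simp only: pp_append_right p)
  then have 1: "inverse q * pp [l] (W (l + 1) (t + 2)) = pxu * pxy"
    using q_nz by simp
  have "mset (W l (t + 1)) = mset ([l] @ ?U @ [l + 1])"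
    using mset_W_Cons[of l "t + 1"] assms bd W1 by simp
  then have "pp (W l (t + 1)) [l] = q * (pux * pyx)"
    using pw_mset[of "W l (t + 1)" "[l] @ ?U @ [l + 1]" "[l]" "[l]" chi gg] gl
    by (simp only: pp_append_left p)
  then have 2: "inverse q * pp (W l (t + 1)) [l] = pux * pyx"
    using q_nz by simp
  have "B (pxu * pxy) ?x E' \<approx> B (pux * pyx) E ?x"
  proof (rule closing_letter_identity[OF inv _ _ E_def b E'_def])
    have "B (pp [l] (W l t)) ?x (B pxu ?x ?u) \<approx> B (pp [l] (W l t)) ?x (e l t)"
      unfolding p by (intro cong_B cong_refl cong_sym[OF e_cons]) (use assms bd in auto)
    then have "B (pp [l] (W l t)) ?x (B pxu ?x ?u) \<in> J"
      by (rule cong_J) (rule first_letter_commutes, use assms bd in auto)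
    moreover have "pp [l] (W l t) = q * pxu"
      using pw_mset[OF refl Wl, of chi gg "[l]"] gl by (simp only: pp_append_right p)
    ultimately show "B (q * pxu) ?x (B pxu ?x ?u) \<in> J"
      by simp
    have "pp [l] [l, l + 1] = q * pxy"
      using pp_append_right[OF gl(1), of "[l]" "[l + 1]"] gl by (simp add: p)
    then show "B (q * pxy) ?x (B pxy ?x ?y) \<in> J"
      using serre_right[of l] assms by (simp add: p)
  qed
  then have "B (pxu * pxy) ?x (e (l + 1) (t + 2)) \<approx> B (pux * pyx) (e l (t + 1)) ?x"
    using cong_B[OF cong_refl R] cong_B[OF E cong_refl] by (blast intro: cong_trans cong_sym)
  then show "B (inverse q * pp [l] (W (l + 1) (t + 2))) ?x (e (l + 1) (t + 2)) \<approx> e l (t + 2)"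
    using e_mid[of l "t + 1"] assms bd unfolding 1 2 by simp
qed

section \<open>The coproduct of \<open>e[k,m]\<close>\<close>

lemma hm_chi_w: "hm d b \<Longrightarrow> w \<in> Poly_Mapping.keys b \<Longrightarrow> chi_w chi w (gg j) = pp d [j]"
  using chi_w_mset[of w d chi "gg j"] by (simp add: hm_def pw_def gr_def)

text \<open>\<open>RB\<close> and \<open>LB\<close> are the brackets with the coproduct of x_j in
  the tensor square, with x_j on the right and on the left.\<close>

definition RB :: "'k \<Rightarrow> nat \<Rightarrow> ('g, 'k) tens \<Rightarrow> ('g, 'k) tens" where
  "RB p j S = RX j S - SC p (LX j S)"

definition LB :: "'k \<Rightarrow> nat \<Rightarrow> ('g, 'k) tens \<Rightarrow> ('g, 'k) tens" where
  "LB p j S = LX j S - SC p (RX j S)"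

lemma RB_add: "RB p j (S + T) = RB p j S + RB p j T"
  by (simp add: RB_def RX_add LX_add SC_add)

lemma LB_add: "LB p j (S + T) = LB p j S + LB p j T"
  by (simp add: LB_def RX_add LX_add SC_add)

lemmas RB_sum = additive_sum[of "RB p j" for p j, OF RB_add]
lemmas LB_sum = additive_sum[of "LB p j" for p j, OF LB_add]

lemma RB_cong: "S \<simeq> T \<Longrightarrow> RB p j S \<simeq> RB p j T"
  unfolding RB_def by (intro tcong_diff RX_cong SC_cong LX_cong)

lemma LB_cong: "S \<simeq> T \<Longrightarrow> LB p j S \<simeq> LB p j T"
  unfolding LB_def by (intro tcong_diff RX_cong SC_cong LX_cong)

lemma D_B_right: "1 \<le> j \<Longrightarrow> j \<le> n \<Longrightarrow> D (B p u (X j)) = RB p j (D u)"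
  by (simp add: B_def RB_def D_diff D_sm D_X_mult D_mult_X)

lemma D_B_left: "1 \<le> j \<Longrightarrow> j \<le> n \<Longrightarrow> D (B p (X j) u) = LB p j (D u)"
  by (simp add: B_def LB_def D_diff D_sm D_X_mult D_mult_X)

lemma chi_gr: "chi j (gr gg d) = pp [j] d"
  by (simp add: pw_def chi_w_Cons)

text \<open>In the product with x_j on the left, x_j passes the group element of degree
  \<open>da\<close>. The resulting p(x_j,da) joins p(da,x_j) from \<open>p\<close> to give the twist
  \<open>sy da j\<close> of the first term.\<close>

lemma RB_TT:
  assumes j: "1 \<le> j" "j \<le> n" and b: "hm db b" and p: "p = r * pp da [j] * pp db [j]"
  shows "RB p j (TT (gr gg da) b a)
    = TT (gr gg da) (B (pp db [j] * (r * sy da j)) b (X j)) a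
      + TT (gr gg (da @ [j])) (sm (pp db [j]) b) (B (r * pp da [j]) a (X j))"
proof -
  have "gg j + gr gg da = gr gg (da @ [j])" "gr gg da + gg j = gr gg (da @ [j])"
    by (simp_all add: gr_def add.commute)
  then have "RB p j (TT (gr gg da) b a)
    = TT (gr gg da) (b * X j) a + TT (gr gg (da @ [j])) (sm (pp db [j]) b) (a * X j)
     - (TT (gr gg da) (sm (p * pp [j] da) (X j * b)) a + TT (gr gg (da @ [j])) (sm p b) (X j * a))"
    using j hm_chi_w[OF b] by (simp add: RB_def RX_TT[OF j, of b "pp db [j]"] LX_TT SC_add SC_TT chi_gr sm_sm)
  also have "TT (gr gg (da @ [j])) (sm p b) (X j * a)
      = TT (gr gg (da @ [j])) (sm (pp db [j]) b) (sm (r * pp da [j]) (X j * a))"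
    by (simp add: TT_sm sm_sm p mult_ac)
  also have "p * pp [j] da = pp db [j] * (r * sy da j)"
    by (simp add: p sy_def mult_ac)
  finally show ?thesis
    by (simp add: B_def TT_diff_left TT_diff_right algebra_simps)
qed

text \<open>Here the twist falls on the second term: in the product with x_j on the right, g_j
  passes \<open>b\<close>, and p(db,x_j) joins p(x_j,db) from \<open>p\<close>.\<close>

lemma LB_TT:
  assumes j: "1 \<le> j" "j \<le> n" and b: "hm db b" and p: "p = pp [j] da * pp [j] db"
  shows "LB p j (TT (gr gg da) b a)
    = TT (gr gg da) (sm (pp [j] da) (B (pp [j] db) (X j) b)) a
      + TT (gr gg (j # da)) b (B (pp [j] da * sy db j) (X j) a)"
proof -
  have "gg j + gr gg da = gr gg (j # da)" "gr gg da + gg j = gr gg (j # da)"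
    by (simp_all add: gr_def add.commute)
  then have "LB p j (TT (gr gg da) b a)
    = TT (gr gg da) (sm (pp [j] da) (X j * b)) a + TT (gr gg (j # da)) b (X j * a)
     - (TT (gr gg da) (sm p (b * X j)) a + TT (gr gg (j # da)) (sm (p * pp db [j]) b) (a * X j))"
    using j hm_chi_w[OF b] by (simp add: LB_def RX_TT[OF j, of b "pp db [j]"] LX_TT SC_add SC_TT chi_gr sm_sm)
  also have "sm p (b * X j) = sm (pp [j] da) (sm (pp [j] db) (b * X j))"
    by (simp add: p sm_sm)
  also have "TT (gr gg (j # da)) (sm (p * pp db [j]) b) (a * X j)
      = TT (gr gg (j # da)) b (sm (pp [j] da * sy db j) (a * X j))"
    by (simp add: TT_sm p sy_def mult_ac)
  finally show ?thesis
    by (simp add: B_def TT_diff_left TT_diff_right sm_diff algebra_simps)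
qed

abbreviation "c1 \<equiv> 1 - inverse q"
abbreviation "ta k m i \<equiv> tau chi gg n k m i"

definition T :: "nat \<Rightarrow> nat \<Rightarrow> nat \<Rightarrow> ('g, 'k) tens" where
  "T k m i = TT (gr gg (W k i)) (sm (ta k m i * c1) (e (i + 1) m)) (e k i)"

definition cop :: "nat \<Rightarrow> nat \<Rightarrow> bool" where
  "cop k m \<longleftrightarrow> D (e k m) \<simeq> TT 0 (e k m) 1 + TT (gr gg (W k m)) 1 (e k m) + (\<Sum>i = k..<m. T k m i)"

lemma hm_one: "hm [] 1"
  by (simp add: hm_def zero_list_def)

lemma good_letter: "1 \<le> j \<Longrightarrow> j \<le> n \<Longrightarrow> good [j]"
  by simp

lemma D_letter: "1 \<le> j \<Longrightarrow> j \<le> n \<Longrightarrow> D (X j) = TT 0 (X j) 1 + TT (gr gg [j]) 1 (X j)"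
  using D_X_mult[of j 1] LX_TT[of j 0 1 1] chi_w_zero[of "[j]"]
  by (simp add: D_one gr_def chi_w_def)

text \<open>The exceptional indices of \<open>\<tau>\<close> are exactly those where the degrees of \<open>e[k,i]\<close> and
  \<open>e[i+1,m]\<close> do not add up to the degree of \<open>e[k,m]\<close>.\<close>

lemma tau_or_split:
  assumes "1 \<le> k" "k \<le> i" "i < m" "m < 2 * n"
  shows "ta k m i = 0 \<or> mset (W k m) = mset (W k i @ W (i + 1) m)"
  using mset_W_split[OF assms] n3 by (auto simp: tau_def)

text \<open>\<open>FR\<close> and \<open>SR\<close> are the two terms that the \<open>i\<close>-th summand for \<open>e[k,p]\<close> produces when it is bracketed
  with \<open>x\<^sub>j\<close> on the right, where \<open>r\<close> is \<open>1\<close>, or \<open>q\<^sup>-\<^sup>1\<close> if \<open>p + 1 = 2n - k\<close>; \<open>FL\<close> and \<open>SL\<close> are their left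
  analogues.\<close>

definition FR :: "'k \<Rightarrow> nat \<Rightarrow> nat \<Rightarrow> nat \<Rightarrow> nat \<Rightarrow> ('g, 'k) tens" where
  "FR r j k p i = TT (gr gg (W k i))
     (sm (ta k p i * c1) (B (pp (W (i + 1) p) [j] * (r * sy (W k i) j)) (e (i + 1) p) (X j))) (e k i)"

definition SR :: "'k \<Rightarrow> nat \<Rightarrow> nat \<Rightarrow> nat \<Rightarrow> nat \<Rightarrow> ('g, 'k) tens" where
  "SR r j k p i = TT (gr gg (W k i @ [j]))
     (sm (ta k p i * c1 * pp (W (i + 1) p) [j]) (e (i + 1) p)) (B (r * pp (W k i) [j]) (e k i) (X j))"

text \<open>Two terms arise outside the sum. The one with 1 - r comes from e \<otimes> 1 and is zero
  for r = 1; the one with \<open>1 - r * sy (W k p) j\<close> comes from g \<otimes> e and becomes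
  the new summand i = p.\<close>

lemma right_bracket_coproduct:
  assumes k: "1 \<le> k" "k \<le> p" "p < 2 * n" and j: "1 \<le> j" "j \<le> n" and cop: "cop k p"
    and e: "e k m = B (r * pp (W k p) [j]) (e k p) (X j)" and W: "mset (W k m) = mset (W k p @ [j])"
  shows "D (e k m) \<simeq> TT 0 (e k m) 1 + TT (gr gg (W k m)) 1 (e k m)
    + (TT (gr gg [j]) (sm ((1 - r) * pp (W k p) [j]) (e k p)) (X j)
     + TT (gr gg (W k p)) (sm (1 - r * sy (W k p) j) (X j)) (e k p)
     + (\<Sum>i = k..<p. FR r j k p i + SR r j k p i))"
proof -
  let ?R = "RB (r * pp (W k p) [j]) j"
  have one: "?R (TT 0 (e k p) 1) = TT 0 (e k m) 1 + TT (gr gg [j]) (sm ((1 - r) * pp (W k p) [j]) (e k p)) (X j)"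
  proof -
    have "?R (TT (gr gg []) (e k p) 1) = TT (gr gg []) (B (pp (W k p) [j] * (r * sy [] j)) (e k p) (X j)) 1
      + TT (gr gg ([] @ [j])) (sm (pp (W k p) [j]) (e k p)) (B (r * pp [] [j]) 1 (X j))"
      using j k by (intro RB_TT hm_e) auto
    moreover have "sy [] j = 1" "B (r * pp [] [j]) 1 (X j) = sm (1 - r) (X j)"
      using pp_Nil(2)[OF good_letter[OF j]] by (simp_all add: sy_def B_def sm_diff_left)
    ultimately show ?thesis
      by (simp add: e mult.commute TT_sm sm_sm)
  qed
  have two: "?R (TT (gr gg (W k p)) 1 (e k p))
    = TT (gr gg (W k p)) (sm (1 - r * sy (W k p) j) (X j)) (e k p) + TT (gr gg (W k m)) 1 (e k m)"
  proof -
    have "?R (TT (gr gg (W k p)) 1 (e k p)) = TT (gr gg (W k p)) (B (pp [] [j] * (r * sy (W k p) j)) 1 (X j)) (e k p)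
      + TT (gr gg (W k p @ [j])) (sm (pp [] [j]) 1) (B (r * pp (W k p) [j]) (e k p) (X j))"
      using j by (intro RB_TT hm_one) auto
    moreover have "B (pp [] [j] * s) 1 (X j) = sm (1 - s) (X j)" for s
      by (simp add: B_def sm_diff_left)
    ultimately show ?thesis
      using gr_mset[OF W, of gg] by (simp add: e)
  qed
  have each: "?R (T k p i) = FR r j k p i + SR r j k p i" if i: "i \<in> {k..<p}" for i
  proof -
    consider "ta k p i = 0" | "mset (W k p) = mset (W k i @ W (i + 1) p)"
      using tau_or_split[of k i p] k i by auto
    then show ?thesis
    proof cases
      case 1
      then show ?thesis
        by (simp add: T_def FR_def SR_def RB_def)
    next
      case 2
      have eq: "r * pp (W k p) [j] = r * pp (W k i) [j] * pp (W (i + 1) p) [j]"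
        using pw_mset[OF 2 refl, of chi gg "[j]"] by (simp add: pp_append_left)
      have h: "hm (W (i + 1) p) (sm (ta k p i * c1) (e (i + 1) p))"
        using i k by (intro hm_sm hm_e) auto
      show ?thesis
        unfolding T_def FR_def SR_def RB_TT[OF j h eq] by (simp add: B_sm_left sm_sm mult_ac)
    qed
  qed
  have sums: "(\<Sum>i = k..<p. ?R (T k p i)) = (\<Sum>i = k..<p. FR r j k p i + SR r j k p i)"
    by (rule sum.cong[OF refl each])
  have "D (e k m) \<simeq> ?R (TT 0 (e k p) 1 + TT (gr gg (W k p)) 1 (e k p) + (\<Sum>i = k..<p. T k p i))"
    unfolding e D_B_right[OF j] by (rule RB_cong) (use cop in \<open>simp add: cop_def\<close>)
  then show ?thesis
    unfolding RB_add RB_sum one two sums by (simp only: add_ac)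
qed

definition FL :: "nat \<Rightarrow> nat \<Rightarrow> nat \<Rightarrow> nat \<Rightarrow> ('g, 'k) tens" where
  "FL j s m i = TT (gr gg (W s i))
     (sm (ta s m i * c1 * pp [j] (W s i)) (B (pp [j] (W (i + 1) m)) (X j) (e (i + 1) m))) (e s i)"

definition SL :: "nat \<Rightarrow> nat \<Rightarrow> nat \<Rightarrow> nat \<Rightarrow> ('g, 'k) tens" where
  "SL j s m i = TT (gr gg (j # W s i)) (sm (ta s m i * c1) (e (i + 1) m))
     (B (pp [j] (W s i) * sy (W (i + 1) m) j) (X j) (e s i))"

text \<open>Only e \<otimes> 1 yields a term outside the sum. Its scalar
  \<open>1 - sy (W s m) j\<close> becomes 1 - q^{-1}, and it is the new summand with second factor
  x_j.\<close>

lemma left_bracket_coproduct: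
  assumes s: "1 \<le> s" "s \<le> m" "m < 2 * n" and j: "1 \<le> j" "j \<le> n" and cop: "cop s m"
    and e: "e k m = B (pp [j] (W s m)) (X j) (e s m)" and W: "W k m = j # W s m"
  shows "D (e k m) \<simeq> TT 0 (e k m) 1 + TT (gr gg (W k m)) 1 (e k m)
    + (TT (gr gg [j]) (sm (1 - sy (W s m) j) (e s m)) (X j) + (\<Sum>i = s..<m. FL j s m i + SL j s m i))"
proof -
  let ?L = "LB (pp [j] (W s m)) j"
  have one: "?L (TT 0 (e s m) 1) = TT 0 (e k m) 1 + TT (gr gg [j]) (sm (1 - sy (W s m) j) (e s m)) (X j)"
  proof -
    have "?L (TT (gr gg []) (e s m) 1) = TT (gr gg []) (sm (pp [j] []) (B (pp [j] (W s m)) (X j) (e s m))) 1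
      + TT (gr gg [j]) (e s m) (B (pp [j] [] * sy (W s m) j) (X j) 1)"
      using j s pp_Nil(2)[OF good_letter[OF j]] by (intro LB_TT hm_e) auto
    moreover have "B c (X j) 1 = sm (1 - c) (X j)" for c :: 'k
      by (simp add: B_def sm_diff_left)
    ultimately show ?thesis
      using pp_Nil(2)[OF good_letter[OF j]] by (simp add: e TT_sm)
  qed
  have two: "?L (TT (gr gg (W s m)) 1 (e s m)) = TT (gr gg (W k m)) 1 (e k m)"
  proof -
    have "?L (TT (gr gg (W s m)) 1 (e s m)) = TT (gr gg (W s m)) (sm (pp [j] (W s m)) (B (pp [j] []) (X j) 1)) (e s m)
      + TT (gr gg (j # W s m)) 1 (B (pp [j] (W s m) * sy [] j) (X j) (e s m))"
      using j pp_Nil(2)[OF good_letter[OF j]] by (intro LB_TT hm_one) auto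
    then show ?thesis
      using pp_Nil(2)[OF good_letter[OF j]] by (simp add: e W sy_def B_def[of 1 "X j" 1])
  qed
  have each: "?L (T s m i) = FL j s m i + SL j s m i" if i: "i \<in> {s..<m}" for i
  proof -
    consider "ta s m i = 0" | "mset (W s m) = mset (W s i @ W (i + 1) m)"
      using tau_or_split[of s i m] s i by auto
    then show ?thesis
    proof cases
      case 1
      then show ?thesis
        by (simp add: T_def FL_def SL_def LB_def)
    next
      case 2
      have eq: "pp [j] (W s m) = pp [j] (W s i) * pp [j] (W (i + 1) m)"
        using pw_mset[OF refl 2, of chi gg "[j]"] pp_append_right[OF good_letter[OF j]] by simp
      have h: "hm (W (i + 1) m) (sm (ta s m i * c1) (e (i + 1) m))"
        using i s by (intro hm_sm hm_e) auto
      show ?thesis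
        unfolding T_def FL_def SL_def LB_TT[OF j h eq] by (simp add: B_sm_right sm_sm mult_ac)
    qed
  qed
  have sums: "(\<Sum>i = s..<m. ?L (T s m i)) = (\<Sum>i = s..<m. FL j s m i + SL j s m i)"
    by (rule sum.cong[OF refl each])
  have "D (e k m) \<simeq> ?L (TT 0 (e s m) 1 + TT (gr gg (W s m)) 1 (e s m) + (\<Sum>i = s..<m. T s m i))"
    unfolding e D_B_left[OF j] by (rule LB_cong) (use cop in \<open>simp add: cop_def\<close>)
  then show ?thesis
    unfolding LB_add LB_sum one two sums by (simp only: add_ac)
qed

lemma FR_zero: "ta k p i = 0 \<Longrightarrow> FR r j k p i = 0"
  and SR_zero: "ta k p i = 0 \<Longrightarrow> SR r j k p i = 0"
  by (simp_all add: FR_def SR_def)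

lemma FR_cong:
  assumes "r * sy (W k i) j = s" "B (pp (W (i + 1) p) [j] * s) (e (i + 1) p) (X j) \<approx> e (i + 1) m"
    "ta k p i = ta k m i"
  shows "FR r j k p i \<simeq> T k m i"
  unfolding FR_def T_def assms(1,3) by (intro TT_cong cong_sm assms(2) cong_refl)

lemma SR_J: "B (r * pp (W k i) [j]) (e k i) (X j) \<in> J \<Longrightarrow> SR r j k p i \<simeq> 0"
  unfolding SR_def by (rule TT_J_right)

lemma FL_J: "B (pp [j] (W (i + 1) m)) (X j) (e (i + 1) m) \<in> J \<Longrightarrow> FL j s m i \<simeq> 0"
  unfolding FL_def by (intro TT_J_left J_sm)

lemma SL_cong:
  assumes "sy (W (i + 1) m) j = t" "B (pp [j] (W s i) * t) (X j) (e s i) \<approx> e k i"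
    "ta s m i = ta k m i" "mset (W k i) = mset (j # W s i)"
  shows "SL j s m i \<simeq> T k m i"
  unfolding SL_def T_def assms(1,3) gr_mset[OF assms(4)] by (intro TT_cong assms(2) cong_refl)

lemma tcong_sum_single:
  assumes "finite A" "a \<in> A" "\<And>i. i \<in> A \<Longrightarrow> i \<noteq> a \<Longrightarrow> f i \<simeq> 0"
  shows "sum f A \<simeq> f a"
proof -
  have "sum f A \<simeq> (\<Sum>i\<in>A. if i = a then f a else 0)"
    by (rule tcong_sum) (use assms in auto)
  then show ?thesis
    using assms by simp
qed

lemma tau_simps:
  "ta k n (n - 1) = 0" "m \<noteq> n \<Longrightarrow> ta k m (n - 1) = pp [n] [n - 1]" "k \<noteq> n \<Longrightarrow> ta k m n = 1" "ta n m n = 0"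
  "i \<noteq> n - 1 \<Longrightarrow> i \<noteq> n \<Longrightarrow> ta k m i = 1"
  using n3 by (auto simp: tau_def pp_letters)

lemma cop_self: "1 \<le> k \<Longrightarrow> k < 2 * n \<Longrightarrow> cop k k"
  using D_letter[of "lt n k"] W_self[of k] e_self[of k] by (auto simp: cop_def lt_def)

text \<open>Both elements are x_n, and the single index of each sum is one where tau is
  zero.\<close>

lemma cop_exceptional: "cop (n - 1) n" "cop n (n + 1)"
proof -
  have "{n - 1..<n} = {n - 1}" "{n..<n + 1} = {n}"
    using n3 by auto
  then show "cop (n - 1) n" "cop n (n + 1)"
    using D_letter[of n] n3 unfolding cop_def T_def W_special e_special
    by (simp_all add: tau_simps del: One_nat_def)
qed

lemma cop_rightI:
  assumes "1 \<le> k" "k \<le> p" "p < 2 * n" "1 \<le> j" "j \<le> n" "cop k p"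
    and "e k m = B (r * pp (W k p) [j]) (e k p) (X j)" "mset (W k m) = mset (W k p @ [j])"
    and "TT (gr gg [j]) (sm ((1 - r) * pp (W k p) [j]) (e k p)) (X j)
     + TT (gr gg (W k p)) (sm (1 - r * sy (W k p) j) (X j)) (e k p)
     + (\<Sum>i = k..<p. FR r j k p i + SR r j k p i) \<simeq> (\<Sum>i = k..<m. T k m i)"
  shows "cop k m"
  unfolding cop_def
  by (rule tcong_trans[OF right_bracket_coproduct[OF assms(1-8)] tcong_add[OF tcong_refl assms(9)]])

lemma cop_leftI:
  assumes "1 \<le> s" "s \<le> m" "m < 2 * n" "1 \<le> j" "j \<le> n" "cop s m"
    and "e k m = B (pp [j] (W s m)) (X j) (e s m)" "W k m = j # W s m"
    and "TT (gr gg [j]) (sm (1 - sy (W s m) j) (e s m)) (X j) + (\<Sum>i = s..<m. FL j s m i + SL j s m i)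
      \<simeq> (\<Sum>i = k..<m. T k m i)"
  shows "cop k m"
  unfolding cop_def
  by (rule tcong_trans[OF left_bracket_coproduct[OF assms(1-8)] tcong_add[OF tcong_refl assms(9)]])

text \<open>The stray term is added at one index; in this way the merging of two terms enters the
  sums.\<close>

lemma tcong_sum_absorb:
  assumes "finite A" "a \<in> A" "\<And>i. i \<in> A \<Longrightarrow> f i + (if i = a then x else 0) \<simeq> g i"
  shows "sum f A + x \<simeq> sum g A"
proof -
  have "sum f A + x = (\<Sum>i\<in>A. f i + (if i = a then x else 0))"
    using assms by (simp add: sum.distrib)
  then show ?thesis
    using tcong_sum[of A, OF assms(3)] by simp
qed

section \<open>Letters appended on the right\<close>

lemma far_letter_after:
  assumes "1 \<le> k" "k \<le> i" "i + 2 \<le> j" "j \<le> n" "i + 3 \<le> n"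
  shows "far (W k i) [j]"
proof -
  have "a \<le> i" if "a \<in> set (W k i)" for a
    using set_W_bounds(4)[OF _ _ _ that] assms by auto
  then show ?thesis
    by (intro farI_less[of _ i]) (use assms in auto)
qed

lemma tau_eq:
  "k \<noteq> n \<Longrightarrow> k' \<noteq> n \<Longrightarrow> m \<noteq> n \<Longrightarrow> m' \<noteq> n \<Longrightarrow> ta k m i = ta k' m' i"
  "n < i \<Longrightarrow> ta k m i = 1" "i + 2 \<le> n \<Longrightarrow> ta k m i = 1"
  using n3 by (auto simp: tau_def)

text \<open>x_m is far from \<open>e[k,i]\<close> for i < p, so an old summand only extends its
  first factor. The new summand has scalar 1 - q^{-1} because \<open>e(k,p)\<close> contains exactly
  one neighbour of m and not m itself.\<close>

lemma cop_ascending: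
  assumes k: "1 \<le> k" "k \<le> pr m" "m \<le> n" "k < m" and cop: "cop k (pr m)"
  shows "cop k m"
proof -
  define p where "p = pr m"
  have p: "k \<le> p" "p < m" "p + 1 = m \<and> m < n \<or> p + 2 = n \<and> m = n" "p + 2 \<le> n"
    using k n3 by (auto simp: p_def pr_def)
  have m: "lt n m = m"
    using k by (simp add: lt_def)
  have ind: "FR 1 m k p i + SR 1 m k p i \<simeq> T k m i" if i: "i \<in> {k..<p}" for i
  proof -
    have f: "far (W k i) [m]"
      by (rule far_letter_after) (use i k p in auto)
    have g: "good (W k i)"
      using good_W[of k i] i k p by auto
    have "FR 1 m k p i \<simeq> T k m i"
    proof (rule FR_cong)
      show "1 * sy (W k i) m = 1"
        using far_sy[OF g _ _ f] k by auto
      show "B (pp (W (i + 1) p) [m] * 1) (e (i + 1) p) (X m) \<approx> e (i + 1) m"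
        using e_left[of "i + 1" m] m i k p by (simp add: p_def)
      show "ta k p i = ta k m i"
        using i p by (simp add: tau_eq(3))
    qed
    moreover have "B (1 * pp (W k i) [m]) (e k i) (X m) \<in> J"
      using far_commute[OF hm_e hm_X g _ f] i k p by simp
    then have "SR 1 m k p i \<simeq> 0"
      by (rule SR_J)
    ultimately show ?thesis
      using tcong_add by fastforce
  qed
  have last: "TT (gr gg (W k p)) (sm (1 - 1 * sy (W k p) m) (X m)) (e k p) = T k m p"
  proof -
    have "sy (W k p) m = inverse q"
      using p(3) sy_values_left(1)[OF k(1) p(1,4)] sy_values_left(2)[OF k(1)] p(1)
      by (auto simp: diff_eq_eq)
    moreover have "e (p + 1) m = X m"
      using p(3)
    proof
      assume "p + 1 = m \<and> m < n"
      then show ?thesis using e_letter[of m] k by simp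
    next
      assume "p + 2 = n \<and> m = n"
      moreover from this have "p + 1 = n - 1" by linarith
      ultimately show ?thesis using e_special by simp
    qed
    moreover have "ta k m p = 1"
      using p by (intro tau_simps(5)) auto
    ultimately show ?thesis
      by (simp add: T_def)
  qed
  have sums: "(\<Sum>i = k..<m. T k m i) = (\<Sum>i = k..<p. T k m i) + T k m p"
    using p(3)
  proof
    assume "p + 1 = m \<and> m < n"
    then show ?thesis using p by auto
  next
    \<comment> \<open>For m = n the index n - 1 lies between p and m; its summand has tau =
      0.\<close>
    assume a: "p + 2 = n \<and> m = n"
    then have "p + 1 = n - 1" "m = n"
      by linarith+
    then have "T k m (p + 1) = 0"
      using tau_simps(1)[of k] unfolding T_def by simp
    moreover have "{k..<m} = insert p (insert (p + 1) {k..<p})"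
      using a p by auto
    ultimately show ?thesis by (simp add: add.commute)
  qed
  show ?thesis
  proof (rule cop_rightI[where r = 1 and p = p and j = m])
    show "e k m = B (1 * pp (W k p) [m]) (e k p) (X m)"
      using e_left[of k m] m k n3 by (simp add: p_def)
    show "mset (W k m) = mset (W k p @ [m])"
      using W_pr[of k m] m k p n3 by (simp add: p_def)
    have "(\<Sum>i = k..<p. FR 1 m k p i + SR 1 m k p i) + T k m p \<simeq> (\<Sum>i = k..<p. T k m i) + T k m p"
      by (intro tcong_add tcong_sum ind tcong_refl)
    then show "TT (gr gg [m]) (sm ((1 - 1) * pp (W k p) [m]) (e k p)) (X m)
      + TT (gr gg (W k p)) (sm (1 - 1 * sy (W k p) m) (X m)) (e k p)
      + (\<Sum>i = k..<p. FR 1 m k p i + SR 1 m k p i) \<simeq> (\<Sum>i = k..<m. T k m i)"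
      unfolding last sums by (simp add: add.commute)
  qed (use k p cop n3 in \<open>auto simp: p_def\<close>)
qed

lemma e_prefix_letter:
  assumes "1 \<le> k" "k \<le> l" "l + 2 \<le> n"
  shows "e k (l + 1) = B (pp (W k l) [l + 1]) (e k l) (X (l + 1))" "W k (l + 1) = W k l @ [l + 1]"
  using e_left_step[of k l] W_pr[of k "l + 1"] assms by (auto simp: lt_def pr_def)

lemma pp_W_Cons_self:
  assumes "1 \<le> j" "j + 2 \<le> n" "j < m" "m < 2 * n"
  shows "pp (W j m) [j] = q * pp (W (j + 1) m) [j]"
proof -
  have "mset (W j m) = mset ([j] @ W (j + 1) m)"
    using mset_W_Cons[of j m] assms by simp
  then show ?thesis
    using pw_mset[of "W j m" "[j] @ W (j + 1) m" "[j]" "[j]" chi gg] pp_letter_self[of j] assms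
    by (simp only: pp_append_left)
qed

text \<open>Brackets of \<open>e[k,i]\<close> with x_j vanish, or carry tau = 0, except for i = j -
  1, where the result is \<open>e[k,j]\<close>. That term is moved to i = j, where the tail
  \<open>e[j+1,p]\<close> lies on the line and appending x_j alone does not give
  \<open>e[j+1,p+1]\<close>.\<close>

lemma cop_past_middle:
  assumes k: "1 \<le> k" "k < j" "j + 1 \<le> n" "j + p + 1 = 2 * n" and cop: "cop k p"
  shows "cop k (p + 1)"
proof -
  obtain l where l: "j = l + 1" "k \<le> l"
    using k by (cases j) auto
  have p: "n \<le> p" "p + 1 < 2 * n" "lt n (p + 1) = j" "p + 1 \<noteq> n" "k \<noteq> n" "n < p + 1" "k < p" "1 \<le> j" "j \<le> n"
    using k by (auto simp: lt_def)
  note d = descending(1,2)[of j "p + 1"]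
  have pref: "e k j = B (pp (W k l) [j]) (e k l) (X j)" "W k j = W k l @ [j]"
    using e_prefix_letter[of k l] k l by auto
  have ta: "ta k p i = ta k (p + 1) i" if "p \<noteq> n \<or> i \<noteq> n - 1" for i
    using that p n3 by (auto simp: tau_def)
  have special: "p = n" "j = n - 1" if "j + 2 > n"
    using that k by auto
  have S0: "SR 1 j k p i \<simeq> 0" if i: "i \<in> {k..<p}" "i \<noteq> l" for i
  proof -
    have "j + 2 \<le> n \<or> i \<le> j" "k \<le> i" "i < p"
      using i k by auto
    then consider "i + 2 \<le> j" | "i = j" "j + 2 > n" | "i = j" "j + 2 \<le> n" | "j < i" "j + 2 \<le> n"
      using i(2) l(1) by linarith
    then show ?thesis
    proof cases
      case 1
      have "far (W k i) [j]"
        by (rule far_letter_after) (use 1 i k in auto)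
      then have "B (pp (W k i) [j]) (e k i) (X j) \<in> J"
        using 1 i k p by (intro far_commute hm_e hm_X good_W) auto
      then show ?thesis
        by (intro SR_J) simp
    next
      case 2
      then have "ta k p i = 0"
        using special tau_simps(1) by simp
      then show ?thesis
        by (simp add: SR_zero)
    next
      case 3
      then show ?thesis
        using last_letter_commutes[of k j] k by (intro SR_J) simp
    next
      case 4
      then show ?thesis
        using inner_letter_commutes[of k j i] i k by (intro SR_J) simp
    qed
  qed
  have F: "FR 1 j k p i + (if i = j then SR 1 j k p l else 0) \<simeq> T k (p + 1) i" if i: "i \<in> {k..<p}" for i
  proof -
    have "j + 2 \<le> n \<or> i \<le> j" "k \<le> i" "i < p"
      using i k by auto
    then consider "i + 2 \<le> j" | "i = l" | "i = j" "j + 2 > n" | "i = j" "j + 2 \<le> n" | "j < i" "j + 2 \<le> n"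
      using l(1) by linarith
    then show ?thesis
    proof cases
      case 1
      have f: "far (W k i) [j]"
        by (rule far_letter_after) (use 1 i k in auto)
      have "FR 1 j k p i \<simeq> T k (p + 1) i"
      proof (rule FR_cong)
        show "1 * sy (W k i) j = 1"
          using far_sy[OF good_W _ _ f] i k p by auto
        show "B (pp (W (i + 1) p) [j] * 1) (e (i + 1) p) (X j) \<approx> e (i + 1) (p + 1)"
          using e_left_step[of "i + 1" p] 1 i k p by simp
        show "ta k p i = ta k (p + 1) i"
          using 1 k by (intro ta) auto
      qed
      then show ?thesis
        using 1 by simp
    next
      case 2
      have "FR 1 j k p l \<simeq> T k (p + 1) l"
      proof (rule FR_cong)
        show "1 * sy (W k l) j = inverse q"
          using sy_values_left(1)[of k l] l k by simp
        \<comment> \<open>The twist q^{-1} is precisely the factor in the definition of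
          \<open>e[j,2n-j]\<close>.\<close>
        show "B (pp (W (l + 1) p) [j] * inverse q) (e (l + 1) p) (X j) \<approx> e (l + 1) (p + 1)"
          using e_mid[of j p] l k by (simp add: mult.commute)
        show "ta k p l = ta k (p + 1) l"
          using l k by (intro ta) auto
      qed
      then show ?thesis
        using 2 l by simp
    next
      \<comment> \<open>For j = n - 1 the old summand at i = j has tau = 0, and the moved term alone
        is the new one. Its scalar \<open>pp (W (l + 1) p) [j]\<close> is p(x_n,x_{n-1}), the value
        of tau at n - 1.\<close>
      case 3
      note sp = special[OF 3(2)]
      have "FR 1 j k p i = 0"
        using 3 sp tau_simps(1) by (intro FR_zero) simp
      moreover have "SR 1 j k p l = T k (p + 1) j"
      proof -
        have "ta k p l = 1"
          using l k by (intro tau_eq) auto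
        moreover have "ta k (p + 1) j = pp [n] [n - 1]"
          unfolding sp by (rule tau_simps) simp
        moreover have "W (l + 1) p = [n]" "e (l + 1) p = X n" "e (j + 1) (p + 1) = X n"
          using sp l n3 W_special e_special by auto
        ultimately show ?thesis
          using sp pref by (simp add: SR_def T_def mult.commute)
      qed
      ultimately show ?thesis
        using 3 by simp
    next
      case 4
      obtain t where t: "p = t + 1"
        using p k by (cases p) auto
      let ?r = "pp (W (j + 1) p) [j]" and ?b = "e (j + 1) p"
      have ta1: "ta k p j = 1" "ta k p l = 1" "ta k (p + 1) j = 1"
        using 4 l by (auto simp: tau_eq(2,3))
      have s: "sy (W k j) j = q"
        using sy_values_left(3)[of k j] 4 k by simp
      have "FR 1 j k p j + SR 1 j k p l
         = TT (gr gg (W k j)) (sm c1 (B (?r * q) ?b (X j) + sm (q * ?r) (e j p))) (e k j)"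
        using pref pp_W_Cons_self[of j p] 4 k p l ta1 s
        by (simp add: FR_def SR_def TT_add_left sm_add sm_sm)
      moreover have "\<dots> \<simeq> T k (p + 1) j"
        unfolding T_def ta1
      proof (intro TT_cong cong_refl)
        have "B (?r * q) ?b (X j) + sm (q * ?r) (e j p) = sm (q * ?r) (e j p) + ?b * X j - sm (q * ?r) (X j * ?b)"
          by (simp add: B_def mult.commute)
        also have "\<dots> \<approx> e (j + 1) (p + 1)"
          using cong_sym[OF closing_relations(1)[of j t]] 4 k t by simp
        finally show "sm c1 (B (?r * q) ?b (X j) + sm (q * ?r) (e j p)) \<approx> sm (1 * c1) (e (j + 1) (p + 1))"
          using cong_sm by simp
      qed
      ultimately show ?thesis
        using 4 by simp
    next
      case 5
      have "FR 1 j k p i \<simeq> T k (p + 1) i"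
      proof (rule FR_cong)
        show "1 * sy (W k i) j = 1"
          using sy_values_left(4)[of k j i] 5 i k by simp
        show "B (pp (W (i + 1) p) [j] * 1) (e (i + 1) p) (X j) \<approx> e (i + 1) (p + 1)"
          using cong_sym[OF e_snoc_right[of j p "i + 1"]] 5 i k p by simp
        show "ta k p i = ta k (p + 1) i"
          using 5 k by (intro ta) auto
      qed
      then show ?thesis
        using 5 by simp
    qed
  qed
  have "sum (FR 1 j k p) {k..<p} + sum (SR 1 j k p) {k..<p} \<simeq> sum (FR 1 j k p) {k..<p} + SR 1 j k p l"
    by (intro tcong_add tcong_refl tcong_sum_single) (use S0 l k p in auto)
  moreover have "sum (FR 1 j k p) {k..<p} + SR 1 j k p l \<simeq> (\<Sum>i = k..<p. T k (p + 1) i)"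
    by (rule tcong_sum_absorb[where a = j]) (use F k p in auto)
  ultimately have 1: "(\<Sum>i = k..<p. FR 1 j k p i + SR 1 j k p i) \<simeq> (\<Sum>i = k..<p. T k (p + 1) i)"
    unfolding sum.distrib by (rule tcong_trans)
  have last: "TT (gr gg (W k p)) (sm (1 - 1 * sy (W k p) j) (X j)) (e k p) = T k (p + 1) p"
  proof -
    have "ta k (p + 1) p = 1"
      using p tau_simps(3)[of k] tau_eq(2)[of p] by (cases "p = n") auto
    moreover have "sy (W k p) j = inverse q"
      using sy_values_left(5)[of k j p] k by simp
    ultimately show ?thesis
      using d k p by (simp add: T_def)
  qed
  show ?thesis
  proof (rule cop_rightI[where r = 1 and p = p and j = j])
    show "e k (p + 1) = B (1 * pp (W k p) [j]) (e k p) (X j)"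
      using e_left_step[of k p] k p by simp
    show "mset (W k (p + 1)) = mset (W k p @ [j])"
      using W_pr[of k "p + 1"] k p by (simp add: pr_def)
    show "TT (gr gg [j]) (sm ((1 - 1) * pp (W k p) [j]) (e k p)) (X j)
      + TT (gr gg (W k p)) (sm (1 - 1 * sy (W k p) j) (X j)) (e k p)
      + (\<Sum>i = k..<p. FR 1 j k p i + SR 1 j k p i) \<simeq> (\<Sum>i = k..<p + 1. T k (p + 1) i)"
      unfolding last using tcong_add[OF 1 tcong_refl[of "T k (p + 1) p"]] p
      by (simp add: add.commute)
  qed (use k p cop in auto)
qed

text \<open>With r = q^{-1} all brackets of \<open>e[k,i]\<close> with x_k vanish or carry tau = 0.
  The part needed for merging at i = k now comes from e \<otimes> 1, whose extra term has second
  factor x_k = e[k,k].\<close>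

lemma cop_mid:
  assumes k: "1 \<le> k" "k + 1 \<le> n" "k + p + 1 = 2 * n" and cop: "cop k p"
  shows "cop k (p + 1)"
proof -
  let ?r = "inverse q"
  have p: "n \<le> p" "k < p" "p + 1 < 2 * n" "k \<noteq> n" "n < p + 1" "p + 1 \<noteq> n"
    using k n3 by auto
  have kk: "W k k = [k]" "e k k = X k"
    using W_letter[of k] e_letter[of k] k by auto
  have special: "p = n" "k = n - 1" if "k + 2 > n"
    using that k by auto
  have ta: "ta k p i = ta k (p + 1) i" if "k + 2 \<le> n" for i
    using that k by (intro tau_eq) auto
  have qq: "pp [k] [k] = q"
    using pp_letter_self[of k] k by simp
  let ?x = "TT (gr gg [k]) (sm ((1 - ?r) * pp (W k p) [k]) (e k p)) (X k)"
  have S: "SR ?r k k p i \<simeq> 0" if i: "i \<in> {k..<p}" for i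
  proof -
    have "k + 2 \<le> n \<or> i = k" "k \<le> i" "i < p"
      using i k by auto
    then consider "i = k" | "k < i" "k + 2 \<le> n"
      by linarith
    then show ?thesis
    proof cases
      case 1
      have "B (?r * q) (X k) (X k) = 0"
        using q_nz by (simp add: B_def)
      then show ?thesis
        using 1 kk qq J_0 by (intro SR_J) simp
    next
      case 2
      have "B (pp [k] (W k i)) (X k) (e k i) \<in> J"
        by (rule first_letter_commutes) (use 2 i k in auto)
      \<comment> \<open>The product of the two scalars is q, so the defining factor q^{-1} makes
        them mutually inverse.\<close>
      moreover have "pp [k] (W k i) * (?r * pp (W k i) [k]) = 1"
        using sy_values_left(6)[of k i] 2 i k q_nz by (simp add: sy_def mult_ac)
      ultimately have "B (?r * pp (W k i) [k]) (e k i) (X k) \<in> J"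
        by (rule B_commute)
      then show ?thesis
        by (rule SR_J)
    qed
  qed
  have F: "FR ?r k k p i + (if i = k then ?x else 0) \<simeq> T k (p + 1) i" if i: "i \<in> {k..<p}" for i
  proof -
    have "k + 2 \<le> n \<or> i = k" "k \<le> i" "i < p"
      using i k by auto
    then consider "i = k" "k + 2 > n" | "i = k" "k + 2 \<le> n" | "k < i" "k + 2 \<le> n"
      by linarith
    then show ?thesis
    proof cases
      case 1
      note sp = special[OF 1(2)]
      have "FR ?r k k p i = 0"
        using 1 sp tau_simps(1) by (intro FR_zero) simp
      moreover have "?x = T k (p + 1) k"
      proof -
        have "ta k (p + 1) k = pp [n] [n - 1]"
          unfolding sp by (rule tau_simps) simp
        moreover have "W k p = [n]" "e k p = X n" "e (k + 1) (p + 1) = X n"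
          using sp n3 W_special e_special by auto
        ultimately show ?thesis
          using sp kk by (simp add: T_def mult.commute)
      qed
      ultimately show ?thesis
        using 1 by simp
    next
      case 2
      obtain t where t: "p = t + 1"
        using p k by (cases p) auto
      let ?s = "pp (W (k + 1) p) [k]" and ?b = "e (k + 1) p"
      have ta1: "ta k p k = 1" "ta k (p + 1) k = 1"
        using 2 by (auto simp: tau_eq(2,3))
      have s: "?r * sy (W k k) k = q"
        using kk qq q_nz by (simp add: sy_def)
      have "FR ?r k k p k + ?x
         = TT (gr gg (W k k)) (sm c1 (B (?s * q) ?b (X k) + sm (q * ?s) (e k p))) (e k k)"
        unfolding FR_def s ta1 using kk pp_W_Cons_self[of k p] 2 k p
        by (simp add: TT_add_left sm_add sm_sm)
      moreover have "\<dots> \<simeq> T k (p + 1) k"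
        unfolding T_def ta1
      proof (intro TT_cong cong_refl)
        have "B (?s * q) ?b (X k) + sm (q * ?s) (e k p) = sm (q * ?s) (e k p) + ?b * X k - sm (q * ?s) (X k * ?b)"
          by (simp add: B_def mult.commute)
        also have "\<dots> \<approx> e (k + 1) (p + 1)"
          using cong_sym[OF closing_relations(1)[of k t]] 2 k t by simp
        finally show "sm c1 (B (?s * q) ?b (X k) + sm (q * ?s) (e k p)) \<approx> sm (1 * c1) (e (k + 1) (p + 1))"
          using cong_sm by simp
      qed
      ultimately show ?thesis
        using 2 by simp
    next
      case 3
      have "FR ?r k k p i \<simeq> T k (p + 1) i"
      proof (rule FR_cong)
        show "?r * sy (W k i) k = 1"
          using sy_values_left(6)[of k i] 3 i k q_nz by simp
        show "B (pp (W (i + 1) p) [k] * 1) (e (i + 1) p) (X k) \<approx> e (i + 1) (p + 1)"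
          using cong_sym[OF e_snoc_right[of k p "i + 1"]] 3 i k p by simp
        show "ta k p i = ta k (p + 1) i"
          by (rule ta) (use 3 in auto)
      qed
      then show ?thesis
        using 3 by simp
    qed
  qed
  have "(\<Sum>i = k..<p. SR ?r k k p i) \<simeq> (\<Sum>i = k..<p. 0)"
    by (rule tcong_sum) (rule S)
  then have "sum (FR ?r k k p) {k..<p} + ?x + (\<Sum>i = k..<p. SR ?r k k p i)
      \<simeq> (\<Sum>i = k..<p. T k (p + 1) i) + 0"
    using k p by (intro tcong_add tcong_sum_absorb[where a = k] F) auto
  then have 1: "?x + (\<Sum>i = k..<p. FR ?r k k p i + SR ?r k k p i) \<simeq> (\<Sum>i = k..<p. T k (p + 1) i)"
    by (simp add: sum.distrib add_ac)
  have last: "TT (gr gg (W k p)) (sm (1 - ?r * sy (W k p) k) (X k)) (e k p) = T k (p + 1) p"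
  proof -
    have "ta k (p + 1) p = 1"
      using p tau_simps(3)[of k] tau_eq(2)[of p] by (cases "p = n") auto
    moreover have "sy (W k p) k = 1"
      using sy_values_left(7)[of k p] k by simp
    ultimately show ?thesis
      using descending(1,2)[of k "p + 1"] k p by (simp add: T_def)
  qed
  show ?thesis
  proof (rule cop_rightI[where r = ?r and p = p and j = k])
    show "e k (p + 1) = B (?r * pp (W k p) [k]) (e k p) (X k)"
      by (rule e_mid) (use k in auto)
    have "lt n (p + 1) = k"
      using k by (auto simp: lt_def)
    then show "mset (W k (p + 1)) = mset (W k p @ [k])"
      using W_pr[of k "p + 1"] k p by (simp add: pr_def)
    show "?x + TT (gr gg (W k p)) (sm (1 - ?r * sy (W k p) k) (X k)) (e k p)
      + (\<Sum>i = k..<p. FR ?r k k p i + SR ?r k k p i) \<simeq> (\<Sum>i = k..<p + 1. T k (p + 1) i)"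
      unfolding last using tcong_add[OF 1 tcong_refl[of "T k (p + 1) p"]] p
      by (simp add: add_ac)
  qed (use k p cop in auto)
qed

section \<open>Letters attached on the left\<close>

lemma tail_commutes:
  assumes "1 \<le> j" "j \<le> n" "n < t" "t \<le> m" "m < 2 * n" "2 * n + 2 \<le> t + j" "j = n \<Longrightarrow> n + 3 \<le> t"
  shows "FL j s m (t - 1) \<simeq> 0" "sy (W t m) j = 1"
proof -
  have nonadj: "b \<noteq> j \<and> \<not> adj b j \<and> \<not> adj j b" if "b \<in> set (W t m)" for b
  proof -
    have "t + b \<le> 2 * n"
      using set_W_descending[OF _ _ _ that] assms by auto
    \<comment> \<open>For j = n the bound t \<ge> n + 3 excludes n - 2, the neighbour of n.\<close>
    then have "b + 2 \<le> j" "b + 3 \<le> n"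
      using assms by (cases "j = n"; simp)+
    then show ?thesis
      by (auto simp: adj_def)
  qed
  then have far: "far [j] (W t m)" "far (W t m) [j]"
    by (auto simp: far_def)
  show "sy (W t m) j = 1"
    using far_sy[OF good_W _ _ far(2)] assms by auto
  have "B (pp [j] (W t m)) (X j) (e t m) \<in> J"
    using assms far by (intro far_commute hm_X hm_e good_W) auto
  then show "FL j s m (t - 1) \<simeq> 0"
    using assms by (intro FL_J) simp
qed

text \<open>Only the letter at position k + 1 interacts with x_j; tails starting later skew commute
  with it.\<close>

lemma cop_descending:
  assumes k: "n < k" "k < m" "m < 2 * n" and cop: "cop (k + 1) m"
  shows "cop k m"
proof -
  obtain j where j: "j + k = 2 * n"
    using k by (metis le_add_diff_inverse2 less_or_eq_imp_le less_trans)
  have j': "1 \<le> j" "j + 1 \<le> n"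
    using j k by auto
  note d = descending[OF j k(1)]
  have ind: "FL j (k + 1) m i + SL j (k + 1) m i \<simeq> T k m i" if i: "i \<in> {k + 1..<m}" for i
  proof -
    have t: "FL j (k + 1) m i \<simeq> 0" "sy (W (i + 1) m) j = 1"
      using tail_commutes[of j "i + 1" m] i k j j' by auto
    have "SL j (k + 1) m i \<simeq> T k m i"
    proof (rule SL_cong[OF t(2)])
      show "B (pp [j] (W (k + 1) i) * 1) (X j) (e (k + 1) i) \<approx> e k i"
        using d(4)[of i] i k by simp
      show "ta (k + 1) m i = ta k m i"
        using i k by (simp add: tau_eq(2))
      show "mset (W k i) = mset (j # W (k + 1) i)"
        using d(3)[of i] i k by simp
    qed
    from tcong_add[OF t(1) this] show ?thesis by simp
  qed
  have "TT (gr gg [j]) (sm (1 - sy (W (k + 1) m) j) (e (k + 1) m)) (X j) = T k m k"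
    using sy_values_right(4)[of m j "k + 1"] tau_eq(2)[of k k m] d(1,2) j j' k by (simp add: T_def)
  moreover have "(\<Sum>i = k + 1..<m. FL j (k + 1) m i + SL j (k + 1) m i) \<simeq> (\<Sum>i = k + 1..<m. T k m i)"
    by (rule tcong_sum) (rule ind)
  moreover have "{k..<m} = insert k {k + 1..<m}"
    using k by auto
  ultimately have "TT (gr gg [j]) (sm (1 - sy (W (k + 1) m) j) (e (k + 1) m)) (X j)
     + (\<Sum>i = k + 1..<m. FL j (k + 1) m i + SL j (k + 1) m i) \<simeq> (\<Sum>i = k..<m. T k m i)"
    by (simp add: tcong_add)
  then show ?thesis
    by (rule cop_leftI[rotated 8]) (use d(3,4)[of m] k j j' cop in auto)
qed

lemma e_from_n:
  assumes "n + 2 \<le> i" "i < 2 * n"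
  shows "e n i = B (pp [n] (W (n + 2) i)) (X n) (e (n + 2) i)" "W n i = n # W (n + 2) i"
    "e (n - 1) i = B (pp [n] (W (n + 1) i)) (X n) (e (n + 1) i)" "W (n - 1) i = n # W (n + 1) i"
proof -
  have s: "sc n = n + 2" "fl n = n" "sc (n - 1) = n + 1" "fl (n - 1) = n"
    using n3 by (auto simp: sc_def fl_def lt_def)
  show "e n i = B (pp [n] (W (n + 2) i)) (X n) (e (n + 2) i)" "W n i = n # W (n + 2) i"
    using e_right[of n i] W_sc[of n i] s assms n3 by auto
  show "e (n - 1) i = B (pp [n] (W (n + 1) i)) (X n) (e (n + 1) i)" "W (n - 1) i = n # W (n + 1) i"
    using e_right[of "n - 1" i] W_sc[of "n - 1" i] s assms n3 by auto
qed

text \<open>The word \<open>e(n,m)\<close> jumps from n to n + 2, so two indices are new: i = n with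
  tau = 0, and i = n + 1, where \<open>e[n,n+1]\<close> is x_n.\<close>

lemma cop_from_n:
  assumes m: "n + 2 \<le> m" "m < 2 * n" and cop: "cop (n + 2) m"
  shows "cop n m"
proof -
  have ind: "FL n (n + 2) m i + SL n (n + 2) m i \<simeq> T n m i" if i: "i \<in> {n + 2..<m}" for i
  proof -
    have t: "FL n (n + 2) m i \<simeq> 0" "sy (W (i + 1) m) n = 1"
      using tail_commutes[of n "i + 1" m] i m n3 by auto
    have "SL n (n + 2) m i \<simeq> T n m i"
    proof (rule SL_cong[OF t(2)])
      show "B (pp [n] (W (n + 2) i) * 1) (X n) (e (n + 2) i) \<approx> e n i"
        using e_from_n(1)[of i] i m by simp
      show "ta (n + 2) m i = ta n m i"
        using i by (simp add: tau_eq(2))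
      show "mset (W n i) = mset (n # W (n + 2) i)"
        using e_from_n(2)[of i] i m by simp
    qed
    from tcong_add[OF t(1) this] show ?thesis by simp
  qed
  have "TT (gr gg [n]) (sm (1 - sy (W (n + 2) m) n) (e (n + 2) m)) (X n) = T n m (n + 1)"
    using sy_values_right(6)[of m 1] tau_eq(2)[of "n + 1" n m] W_special e_special m n3 by (simp add: T_def)
  moreover have "(\<Sum>i = n + 2..<m. FL n (n + 2) m i + SL n (n + 2) m i) \<simeq> (\<Sum>i = n + 2..<m. T n m i)"
    by (rule tcong_sum) (rule ind)
  moreover have "{n..<m} = insert n (insert (n + 1) {n + 2..<m})"
    using m by auto
  moreover have "T n m n = 0"
    by (simp add: T_def tau_simps(4))
  ultimately have "TT (gr gg [n]) (sm (1 - sy (W (n + 2) m) n) (e (n + 2) m)) (X n)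
     + (\<Sum>i = n + 2..<m. FL n (n + 2) m i + SL n (n + 2) m i) \<simeq> (\<Sum>i = n..<m. T n m i)"
    by (simp add: tcong_add)
  then show ?thesis
    by (rule cop_leftI[rotated 8]) (use e_from_n(1,2)[of m] m n3 cop in auto)
qed

text \<open>Attaching x_n to \<open>e[n+1,m]\<close> creates the indices n - 1 and n. Index n is the
  term outside the sum. Index n - 1 is the one tail bracket that survives, [x_n, e[n+2,m]] = e[n,m],
  next to x_{n-1}; its scalar p(x_n,x_{n-1}) is tau at n - 1.\<close>

lemma cop_before_n:
  assumes m: "n + 2 \<le> m" "m < 2 * n" and cop: "cop (n + 1) m"
  shows "cop (n - 1) m"
proof -
  have d: "W (n + 1) (n + 1) = [n - 1]" "e (n + 1) (n + 1) = X (n - 1)"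
    using descending(1,2)[of "n - 1" "n + 1"] n3 by auto
  have d': "W (n - 1) (n - 1) = [n - 1]" "e (n - 1) (n - 1) = X (n - 1)"
    using W_letter[of "n - 1"] e_letter[of "n - 1"] n3 by auto
  have F0: "FL n (n + 1) m i \<simeq> 0" "sy (W (i + 1) m) n = 1" if i: "i \<in> {n + 2..<m}" for i
    using tail_commutes[of n "i + 1" m] i m n3 by auto
  have S: "SL n (n + 1) m i \<simeq> T (n - 1) m i" if i: "i \<in> {n + 1..<m}" for i
  proof (cases "i = n + 1")
    case True
    show ?thesis
      unfolding True
    proof (rule SL_cong)
      show "sy (W (n + 1 + 1) m) n = inverse q"
        using sy_values_right(6)[of m 1] m n3 by simp
      have "e (n - 1) (n + 1) = B (inverse q * pp (W (n - 1) n) [n - 1]) (e (n - 1) n) (X (n - 1))"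
        by (rule e_mid) (use n3 in auto)
      then show "B (pp [n] (W (n + 1) (n + 1)) * inverse q) (X n) (e (n + 1) (n + 1)) \<approx> e (n - 1) (n + 1)"
        unfolding d W_special e_special by (simp add: mult.commute)
      show "ta (n + 1) m (n + 1) = ta (n - 1) m (n + 1)"
        by (simp add: tau_eq(2))
      have "lt n (n + 1) = n - 1" "pr (n + 1) = n"
        by (auto simp: lt_def pr_def)
      then show "mset (W (n - 1) (n + 1)) = mset (n # W (n + 1) (n + 1))"
        using W_pr[of "n - 1" "n + 1"] n3 unfolding d by (simp add: W_special[simplified])
    qed
  next
    case False
    with i have i': "i \<in> {n + 2..<m}" by auto
    show ?thesis
    proof (rule SL_cong[OF F0(2)[OF i']])
      show "B (pp [n] (W (n + 1) i) * 1) (X n) (e (n + 1) i) \<approx> e (n - 1) i"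
        using e_from_n(3)[of i] i' m by simp
      show "ta (n + 1) m i = ta (n - 1) m i"
        using i by (simp add: tau_eq(2))
      show "mset (W (n - 1) i) = mset (n # W (n + 1) i)"
        using e_from_n(4)[of i] i' m by simp
    qed
  qed
  have FT: "FL n (n + 1) m (n + 1) = T (n - 1) m (n - 1)"
  proof -
    have "ta (n + 1) m (n + 1) = 1" "ta (n - 1) m (n - 1) = pp [n] [n - 1]" "n - 1 + 1 = n"
      using m n3 by (auto simp: tau_eq(2) tau_simps(2)[simplified])
    moreover have "B (pp [n] (W (n + 2) m)) (X n) (e (n + 2) m) = e n m"
      using e_from_n(1)[of m] m by simp
    ultimately show ?thesis
      unfolding FL_def T_def d d' by (simp add: mult.commute)
  qed
  have E: "TT (gr gg [n]) (sm (1 - sy (W (n + 1) m) n) (e (n + 1) m)) (X n) = T (n - 1) m n"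
    using sy_values_right(7)[of m 1] tau_simps(3)[of "n - 1" m] m n3 W_special e_special
    by (simp add: T_def)
  have "sum (FL n (n + 1) m) {n + 1..<m} \<simeq> T (n - 1) m (n - 1)"
    unfolding FT[symmetric] by (rule tcong_sum_single) (use F0 m in auto)
  moreover have "sum (SL n (n + 1) m) {n + 1..<m} \<simeq> sum (T (n - 1) m) {n + 1..<m}"
    by (rule tcong_sum) (rule S)
  ultimately have "T (n - 1) m n + (sum (FL n (n + 1) m) {n + 1..<m} + sum (SL n (n + 1) m) {n + 1..<m})
    \<simeq> T (n - 1) m n + (T (n - 1) m (n - 1) + sum (T (n - 1) m) {n + 1..<m})"
    by (intro tcong_add tcong_refl)
  moreover have "sum (T (n - 1) m) {n - 1..<m}
      = T (n - 1) m n + (T (n - 1) m (n - 1) + sum (T (n - 1) m) {n + 1..<m})"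
  proof -
    have "{n - 1..<m} = insert (n - 1) (insert n {n + 1..<m})" "n - 1 \<noteq> n" "n - 1 \<notin> {n + 1..<m}"
      using m n3 by auto
    then show ?thesis
      by (simp add: add.left_commute del: One_nat_def)
  qed
  ultimately have "TT (gr gg [n]) (sm (1 - sy (W (n + 1) m) n) (e (n + 1) m)) (X n)
     + (\<Sum>i = n + 1..<m. FL n (n + 1) m i + SL n (n + 1) m i) \<simeq> (\<Sum>i = n - 1..<m. T (n - 1) m i)"
    unfolding E sum.distrib by simp
  then show ?thesis
    by (rule cop_leftI[rotated 8]) (use e_from_n(3,4)[of m] m n3 cop in auto)
qed

text \<open>\<open>e(k+1,m)\<close> contains x_k at position f = 2n - k. Among the tails only the
  one starting at f + 1 has a surviving bracket with x_k, namely \<open>e[f,m]\<close>. It merges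
  with the summand t = f - 1, where the twist q prevents a direct extension to
  \<open>e[k,t]\<close>.\<close>

lemma cop_closing:
  assumes k: "1 \<le> k" "k + 2 \<le> n" "2 * n < k + m" "m < 2 * n" and cop: "cop (k + 1) m"
  shows "cop k m"
proof -
  define t where "t = 2 * n - k - 1"
  have t: "k + t + 1 = 2 * n"
    unfolding t_def using k(2) by linarith
  define f where "f = t + 1"
  have f: "f = t + 1" "k + f = 2 * n" "n < t" "f < m" "n < f" "f < 2 * n" "k + t + 1 = 2 * n" "2 \<le> k"
    "k + 1 \<le> t" "k \<noteq> n" "k + 1 \<noteq> n" "m \<noteq> n"
    unfolding f_def using k t by linarith+
  note d = descending[OF f(2,5,6)]
  have kk: "W k k = [k]" "e k k = X k"
    using W_letter[of k] e_letter[of k] k by auto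
  have good: "good [k]"
    using k by simp
  have ta: "ta (k + 1) m i = ta k m i" for i
    by (rule tau_eq(1)) (use f in auto)
  have Wc: "mset (W k i) = mset (k # W (k + 1) i)" if "i \<in> {k + 1..<m}" for i
    using mset_W_Cons[of k i] that k by simp
  have F0: "FL k (k + 1) m i \<simeq> 0" if i: "i \<in> {k + 1..<m}" "i \<noteq> f" for i
  proof -
    consider "i < t" | "i = t" | "f < i"
      using i f by linarith
    then show ?thesis
    proof cases
      case 1
      show ?thesis
        by (rule FL_J, rule inner_letter_commutes_right[of k t]) (use 1 i k f in auto)
    next
      case 2
      obtain l where l: "k = l + 1" "1 \<le> l"
        using f by (cases k) auto
      show ?thesis
        unfolding 2 f(1)[symmetric] using first_letter_commutes_right[of l f m] l k f
        by (intro FL_J) simp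
    next
      case 3
      then show ?thesis
        using tail_commutes(1)[of k "i + 1" m "k + 1"] i k f by simp
    qed
  qed
  let ?P = "pp [k] (W (k + 1) t)" and ?Q = "pp [k] (W (k + 1) f)" and ?a = "e (k + 1) t"
  have Wf: "mset (W (k + 1) f) = mset (W (k + 1) t @ [k])"
    using mset_W_split[of "k + 1" t "t + 1"] d(1) f(2-) unfolding f(1) by simp
  have PQ: "?Q = q * ?P"
    using pw_mset[OF refl Wf, of chi gg "[k]"] pp_letter_self[of k] k pp_append_right[OF good]
    by (simp add: mult.commute)
  obtain t0 where t0: "t = t0 + 1" "k + t0 + 2 = 2 * n"
    using f by (cases t) auto
  have f0: "f = t0 + 2"
    using f(1) t0(1) by simp
  note cl = closing_relations[OF k(1,2) t0(2)]
  have merge: "SL k (k + 1) m t + FL k (k + 1) m f \<simeq> T k m t"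
  proof -
    have ta1: "ta (k + 1) m t = 1" "ta (k + 1) m f = 1" "ta k m t = 1"
      using f by (auto simp: tau_eq(2,3))
    have s: "sy (W f m) k = q"
      using sy_values_right(3)[of m k f] f(2-) k by simp
    have g: "gr gg (W (k + 1) f) = gr gg (W k t)" "gr gg (k # W (k + 1) t) = gr gg (W k t)"
      using Wf Wc[of t] f(2-) by (auto intro!: gr_mset)
    have "SL k (k + 1) m t + FL k (k + 1) m f
      = TT (gr gg (W k t)) (sm c1 (e f m)) (B (?P * q) (X k) ?a + sm ?Q (e (k + 1) f))"
      unfolding SL_def FL_def s ta1 g f(1)[symmetric] d(4)[OF f(4) k(4), symmetric]
      by (simp add: TT_add_right TT_sm sm_sm mult.commute)
    moreover have "\<dots> \<simeq> T k m t"
      unfolding T_def ta1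
    proof (intro TT_cong)
      let ?r = "pp (W (k + 1) t) [k]"
      \<comment> \<open>For d = e(k+1,t) one has p(x_k,d) p(d,x_k) = q^{-2}. Hence multiplying the
        merging identity by \<open>?Q\<close> solves it for \<open>e[k,t]\<close>.\<close>
      have c: "?Q * (q * ?r) = 1"
        using sy_values_left(9)[of k t] f(2-) k q_nz unfolding PQ
        by (simp add: sy_def power2_eq_square field_simps)
      have "e (k + 1) f \<approx> sm (q * ?r) (e k t) + ?a * X k - sm (q * ?r) (X k * ?a)"
        using cl(1) unfolding f0 t0(1) by simp
      then have "B (?P * q) (X k) ?a + sm ?Q (e (k + 1) f)
        \<approx> B (?P * q) (X k) ?a + sm ?Q (sm (q * ?r) (e k t) + ?a * X k - sm (q * ?r) (X k * ?a))"
        by (intro cong_add cong_sm cong_refl)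
      moreover have "\<dots> = e k t"
        unfolding sm_add sm_diff sm_sm c unfolding PQ B_def mult.commute[of ?P q] by simp
      ultimately show "B (?P * q) (X k) ?a + sm ?Q (e (k + 1) f) \<approx> e k t"
        by simp
      show "sm c1 (e f m) \<approx> sm (1 * c1) (e (t + 1) m)"
        by (simp add: f(1))
    qed
    ultimately show ?thesis
      by simp
  qed
  have S: "SL k (k + 1) m i + (if i = t then FL k (k + 1) m f else 0) \<simeq> T k m i"
    if i: "i \<in> {k + 1..<m}" for i
  proof -
    consider "i < t" | "i = t" | "i = f" | "f < i"
      using f(1) by linarith
    then show ?thesis
    proof cases
      case 1
      have "SL k (k + 1) m i \<simeq> T k m i"
      proof (rule SL_cong[OF _ _ ta Wc[OF i]])
        show "sy (W (i + 1) m) k = 1"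
          using sy_values_right(2)[of m k "i + 1"] 1 i k f by simp
        show "B (pp [k] (W (k + 1) i) * 1) (X k) (e (k + 1) i) \<approx> e k i"
          using cong_sym[OF e_cons[of k i]] 1 i k f by simp
      qed
      then show ?thesis
        using 1 by simp
    next
      case 2
      then show ?thesis
        using merge by simp
    next
      case 3
      \<comment> \<open>\<open>e[k,f]\<close> lies on the line and is defined with x_k on the right;
        the twist q^{-1} fits its other description, with x_k on the left.\<close>
      have "SL k (k + 1) m f \<simeq> T k m f"
      proof (rule SL_cong[OF _ _ ta Wc])
        show "sy (W (f + 1) m) k = inverse q"
          using sy_values_right(4)[of m k "f + 1"] k f(2-) by simp
        show "B (pp [k] (W (k + 1) f) * inverse q) (X k) (e (k + 1) f) \<approx> e k f"
          using cl(2) unfolding f0 by (simp add: mult.commute)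
      qed (use i 3 in auto)
      then show ?thesis
        using 3 f by simp
    next
      case 4
      have "SL k (k + 1) m i \<simeq> T k m i"
      proof (rule SL_cong[OF _ _ ta Wc[OF i]])
        show "sy (W (i + 1) m) k = 1"
          using tail_commutes(2)[of k "i + 1" m] 4 i k f by simp
        have "sc k = k + 1" "fl k = k" "2 * n < i + k"
          using k f 4 by (auto simp: sc_def fl_def lt_def)
        then show "B (pp [k] (W (k + 1) i) * 1) (X k) (e (k + 1) i) \<approx> e k i"
          using e_right[of k i] 4 i k f by simp
      qed
      then show ?thesis
        using 4 f by simp
    qed
  qed
  have E: "TT (gr gg [k]) (sm (1 - sy (W (k + 1) m) k) (e (k + 1) m)) (X k) = T k m k"
  proof -
    have "sy (W (k + 1) m) k = inverse q" "ta k m k = 1"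
      using sy_values_right(1)[of m k] k by (auto simp: tau_eq(2,3))
    then show ?thesis
      by (simp add: T_def kk)
  qed
  have mem: "f \<in> {k + 1..<m}" "t \<in> {k + 1..<m}"
    using f(4,9) by (simp_all add: f(1))
  have "sum (FL k (k + 1) m) {k + 1..<m} \<simeq> FL k (k + 1) m f"
    by (rule tcong_sum_single[OF finite_atLeastLessThan mem(1) F0])
  then have 3: "sum (SL k (k + 1) m) {k + 1..<m} + sum (FL k (k + 1) m) {k + 1..<m}
      \<simeq> sum (SL k (k + 1) m) {k + 1..<m} + FL k (k + 1) m f"
    by (rule tcong_add[OF tcong_refl])
  have 2: "sum (SL k (k + 1) m) {k + 1..<m} + FL k (k + 1) m f \<simeq> sum (T k m) {k + 1..<m}"
  proof (rule tcong_sum_absorb[where a = t])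
    show "SL k (k + 1) m i + (if i = t then FL k (k + 1) m f else 0) \<simeq> T k m i"
      if "i \<in> {k + 1..<m}" for i
      using that by (rule S)
  qed (rule finite_atLeastLessThan, rule mem)
  note 1 = tcong_trans[OF 3 2]
  have "{k..<m} = insert k {k + 1..<m}"
    using f(4,9) unfolding f(1) by auto
  then have sums: "sum (T k m) {k..<m} = T k m k + sum (T k m) {k + 1..<m}"
    by simp
  have sc: "sc k = k + 1" "fl k = k"
    using k by (auto simp: sc_def fl_def lt_def)
  show ?thesis
  proof (rule cop_leftI[where s = "k + 1" and j = k])
    show "TT (gr gg [k]) (sm (1 - sy (W (k + 1) m) k) (e (k + 1) m)) (X k)
      + (\<Sum>i = k + 1..<m. FL k (k + 1) m i + SL k (k + 1) m i) \<simeq> sum (T k m) {k..<m}"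
      unfolding E sum.distrib sums add.commute[of "sum (FL k (k + 1) m) {k + 1..<m}"]
      by (rule tcong_add[OF tcong_refl 1])
    show "e k m = B (pp [k] (W (k + 1) m)) (X k) (e (k + 1) m)"
      using e_right[of k m] sc k f(4,9) by simp
    show "W k m = k # W (k + 1) m"
      using W_sc[of k m] sc k f(4,9) by simp
  qed (use k f(4,9) cop in auto)
qed

section \<open>The two inductions and the return to G<X>\<close>

lemma cop_left:
  assumes "1 \<le> k" "k < n" "k \<le> m" "m + k \<le> 2 * n"
  shows "cop k m"
  using assms(3,4)
proof (induction m rule: less_induct)
  case (less m)
  consider "m = k" | "k < m" "m < n" | "k < m" "m = n" "k + 2 \<le> n" | "k = n - 1" "m = n"
    | "n < m" "k + m = 2 * n" | "n < m" "k + m < 2 * n"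
    using less.prems assms n3 by linarith
  then show ?case
  proof cases
    case 1
    then show ?thesis using assms by (simp add: cop_self)
  next
    case 2
    then have "pr m < m" "k \<le> pr m"
      by (auto simp: pr_def)
    moreover from this 2 less.prems have "cop k (pr m)"
      by (intro less.IH) auto
    ultimately show ?thesis
      using 2 assms cop_ascending[of k m] by simp
  next
    case 3
    then have "pr m < m" "k \<le> pr m"
      using n3 by (auto simp: pr_def)
    moreover from this 3 less.prems have "cop k (pr m)"
      by (intro less.IH) auto
    ultimately show ?thesis
      using 3 assms cop_ascending[of k m] by simp
  next
    case 4
    then show ?thesis using cop_exceptional by simp
  next
    case 5
    then obtain p where "m = p + 1" by (cases m) auto
    moreover from this have "cop k p"
      using 5 less.prems assms by (intro less.IH) auto
    ultimately show ?thesis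
      using 5 assms cop_mid[of k p] by simp
  next
    case 6
    then obtain p where p: "m = p + 1" by (cases m) auto
    have "cop k p"
      using 6 p less.prems assms by (intro less.IH) auto
    moreover define j where "j = 2 * n - p - 1"
    have "k < j" "j + 1 \<le> n" "j + p + 1 = 2 * n"
      using 6 p by (auto simp: j_def)
    ultimately show ?thesis
      using assms p cop_past_middle[of k j p] by blast
  qed
qed

text \<open>Increasing k keeps m > 2n - k. The smaller element is not always
  \<open>e[k+1,m]\<close>: the words lead from n to n + 2 and from n - 1 to n + 1.\<close>

lemma cop_right:
  assumes "1 \<le> k" "k \<le> m" "m < 2 * n" "2 * n < k + m"
  shows "cop k m"
  using assms
proof (induction "2 * n - k" arbitrary: k rule: less_induct)
  case less
  have IH: "cop k' m" if "k < k'" "k' \<le> m" for k'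
    using less.hyps[of k'] less.prems that by auto
  consider "k = m" | "n < k" "k < m" | "k = n" "m = n + 1" | "k = n" "n + 2 \<le> m" | "k = n - 1" "n + 2 \<le> m"
    | "k + 2 \<le> n"
    using less.prems by linarith
  then show ?case
  proof cases
    case 1
    then show ?thesis using less.prems by (simp add: cop_self)
  next
    case 2
    then show ?thesis
      using less.prems IH[of "k + 1"] cop_descending[of k m] by simp
  next
    case 3
    then show ?thesis using cop_exceptional by simp
  next
    case 4
    then show ?thesis
      using less.prems IH[of "n + 2"] cop_from_n[of m] by simp
  next
    case 5
    then show ?thesis
      using less.prems IH[of "n + 1"] cop_before_n[of m] by simp
  next
    case 6
    then show ?thesis
      using less.prems IH[of "k + 1"] cop_closing[of k m] by simp
  qed
qed

lemma cop_all:
  assumes "1 \<le> k" "k \<le> m" "m < 2 * n"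
  shows "cop k m"
proof -
  consider "k < n" "m + k \<le> 2 * n" | "2 * n < k + m" | "k = n" "m = n"
    using assms by linarith
  then show ?thesis
    using assms by cases (simp_all add: cop_left cop_right cop_self)
qed

lemma TT_eq_tensor:
  assumes "1 \<le> k" "k \<le> m" "m < 2 * n"
  shows "TT 0 (e k m) 1 = tensor (ebr chi gg n q k m) aone"
    "TT (gr gg (W k m)) 1 (e k m) = tensor (grp (gr gg (W k m))) (ebr chi gg n q k m)"
proof -
  have one: "Poly_Mapping.single [] 1 = (1 :: 'k free_alg)"
    by (simp flip: zero_list_def)
  have "grp h = emh h 1" for h
    using emh_single[of h "[]" 1] by (simp add: grp_def one)
  then show "TT 0 (e k m) 1 = tensor (ebr chi gg n q k m) aone"
    "TT (gr gg (W k m)) 1 (e k m) = tensor (grp (gr gg (W k m))) (ebr chi gg n q k m)"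
    using assms by (simp_all add: TT_def emh_e aone_eq_emh)
qed

lemma T_eq_tensor:
  assumes "1 \<le> k" "k \<le> i" "i < m" "m < 2 * n"
  shows "T k m i = tensor (asmult (ta k m i * c1) (amul chi (grp (gr gg (W k i))) (ebr chi gg n q (i + 1) m)))
     (ebr chi gg n q k i)"
proof -
  have "emh (gr gg (W k i)) (e (i + 1) m) = amul chi (grp (gr gg (W k i))) (ebr chi gg n q (i + 1) m)"
    using amul_grp_emh[of "gr gg (W k i)" 0 "e (i + 1) m"] emh_e[of "i + 1" m] assms by simp
  then show ?thesis
    using assms by (simp add: T_def TT_def emh_sm emh_e)
qed

lemma coproduct_formula:
  assumes "1 \<le> k" "k \<le> m" "m < 2 * n"
  shows "Delta chi gg (ebr chi gg n q k m)
          - (tensor (ebr chi gg n q k m) aone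
             + tensor (grp (gr gg (ew n k m))) (ebr chi gg n q k m)
             + (\<Sum>i = k..m-1. tensor
                  (asmult (tau chi gg n k m i * (1 - inverse q))
                     (amul chi (grp (gr gg (ew n k i))) (ebr chi gg n q (i+1) m)))
                  (ebr chi gg n q k i)))
         \<in> tens_ker rel_ideal"
proof -
  \<comment> \<open>Here k \<ge> 1 matters: for m = k the interval {k..k - 1} is then empty.\<close>
  have "{k..m - 1} = {k..<m}"
    using assms by auto
  then have "(\<Sum>i = k..<m. T k m i) = (\<Sum>i = k..m-1. tensor
      (asmult (ta k m i * c1) (amul chi (grp (gr gg (W k i))) (ebr chi gg n q (i+1) m))) (ebr chi gg n q k i))"
    using assms by (intro sum.cong T_eq_tensor) auto
  then show ?thesis
    using cop_all[OF assms] assms by (simp add: cop_def tcong_def D_def emh_e TT_eq_tensor)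
qed

end

theorem theorem9p1:
  fixes chi :: "nat \<Rightarrow> 'g::ab_group_add \<Rightarrow> 'k::field"
    and gg :: "nat \<Rightarrow> 'g"
    and n k m :: nat
    and q :: 'k
  assumes n3: "n \<ge> 3"
    and char_hom: "\<And>i a b. 1 \<le> i \<Longrightarrow> i \<le> n \<Longrightarrow> chi i (a + b) = chi i a * chi i b"
    and char_nz: "\<And>i a. 1 \<le> i \<Longrightarrow> i \<le> n \<Longrightarrow> chi i a \<noteq> 0"
    and q_nz: "q \<noteq> 0" and q_ne: "q \<noteq> -1"
    and p_ii: "\<And>i. 1 \<le> i \<Longrightarrow> i \<le> n \<Longrightarrow> chi i (gg i) = q"
    and p_adj: "\<And>i. 1 < i \<Longrightarrow> i < n \<Longrightarrow> chi i (gg (i-1)) * chi (i-1) (gg i) = inverse q"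
    and p_n2n: "chi (n-2) (gg n) * chi n (gg (n-2)) = inverse q"
    and p_n1n: "chi (n-1) (gg n) * chi n (gg (n-1)) = 1"
    and p_other: "\<And>i j. 1 \<le> i \<Longrightarrow> i < j \<Longrightarrow> j \<le> n \<Longrightarrow> j > i + 1 \<Longrightarrow>
                    \<not> (i = n - 2 \<and> j = n) \<Longrightarrow> chi i (gg j) * chi j (gg i) = 1"
    and km: "1 \<le> k" "k \<le> m" "m < 2*n"
  shows "Delta chi gg (ebr chi gg n q k m)
          - (tensor (ebr chi gg n q k m) aone
             + tensor (grp (gr gg (ew n k m))) (ebr chi gg n q k m)
             + (\<Sum>i = k..m-1. tensor
                  (asmult (tau chi gg n k m i * (1 - inverse q))
                     (amul chi (grp (gr gg (ew n k i))) (ebr chi gg n q (i+1) m)))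
                  (ebr chi gg n q k i)))
         \<in> tens_ker (ideal_gen chi (relators chi gg n))"
proof -
  interpret quantum_so chi gg n q
    by unfold_locales (fact assms)+
  show ?thesis
    by (rule coproduct_formula[OF km])
qed

end
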